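(* Let $a=\{a_n\}_{n\in\mathbb{N}}$ be a complex sequence with $\sum_{n=1}^\infty|a_n|<\infty$, and define for $x>0$ $$f(x)=\sum_{n=1}^\infty\frac{a_n}{\sinh(\pi n/2)}\,\mathrm{Im}\left[J^2_{in/2}(x)\right].$$ For $x>0$ and $n\in\mathbb{N}$ let $$\Omega_n(x)=\int_0^\pi\left[x\,\mathbf{K}_0\big(2x\cosh u\big)-\frac{1}{\pi\cosh u}\right]\sinh(2u)\sin(nu)\,du.$$ Then for every $n\in\mathbb{N}$, $$a_n=\sinh(\pi n)\int_0^\infty\Omega_n(x)f(x)\,dx,$$ and the integral converges absolutely.
   Context: $J_{in/2}$ is the Bessel function of the first kind of imaginary order $in/2$; $\mathrm{Im}$ denotes the imaginary part. $\mathbf{K}_0$ is the Struve-type function $\mathbf{K}_0=\mathbf{H}_0-Y_0$, given for $x>0$ by $\mathbf{K}_0(x)=\frac{2}{\pi}\int_0^\infty e^{-x\sinh t}\,dt$. *)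

theory Defs
  imports "HOL-Analysis.Analysis"
begin

definition Bessel_J :: "complex \<Rightarrow> real \<Rightarrow> complex" where
  "Bessel_J \<nu> x =
     (\<Sum>k. ((-1) ^ k * rGamma (of_nat k + \<nu> + 1) / of_nat (fact k))
            * complex_of_real ((x / 2) ^ (2 * k)))
     * (complex_of_real (x / 2)) powr \<nu>"

text \<open>Struve-type function K_0 = H_0 - Y_0, for x > 0:
  K_0(x) = (2/pi) * integral over [0,infinity) of exp(-x sinh t) dt.\<close>
definition Struve_K0 :: "real \<Rightarrow> real" where
  "Struve_K0 x = 2 / pi * (LBINT t:{0..}. exp (- x * sinh t))"

definition Omega :: "nat \<Rightarrow> real \<Rightarrow> real" where
  "Omega n x = integral {0..pi}
     (\<lambda>u. (x * Struve_K0 (2 * x * cosh u) - 1 / (pi * cosh u)) * sinh (2 * u) * sin (real n * u))"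

end

theory Submission
  imports Defs "HOL-Real_Asymp.Real_Asymp"
begin

text \<open>
Write \<open>\<tau> = m\<close>. In the variable \<open>t = ln x\<close> Bessel's equation for order \<open>i\<sigma>\<close> reads
\<open>y'' = - (e\<^sup>2\<^sup>t + \<sigma>\<^sup>2) y\<close>, and a decreasing energy gives
\<open>|J\<^sub>i\<^sub>\<sigma>(x)|\<^sup>2 \<le> 2 sinh (\<pi>\<sigma>) / (\<pi>\<sigma>)\<close>. Hence the normalised summands of \<open>f\<close> are uniformly bounded
and, as \<open>\<Omega>\<^sub>n(x) = O(1 / (1 + x\<^sup>2))\<close>, everything converges absolutely and it suffices to
treat a single order.

Up to a factor the kernel of \<open>\<Omega>\<^sub>n\<close> is the Laplace transform of \<open>v / (1 + v\<^sup>2)\<^sup>3\<^sup>/\<^sup>2\<close> at \<open>2x cosh u\<close>.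
Neumann's formula writes \<open>J\<^sub>\<nu>\<^sup>2\<close> as an average of \<open>J\<^sub>2\<^sub>\<nu>\<close>, whose Laplace transform at \<open>sinh r\<close> is
\<open>e\<^sup>-\<^sup>i\<^sup>\<tau>\<^sup>r / cosh r\<close> (\<open>2\<nu> = i\<tau>\<close>). The averaging integral is then elementary, and the imaginary part
of what remains is the Fourier integral of \<open>sech\<close>, so the \<open>x\<close>-integral of the kernel against \<open>Im J\<^sub>\<nu>\<^sup>2\<close>
is a multiple of \<open>sin (\<tau>u) / (sinh u cosh (\<pi>\<tau>/2))\<close>. Orthogonality of the sines on \<open>[0, \<pi>]\<close> finishes the proof.
\<close>

section \<open>Substitution, Fubini and the Beta integral\<close>

text \<open>The Bessel functions enter all estimates only through a uniform bound, so every bit of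
  decay has to come from the other factor. This is what the term \<open>1 / (pi * cosh u)\<close> is
  for: \<open>z * Struve_K0 z\<close> tends to \<open>2 / pi\<close>, and subtracting that limit
  leaves a kernel of order \<open>1 / z^2\<close>. The Laplace transform is needed at every positive
  argument, while integrating the power series term by term would only reach arguments above 1. It
  is therefore obtained from a differential equation in r, with the solution singled out by its
  behaviour as r tends to infinity. The Laplace transform of the square is never evaluated; it is
  kept as an integral over the averaging variable q. Only the further integration against the weight
  in v makes it elementary, because a rescaling of v gathers all dependence on q in an algebraic
  factor. The imaginary part matters at the very end: the last integral runs over a half-line, and
  only its imaginary part has an even integrand, which extends to the whole line where the Fourier
  integral of sech is available.\<close>

lemma integral_substitution_line:
  fixes f :: "real \<Rightarrow> 'a :: euclidean_space" and g g' :: "real \<Rightarrow> real"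
  assumes f: "f \<in> borel_measurable borel"
    and cont: "continuous_on UNIV g'"
    and deriv: "\<And>x. (g has_field_derivative g' x) (at x)"
    and pos: "\<And>x. g' x > 0"
    and S: "range g = S" "S \<in> sets borel"
  shows "integrable lborel (\<lambda>x. g' x *\<^sub>R f (g x)) \<longleftrightarrow> set_integrable lborel S f"
    and "(LINT x|lborel. g' x *\<^sub>R f (g x)) = (LINT x:S|lborel. f x)"
proof -
  have [measurable]: "f \<in> borel_measurable borel" "S \<in> sets borel" by fact+
  have "continuous_on UNIV g"
    using deriv by (meson DERIV_isCont continuous_at_imp_continuous_on)
  then have [measurable]: "g \<in> borel_measurable borel" by (rule borel_measurable_continuous_onI)
  have [measurable]: "g' \<in> borel_measurable borel" using cont by (rule borel_measurable_continuous_onI)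
  have "strict_mono g"
    using deriv pos by (intro strict_monoI) (meson DERIV_pos_imp_increasing)
  then have inj: "inj_on g UNIV" by (rule strict_mono_imp_inj_on)
  have d: "(g has_field_derivative g' x) (at x within UNIV)" for x using deriv by simp
  have abs: "\<bar>g' x\<bar> = g' x" for x using pos[of x] by simp
  \<comment> \<open>The change of variables theorem speaks about the completed measure; Borel
    measurability of \<open>f\<close> transfers both integrability claims to
    \<open>lborel\<close>.\<close>
  have eqS: "set_integrable lebesgue S f \<longleftrightarrow> set_integrable lborel S f"
    unfolding set_integrable_def by (subst integrable_completion) auto
  have eqU: "set_integrable lebesgue UNIV (\<lambda>x. g' x *\<^sub>R f (g x)) \<longleftrightarrow> integrable lborel (\<lambda>x. g' x *\<^sub>R f (g x))"
    unfolding set_integrable_def by (subst integrable_completion) auto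
  note cv = has_absolute_integral_change_of_variables_real[where S=UNIV and g=g and h=g' and f=f, OF _ d inj, unfolded S abs eqS eqU, simplified]
  show int: "integrable lborel (\<lambda>x. g' x *\<^sub>R f (g x)) \<longleftrightarrow> set_integrable lborel S f"
    using cv by blast
  show "(LINT x|lborel. g' x *\<^sub>R f (g x)) = (LINT x:S|lborel. f x)"
  proof (cases "set_integrable lborel S f")
    case True
    then have I: "integrable lborel (\<lambda>x. g' x *\<^sub>R f (g x))" using int by simp
    have "integral UNIV (\<lambda>x. g' x *\<^sub>R f (g x)) = integral S f" using cv I by blast
    then show ?thesis
      using set_borel_integral_eq_integral(2)[OF True] integral_lborel[OF I] by simp
  next
    \<comment> \<open>Without integrability on either side, both integrals take the default value 0
      and still agree.\<close>
    case False
    then show ?thesis using int 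
      by (simp add: not_integrable_integral_eq set_lebesgue_integral_def set_integrable_def)
  qed
qed

text \<open>A majorant that splits into a function of x times a function of y reduces joint
  integrability to two one-dimensional integrals. The uniform bound on the Bessel functions makes
  such majorants available.\<close>

lemma integrable_prod_dominated:
  fixes h :: "real \<Rightarrow> real \<Rightarrow> 'a :: {banach, second_countable_topology}" and f g :: "real \<Rightarrow> real"
  assumes [measurable]: "case_prod h \<in> borel_measurable (lborel \<Otimes>\<^sub>M lborel)"
    and f: "integrable lborel f" and g: "integrable lborel g"
    and le: "\<And>x y. norm (h x y) \<le> f x * g y"
  shows "integrable (lborel \<Otimes>\<^sub>M lborel) (case_prod h)"
proof -
  have [measurable]: "f \<in> borel_measurable borel" "g \<in> borel_measurable borel"
    using f g by auto
  have "integrable (lborel \<Otimes>\<^sub>M lborel) (\<lambda>(x, y). f x * g y)"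
  proof (rule lborel_pair.Fubini_integrable)
    show "integrable lborel (\<lambda>x. LINT y|lborel. norm (case (x, y) of (x, y) \<Rightarrow> f x * g y))"
      using f by (simp add: abs_mult)
    show "AE x in lborel. integrable lborel (\<lambda>y. case (x, y) of (x, y) \<Rightarrow> f x * g y)"
      using g by simp
  qed simp
  then show ?thesis
  proof (rule Bochner_Integration.integrable_bound)
    show "AE x in lborel \<Otimes>\<^sub>M lborel. norm (case x of (x, y) \<Rightarrow> h x y) \<le> norm (case x of (x, y) \<Rightarrow> f x * g y)"
      by (rule AE_I2) (use le in \<open>auto intro: order_trans[OF _ abs_ge_self]\<close>)
  qed simp
qed

lemma Fubini_dominated:
  fixes h :: "real \<Rightarrow> real \<Rightarrow> 'a :: {banach, second_countable_topology}" and f g :: "real \<Rightarrow> real"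
  assumes "case_prod h \<in> borel_measurable (lborel \<Otimes>\<^sub>M lborel)"
    and "integrable lborel f" and "integrable lborel g"
    and "\<And>x y. norm (h x y) \<le> f x * g y"
  shows "(LINT x|lborel. LINT y|lborel. h x y) = (LINT y|lborel. LINT x|lborel. h x y)"
  using lborel_pair.Fubini_integral[OF integrable_prod_dominated[OF assms]] by simp

text \<open>Euler's integral after t = e^s. On the whole line, scalings of t become translations of
  s, which is how the integral is used below.\<close>

lemma Gamma_line_integral:
  assumes "Re a > 0"
  shows "has_bochner_integral lborel (\<lambda>s. exp (a * of_real s - of_real (exp s))) (Gamma a)"
proof -
  let ?f = "\<lambda>t. exp ((a - 1) * of_real (ln t)) / of_real (exp t) :: complex"
  have m: "?f \<in> borel_measurable borel" by measurable
  have R: "range (exp :: real \<Rightarrow> real) = {0<..}"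
    by (auto simp: image_iff intro: exp_ln[symmetric])
  have eq: "exp s *\<^sub>R ?f (exp s) = exp (a * of_real s - of_real (exp s))" for s :: real
    by (simp add: scaleR_conv_of_real exp_diff algebra_simps flip: exp_of_real)
  note sub = integral_substitution_line[where f="?f" and g=exp and g'=exp and S="{0<..}", OF m _ DERIV_exp exp_gt_zero R]
  have pw: "?f t = of_real t powr (a - 1) / of_real (exp t)" if "t \<in> {0<..}" for t
    using that by (simp add: powr_def Ln_of_real)
  have "?f absolutely_integrable_on {0<..}"
    by (subst set_integrable_cong[OF refl refl pw]) (simp_all add: absolutely_integrable_Gamma_integral'[OF assms] del: of_real_exp)
  then have leb: "set_integrable lborel {0<..} ?f"
    unfolding set_integrable_def by (subst (asm) integrable_completion) auto
  have "(?f has_integral Gamma a) {0<..}"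
    by (subst has_integral_cong[OF pw]) (use Gamma_integral_complex'[OF assms] in simp_all)
  then have "(LINT t:{0<..}|lborel. ?f t) = Gamma a"
    using set_borel_integral_eq_integral(2)[OF leb] by (simp add: integral_unique)
  then show ?thesis
    using sub leb unfolding eq by (simp add: has_bochner_integral_iff continuous_on_exp)
qed

lemma not_nonpos_Ints_if_Re_pos: "Re z > 0 \<Longrightarrow> z \<notin> \<int>\<^sub>\<le>\<^sub>0"
  by (auto elim!: nonpos_Ints_cases)

lemma Gamma_nonzero_if_Re_pos: "Re z > 0 \<Longrightarrow> Gamma z \<noteq> 0"
  by (simp add: Gamma_eq_zero_iff not_nonpos_Ints_if_Re_pos)

text \<open>The positive-exponent double integral \<open>H\<close> is evaluated in both orders: over
  y first, the variable t + 2y separates off \<open>Gamma a / 2\<close>; over t first, a translation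
  by ln (1 + e^(2y)) separates off \<open>Gamma (a + b)\<close> and leaves
  \<open>h y\<close>.\<close>

lemma Beta_line_integral:
  assumes a: "Re a > 0" and b: "Re b > 0"
  defines "h \<equiv> \<lambda>y. exp (2 * a * of_real y - (a + b) * of_real (ln (1 + exp (2 * y))))"
  shows "has_bochner_integral lborel h (Gamma a * Gamma b / (2 * Gamma (a + b)))"
proof -
  define H where "H = (\<lambda>a b (t::real) (y::real). exp ((a + b) * of_real t + 2 * a * of_real y - of_real (exp t * (1 + exp (2 * y)))) :: complex)"
  have ab: "Re (a + b) > 0" using a b by simp
  have [measurable]: "case_prod (H a b) \<in> borel_measurable (lborel \<Otimes>\<^sub>M lborel)" for a b
    unfolding H_def by measurable
  have inner: "has_bochner_integral lborel (H a b t) (Gamma a * exp (b * of_real t - of_real (exp t)) / 2)"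
    if "Re a > 0" for a b t
  proof -
    have eq: "exp (a * of_real (t + 2 * y) - of_real (exp (t + 2 * y))) * exp (b * of_real t - of_real (exp t)) = H a b t y" for y
      unfolding H_def by (simp add: algebra_simps exp_add flip: exp_add exp_of_real)
    note G = Gamma_line_integral[OF that]
    have I: "integrable lborel (\<lambda>y. exp (a * of_real (t + 2 * y) - of_real (exp (t + 2 * y))))"
      by (rule lborel_integrable_real_affine) (use G in \<open>auto simp: has_bochner_integral_iff\<close>)
    have "(LINT y|lborel. exp (a * of_real (t + 2 * y) - of_real (exp (t + 2 * y)))) = Gamma a / 2"
      using G lborel_integral_real_affine[of 2 "\<lambda>s. exp (a * of_real s - of_real (exp s))" t]
      by (simp add: has_bochner_integral_iff scaleR_conv_of_real mult.commute[of _ 2])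
    with I have "has_bochner_integral lborel (\<lambda>y. exp (a * of_real (t + 2 * y) - of_real (exp (t + 2 * y)))) (Gamma a / 2)"
      by (simp add: has_bochner_integral_iff)
    from has_bochner_integral_mult_left[where c="exp (b * of_real t - of_real (exp t))", OF this]
    show ?thesis unfolding eq by (simp add: mult.commute)
  qed
  \<comment> \<open>The modulus of \<open>H\<close> is \<open>H\<close> with both parameters
    replaced by their real parts, so \<open>inner\<close> also computes the integral of the norm
    required by Fubini's theorem.\<close>
  have norm_H: "complex_of_real (norm (H a b t y)) = H (of_real (Re a)) (of_real (Re b)) t y" for t y
    unfolding H_def by (simp only: norm_exp_eq_Re flip: exp_of_real) simp
  have int: "integrable (lborel \<Otimes>\<^sub>M lborel) (case_prod (H a b))"
  proof (rule lborel_pair.Fubini_integrable)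
    have "integrable lborel (\<lambda>t. Gamma (of_real (Re a)) * exp (of_real (Re b) * of_real t - of_real (exp t)) / 2 :: complex)"
      using Gamma_line_integral[of "of_real (Re b)"] b
      by (intro integrable_divide integrable_mult_right) (auto simp: has_bochner_integral_iff)
    moreover have "complex_of_real (LINT y|lborel. norm (H a b t y)) = Gamma (of_real (Re a)) * exp (of_real (Re b) * of_real t - of_real (exp t)) / 2" for t
      using inner[of "of_real (Re a)" "of_real (Re b)" t] a
      by (simp add: has_bochner_integral_iff norm_H flip: integral_complex_of_real)
    ultimately have "integrable lborel (\<lambda>t. complex_of_real (LINT y|lborel. norm (H a b t y)))"
      by (simp only:)
    then show "integrable lborel (\<lambda>t. LINT y|lborel. norm (case_prod (H a b) (t, y)))"
      by (simp add: complex_of_real_integrable_eq)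
    show "AE t in lborel. integrable lborel (\<lambda>y. case_prod (H a b) (t, y))"
      using inner[OF a] by (auto simp: has_bochner_integral_iff)
  qed simp
  have outer: "(LINT t|lborel. H a b t y) = Gamma (a + b) * h y" for y
  proof -
    let ?l = "ln (1 + exp (2 * y))"
    have p: "1 + exp (2 * y) > 0" by (smt (verit) exp_gt_zero)
    have e: "exp (t - ?l) * (1 + exp (2 * y)) = exp t" for t
      using p by (simp add: exp_diff)
    have "(LINT t|lborel. H a b t y) = (LINT t|lborel. H a b (- ?l + 1 * t) y)"
      by (subst lborel_integral_real_affine[of 1 _ "- ?l"]) auto
    also have "\<dots> = (LINT t|lborel. exp ((a + b) * of_real t - of_real (exp t)) * h y)"
      unfolding H_def h_def using e
      by (intro Bochner_Integration.integral_cong refl) (simp add: algebra_simps exp_add flip: exp_add)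
    also have "\<dots> = Gamma (a + b) * h y"
      using Gamma_line_integral[OF ab] by (simp add: has_bochner_integral_iff)
    finally show ?thesis .
  qed
  have G0: "Gamma (a + b) \<noteq> 0" using ab by (rule Gamma_nonzero_if_Re_pos)
  have "integrable lborel (\<lambda>y. LINT t|lborel. H a b t y)"
    by (rule lborel_pair.integrable_snd[OF int])
  then have "integrable lborel (\<lambda>y. Gamma (a + b) * h y / Gamma (a + b))"
    unfolding outer by (rule integrable_divide)
  then have 1: "integrable lborel h" using G0 by simp
  have "Gamma (a + b) * (LINT y|lborel. h y) = (LINT y|lborel. LINT t|lborel. H a b t y)"
    unfolding outer by simp
  also have "\<dots> = (LINT t|lborel. LINT y|lborel. H a b t y)"
    using lborel_pair.Fubini_integral[OF int] by simp
  also have "\<dots> = (LINT t|lborel. Gamma a * exp (b * of_real t - of_real (exp t)) / 2)"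
    by (simp only: has_bochner_integral_integral_eq[OF inner[OF a]])
  also have "\<dots> = Gamma a * Gamma b / 2"
    using Gamma_line_integral[OF b] by (simp add: has_bochner_integral_iff)
  finally show ?thesis using 1 G0 by (simp add: has_bochner_integral_iff field_simps)
qed

section \<open>Bessel functions of imaginary order\<close>

definition Bessel_coeff :: "complex \<Rightarrow> nat \<Rightarrow> complex" where
  "Bessel_coeff \<nu> k = (-1) ^ k * rGamma (of_nat k + \<nu> + 1) / of_nat (fact k)"

text \<open>The entire factor of the Bessel function: J_\<nu>(x) is (x/2)^\<nu> times
  \<open>Bessel_entire\<close> at (x/2)^2. Up to the sign of its argument it is the Bessel-Clifford
  function. Splitting it off confines the branch point at 0 to an exponential.\<close>

definition Bessel_entire :: "complex \<Rightarrow> complex \<Rightarrow> complex" where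
  "Bessel_entire \<nu> z = (\<Sum>k. Bessel_coeff \<nu> k * z ^ k)"

lemma of_nat_fact_Suc:
  "(of_nat (fact (Suc k)) :: 'a :: comm_semiring_1) = of_nat (Suc k) * of_nat (fact k)"
  by (simp only: fact_Suc of_nat_mult of_nat_id)

lemma Bessel_coeff_diffs: "diffs (Bessel_coeff \<nu>) k = - Bessel_coeff (\<nu> + 1) k"
proof -
  have nz: "complex_of_nat (Suc k) \<noteq> 0" by (rule of_nat_neq_0)
  have e: "of_nat (Suc k) + \<nu> + 1 = of_nat k + (\<nu> + 1) + 1" by simp
  show ?thesis
    unfolding diffs_def Bessel_coeff_def of_nat_fact_Suc e using nz by (simp del: of_nat_Suc of_nat_fact fact_Suc)
qed

lemma Bessel_coeff_rec:
  "of_nat (Suc k) * (of_nat (Suc k) + \<nu>) * Bessel_coeff \<nu> (Suc k) = - Bessel_coeff \<nu> k"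
proof -
  have "(of_nat (Suc k) + \<nu>) * rGamma (of_nat (Suc k) + \<nu> + 1) = rGamma (of_nat k + \<nu> + 1)"
    using rGamma_plus1[of "of_nat (Suc k) + \<nu>"] by (simp add: add_ac)
  then have "of_nat (Suc k) * ((of_nat (Suc k) + \<nu>) * rGamma (of_nat (Suc k) + \<nu> + 1)) / of_nat (fact (Suc k))
      = rGamma (of_nat k + \<nu> + 1) / of_nat (fact k)"
    unfolding of_nat_fact_Suc using of_nat_neq_0[where 'a=complex, of k] by (simp del: of_nat_Suc of_nat_fact)
  then show ?thesis
    unfolding Bessel_coeff_def power_Suc
    by (simp only: minus_mult_left[symmetric] mult_1 mult_ac minus_divide_left[symmetric] minus_mult_right[symmetric] times_divide_eq_right[symmetric])
qed

text \<open>In the coefficient recursion the factor k + 1 + \<nu> has modulus at least 1 when Re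
  \<nu> is nonnegative; dropping it leaves the exponential series as a majorant, with no asymptotics
  of the Gamma function.\<close>

lemma norm_Bessel_coeff_le:
  assumes "Re \<nu> \<ge> 0"
  shows "norm (Bessel_coeff \<nu> k) \<le> norm (rGamma (\<nu> + 1)) / fact k"
proof (induction k)
  case 0 show ?case by (simp add: Bessel_coeff_def)
next
  case (Suc k)
  have "1 \<le> Re (of_nat (Suc k) + \<nu>)" using assms by simp
  also have "\<dots> \<le> norm (of_nat (Suc k) + \<nu>)" by (rule complex_Re_le_cmod)
  finally have 1: "1 \<le> norm (of_nat (Suc k) + \<nu>)" .
  have "real (Suc k) * norm (Bessel_coeff \<nu> (Suc k)) * 1 \<le> real (Suc k) * norm (Bessel_coeff \<nu> (Suc k)) * norm (of_nat (Suc k) + \<nu>)"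
    by (intro mult_left_mono 1) auto
  also have "\<dots> = norm (of_nat (Suc k) * (of_nat (Suc k) + \<nu>) * Bessel_coeff \<nu> (Suc k))"
    by (simp add: norm_mult del: of_nat_Suc)
  also have "\<dots> \<le> norm (rGamma (\<nu> + 1)) / fact k"
    unfolding Bessel_coeff_rec using Suc.IH by simp
  finally show ?case by (simp add: pos_le_divide_eq mult_ac del: of_nat_Suc)
qed

lemma summable_norm_Bessel_coeff:
  assumes "Re \<nu> \<ge> 0"
  shows "summable (\<lambda>k. norm (Bessel_coeff \<nu> k * z ^ k))"
proof (rule summable_comparison_test')
  show "summable (\<lambda>k. norm (rGamma (\<nu> + 1)) * (inverse (fact k) * norm z ^ k))"
    by (intro summable_mult summable_exp)
  show "norm (norm (Bessel_coeff \<nu> k * z ^ k)) \<le> norm (rGamma (\<nu> + 1)) * (inverse (fact k) * norm z ^ k)" for k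
    using mult_right_mono[OF norm_Bessel_coeff_le[OF assms, of k], of "norm z ^ k"]
    by (simp add: norm_mult norm_power field_simps)
qed

lemma Bessel_entire_sums:
  assumes "Re \<nu> \<ge> 0"
  shows "(\<lambda>k. Bessel_coeff \<nu> k * z ^ k) sums Bessel_entire \<nu> z"
  unfolding Bessel_entire_def
  by (rule summable_sums[OF summable_norm_cancel[OF summable_norm_Bessel_coeff[OF assms]]])

lemma DERIV_Bessel_entire:
  assumes "Re \<nu> \<ge> 0"
  shows "(Bessel_entire \<nu> has_field_derivative - Bessel_entire (\<nu> + 1) z) (at z)"
proof -
  have "(\<Sum>k. diffs (Bessel_coeff \<nu>) k * z ^ k) = - Bessel_entire (\<nu> + 1) z"
    using Bessel_entire_sums[of "\<nu> + 1" z] assms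
    by (simp add: Bessel_coeff_diffs Bessel_entire_def suminf_minus sums_iff)
  then show ?thesis
    using termdiffs_strong_converges_everywhere[of "Bessel_coeff \<nu>" z] Bessel_entire_sums[OF assms]
    unfolding Bessel_entire_def by (simp add: sums_iff)
qed

text \<open>Since differentiation raises the index with a minus sign, this recurrence is the
  differential equation z E'' + (\<nu> + 1) E' + E = 0 in disguise, hence Bessel's equation.\<close>

lemma Bessel_entire_rec:
  assumes "Re \<nu> \<ge> 0"
  shows "z * Bessel_entire (\<nu> + 2) z = (\<nu> + 1) * Bessel_entire (\<nu> + 1) z - Bessel_entire \<nu> z"
proof -
  have rec: "(\<nu> + 1) * Bessel_coeff (\<nu> + 1) (Suc k) - Bessel_coeff \<nu> (Suc k) = Bessel_coeff (\<nu> + 2) k" for k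
  proof -
    define w where "w = of_nat k + \<nu> + 2"
    have "w * rGamma (w + 1) = rGamma w" by (rule rGamma_plus1)
    then have 1: "(\<nu> + 1) * rGamma (w + 1) - rGamma w = - of_nat (Suc k) * rGamma (w + 1)"
      unfolding w_def by (simp add: algebra_simps)
    have "(\<nu> + 1) * Bessel_coeff (\<nu> + 1) (Suc k) - Bessel_coeff \<nu> (Suc k)
        = (-1) ^ Suc k * ((\<nu> + 1) * rGamma (w + 1) - rGamma w) / of_nat (fact (Suc k))"
      unfolding w_def Bessel_coeff_def by (simp add: algebra_simps diff_divide_distrib)
    also have "\<dots> = (-1) ^ k * rGamma (w + 1) / of_nat (fact k)"
      unfolding 1 of_nat_fact_Suc using of_nat_neq_0[where 'a=complex, of k] by (simp del: of_nat_Suc of_nat_fact)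
    finally show ?thesis by (simp add: w_def Bessel_coeff_def algebra_simps)
  qed
  \<comment> \<open>The constant terms cancel, so the difference of the two series starts at index 1
    and supplies the factor z on the left.\<close>
  have 0: "(\<nu> + 1) * Bessel_coeff (\<nu> + 1) 0 - Bessel_coeff \<nu> 0 = 0"
    using rGamma_plus1[of "\<nu> + 1"] by (simp add: Bessel_coeff_def add_ac)
  have "(\<lambda>k. ((\<nu> + 1) * Bessel_coeff (\<nu> + 1) k - Bessel_coeff \<nu> k) * z ^ k) sums
      ((\<nu> + 1) * Bessel_entire (\<nu> + 1) z - Bessel_entire \<nu> z)"
    using sums_diff[OF sums_mult[OF Bessel_entire_sums[of "\<nu> + 1" z], of "\<nu> + 1"] Bessel_entire_sums[of \<nu> z]] assms
    by (simp add: algebra_simps)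
  then have "(\<lambda>k. Bessel_coeff (\<nu> + 2) k * z ^ Suc k) sums
      ((\<nu> + 1) * Bessel_entire (\<nu> + 1) z - Bessel_entire \<nu> z)"
    using sums_Suc_iff[of "\<lambda>k. ((\<nu> + 1) * Bessel_coeff (\<nu> + 1) k - Bessel_coeff \<nu> k) * z ^ k"]
    unfolding rec 0 by simp
  moreover have "(\<lambda>k. Bessel_coeff (\<nu> + 2) k * z ^ Suc k) sums (z * Bessel_entire (\<nu> + 2) z)"
    using sums_mult[OF Bessel_entire_sums[of "\<nu> + 2" z], of z] assms by (simp add: algebra_simps)
  ultimately show ?thesis by (rule sums_unique2[symmetric])
qed

section \<open>Bessel's equation in the logarithmic variable and the energy bound\<close>

definition Bessel_exp :: "complex \<Rightarrow> real \<Rightarrow> complex" where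
  "Bessel_exp \<nu> t = Bessel_entire \<nu> (of_real (exp (2 * t) / 4)) * exp (\<nu> * of_real (t - ln 2))"

text \<open>The derivative of J_\<nu>(e^t) in t, that is x J_\<nu>'(x) at x = e^t. The closed form
  gives access both to the second derivative and to the limit as t tends to minus infinity.\<close>

definition Bessel_exp' :: "complex \<Rightarrow> real \<Rightarrow> complex" where
  "Bessel_exp' \<nu> t = (\<nu> * Bessel_entire \<nu> (of_real (exp (2 * t) / 4))
     - of_real (exp (2 * t) / 2) * Bessel_entire (\<nu> + 1) (of_real (exp (2 * t) / 4))) * exp (\<nu> * of_real (t - ln 2))"

lemma Bessel_J_eq:
  assumes "x > 0"
  shows "Bessel_J \<nu> x = Bessel_entire \<nu> (of_real ((x / 2)\<^sup>2)) * exp (\<nu> * of_real (ln (x / 2)))"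
proof -
  have "complex_of_real (x / 2) powr \<nu> = exp (\<nu> * of_real (ln (x / 2)))"
    unfolding powr_def using assms Ln_of_real[of "x / 2"] by (simp del: of_real_divide)
  moreover have "complex_of_real ((x / 2) ^ (2 * k)) = of_real ((x / 2)\<^sup>2) ^ k" for k
    by (simp only: power_mult of_real_power)
  ultimately show ?thesis
    by (simp only: Bessel_J_def Bessel_entire_def Bessel_coeff_def)
qed

lemma Bessel_exp_eq: "Bessel_exp \<nu> t = Bessel_J \<nu> (exp t)"
proof -
  have "(exp t / 2)\<^sup>2 = exp (2 * t) / 4" "ln (exp t / 2) = t - ln 2"
    by (simp_all only: power_divide exp_double) (simp_all add: ln_div)
  then show ?thesis by (simp only: Bessel_J_eq[OF exp_gt_zero] Bessel_exp_def)
qed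

text \<open>In the variable t = ln x the first-order term of Bessel's equation disappears, which is
  what makes a simple energy argument possible.\<close>

lemma Bessel_exp_deriv:
  assumes "Re \<nu> \<ge> 0"
  shows "(Bessel_exp \<nu> has_vector_derivative Bessel_exp' \<nu> t) (at t)"
    and "(Bessel_exp' \<nu> has_vector_derivative (\<nu>\<^sup>2 - of_real (exp (2 * t))) * Bessel_exp \<nu> t) (at t)"
proof -
  let ?z = "\<lambda>t. of_real (exp (2 * t) / 4) :: complex"
  have dz: "(?z has_vector_derivative 2 * ?z t) (at t)"
    by (rule has_vector_derivative_eq_rhs[OF has_vector_derivative_of_real[where D="2 * exp (2 * t) / 4"]])
       (auto intro!: derivative_eq_intros)
  have F: "((\<lambda>t. Bessel_entire \<mu> (?z t)) has_vector_derivative - 2 * ?z t * Bessel_entire (\<mu> + 1) (?z t)) (at t)"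
    if "Re \<mu> \<ge> 0" for \<mu>
    using field_vector_diff_chain_at[OF dz DERIV_Bessel_entire[OF that, of "?z t"]] 
    by (simp add: o_def)
  have E: "((\<lambda>t. exp (\<nu> * of_real (t - ln 2))) has_vector_derivative \<nu> * exp (\<nu> * of_real (t - ln 2))) (at t)"
  proof -
    have "((\<lambda>t. \<nu> * of_real (t - ln 2)) has_vector_derivative \<nu>) (at t)"
      by (auto intro!: derivative_eq_intros has_vector_derivative_of_real[where D=1, THEN has_vector_derivative_mult_right[where a=\<nu>], THEN has_vector_derivative_eq_rhs] simp del: of_real_diff)
    from field_vector_diff_chain_at[OF this DERIV_exp]
    show ?thesis by (simp add: o_def)
  qed
  have nu1: "Re (\<nu> + 1) \<ge> 0" using assms by simp
  show "(Bessel_exp \<nu> has_vector_derivative Bessel_exp' \<nu> t) (at t)"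
    unfolding Bessel_exp_def[abs_def] Bessel_exp'_def
    by (rule has_vector_derivative_eq_rhs[OF has_vector_derivative_mult[OF F[OF assms] E]])
       (simp add: algebra_simps)
  \<comment> \<open>Here F, G, H stand for the entire factors of index \<nu>, \<nu> + 1, \<nu> + 2
    at z, and E for the exponential. The two sides differ by 4zE times the recurrence of
    \<open>Bessel_entire_rec\<close>.\<close>
  have gen: "(\<nu> * F - (2 * z) * G) * (\<nu> * E) + (\<nu> * (- 2 * z * G) - ((2 * z) * (- 2 * z * H) + (2 * (2 * z)) * G)) * E
      = (\<nu>\<^sup>2 - 4 * z) * F * E" if "z * H = (\<nu> + 1) * G - F" for E F G H z :: complex
  proof -
    have "(\<nu> * F - (2 * z) * G) * (\<nu> * E) + (\<nu> * (- 2 * z * G) - ((2 * z) * (- 2 * z * H) + (2 * (2 * z)) * G)) * E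
      = (\<nu>\<^sup>2 - 4 * z) * F * E + 4 * z * E * (z * H - ((\<nu> + 1) * G - F))"
      by (simp add: algebra_simps power2_eq_square)
    then show ?thesis using that by simp
  qed
  have z2: "2 * ?z t = of_real (exp (2 * t) / 2)" for t by simp
  have rec: "?z t * Bessel_entire (\<nu> + 1 + 1) (?z t) = (\<nu> + 1) * Bessel_entire (\<nu> + 1) (?z t) - Bessel_entire \<nu> (?z t)"
    using Bessel_entire_rec[OF assms] by (simp add: add.assoc)
  have D: "(Bessel_exp' \<nu> has_vector_derivative
      (\<nu> * Bessel_entire \<nu> (?z t) - (2 * ?z t) * Bessel_entire (\<nu> + 1) (?z t)) * (\<nu> * exp (\<nu> * of_real (t - ln 2))) +
      (\<nu> * (- 2 * ?z t * Bessel_entire (\<nu> + 1) (?z t)) - ((2 * ?z t) * (- 2 * ?z t * Bessel_entire (\<nu> + 1 + 1) (?z t)) + (2 * (2 * ?z t)) * Bessel_entire (\<nu> + 1) (?z t)))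
         * exp (\<nu> * of_real (t - ln 2))) (at t)"
    unfolding Bessel_exp'_def[abs_def] z2[symmetric]
    by (rule has_vector_derivative_mult[OF has_vector_derivative_diff[OF
          has_vector_derivative_mult_right[OF F[OF assms]]
          has_vector_derivative_mult[OF has_vector_derivative_mult_right[OF dz] F[OF nu1]]] E])
  have "(\<nu>\<^sup>2 - 4 * ?z t) * Bessel_entire \<nu> (?z t) * exp (\<nu> * of_real (t - ln 2))
      = (\<nu>\<^sup>2 - of_real (exp (2 * t))) * Bessel_exp \<nu> t"
    unfolding Bessel_exp_def mult.assoc by simp
  from trans[OF gen[OF rec] this] show "(Bessel_exp' \<nu> has_vector_derivative (\<nu>\<^sup>2 - of_real (exp (2 * t))) * Bessel_exp \<nu> t) (at t)"
    by (rule has_vector_derivative_eq_rhs[OF D])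
qed

lemma of_real_sinh_complex: "complex_of_real (sinh r) = sinh (of_real r)"
  by (simp only: sinh_field_def exp_of_real of_real_minus[symmetric] of_real_diff of_real_divide of_real_numeral)

text \<open>The conjugate of 1 + is is 1 - is, so the squared modulus is a product to which Euler's
  reflection formula applies after multiplication by z (-z) with z = is. The value is half the limit
  of the energy at minus infinity.\<close>

lemma norm_rGamma_imag_sq:
  assumes "s \<noteq> 0"
  shows "(norm (rGamma (1 + \<i> * of_real s)))\<^sup>2 = sinh (pi * s) / (pi * s)"
proof -
  let ?z = "\<i> * complex_of_real s"
  have z: "?z \<noteq> 0" using assms by simp
  have "complex_of_real ((norm (rGamma (1 + ?z)))\<^sup>2) = rGamma (?z + 1) * rGamma (- ?z + 1)"
    by (subst complex_norm_square) (simp add: cnj_rGamma add.commute)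
  also have "\<dots> * (?z * (- ?z)) = rGamma ?z * rGamma (- ?z)"
    unfolding rGamma_plus1[of ?z, symmetric] rGamma_plus1[of "- ?z", symmetric] by (simp only: mult_ac)
  also have "\<dots> = - ?z * sin (of_real pi * ?z) / of_real pi"
    by (rule rGamma_reflection_complex')
  also have "sin (of_real pi * ?z) = \<i> * of_real (sinh (pi * s))"
  proof -
    have "complex_of_real (sinh (pi * s)) = - \<i> * sin (\<i> * of_real (pi * s))"
      unfolding sinh_conv_sin[symmetric] by (rule of_real_sinh_complex)
    then show ?thesis by (simp add: mult_ac)
  qed
  also have "?z * (- ?z) = of_real (s\<^sup>2)" by (simp add: complex_eq_iff power2_eq_square)
  also have "- ?z * (\<i> * of_real (sinh (pi * s))) / of_real pi = of_real (s * sinh (pi * s) / pi)"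
    by (simp add: complex_eq_iff Re_divide Im_divide)
  finally have "complex_of_real ((norm (rGamma (1 + ?z)))\<^sup>2 * s\<^sup>2) = complex_of_real (s * sinh (pi * s) / pi)"
    by (simp only: of_real_mult)
  then have "(norm (rGamma (1 + ?z)))\<^sup>2 * s\<^sup>2 = s * sinh (pi * s) / pi"
    by (simp only: of_real_eq_iff)
  then show ?thesis using assms by (simp add: field_simps power2_eq_square)
qed

lemma Bessel_entire_0: "Bessel_entire \<nu> 0 = rGamma (\<nu> + 1)"
  unfolding Bessel_entire_def powser_zero by (simp add: Bessel_coeff_def)

text \<open>The energy \<open>V\<close> below is decreasing in \<open>t = ln x\<close>, so it is bounded by its limit at \<open>- \<infinity>\<close>.\<close>

lemma Bessel_exp_energy:
  assumes s: "s \<noteq> 0"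
  defines "\<nu> \<equiv> \<i> * of_real s"
  shows "(norm (Bessel_exp \<nu> t))\<^sup>2 + (norm (Bessel_exp' \<nu> t))\<^sup>2 / (exp (2 * t) + s\<^sup>2) \<le> 2 * sinh (pi * s) / (pi * s)"
proof -
  define V where "V = (\<lambda>t. (Bessel_exp \<nu> t \<bullet> Bessel_exp \<nu> t) + (Bessel_exp' \<nu> t \<bullet> Bessel_exp' \<nu> t) / (exp (2 * t) + s\<^sup>2))"
  have nu: "Re \<nu> \<ge> 0" "\<nu>\<^sup>2 = - of_real (s\<^sup>2)" by (simp_all add: \<nu>_def power_mult_distrib)
  have pos: "exp (2 * t) + s\<^sup>2 > 0" for t by (simp add: add_pos_nonneg)
  have d2: "(Bessel_exp' \<nu> has_vector_derivative - (exp (2 * t) + s\<^sup>2) *\<^sub>R Bessel_exp \<nu> t) (at t)" for t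
    using Bessel_exp_deriv(2)[OF nu(1), of t] by (simp add: nu(2) scaleR_conv_of_real algebra_simps)
  have dinner: "((\<lambda>t. f t \<bullet> f t) has_real_derivative 2 * (f t \<bullet> f')) (at t)"
    if "(f has_vector_derivative f') (at t)" for f :: "real \<Rightarrow> complex" and f' t
    using has_derivative_inner[OF that[unfolded has_vector_derivative_def] that[unfolded has_vector_derivative_def]]
    unfolding has_field_derivative_def by (rule has_derivative_eq_rhs) (auto simp: inner_commute algebra_simps)
  have dP: "((\<lambda>t. exp (2 * t) + s\<^sup>2) has_real_derivative 2 * exp (2 * t)) (at t)" for t
    by (auto intro!: derivative_eq_intros)
  \<comment> \<open>Because y'' = -(e^(2t) + s^2) y, the derivative of |y|^2 cancels against the y''
    contribution of the second term. Only the derivative of the increasing denominator survives,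
    with a negative sign.\<close>
  have dV: "(V has_real_derivative - 2 * exp (2 * t) * (Bessel_exp' \<nu> t \<bullet> Bessel_exp' \<nu> t) / (exp (2 * t) + s\<^sup>2)\<^sup>2) (at t)" for t
  proof -
    have alg: "2 * b + (2 * (- p * b) * p - c * (2 * e)) / (p * p) = - 2 * e * c / p\<^sup>2" if "p > 0" for b c e p :: real
      using that by (simp add: field_simps power2_eq_square)
    have "(V has_real_derivative 2 * (Bessel_exp \<nu> t \<bullet> Bessel_exp' \<nu> t) +
        (2 * (Bessel_exp' \<nu> t \<bullet> (- (exp (2 * t) + s\<^sup>2) *\<^sub>R Bessel_exp \<nu> t)) * (exp (2 * t) + s\<^sup>2)
          - (Bessel_exp' \<nu> t \<bullet> Bessel_exp' \<nu> t) * (2 * exp (2 * t))) / ((exp (2 * t) + s\<^sup>2) * (exp (2 * t) + s\<^sup>2))) (at t)"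
      unfolding V_def using pos[of t]
      by (intro DERIV_add DERIV_divide dinner[OF Bessel_exp_deriv(1)[OF nu(1)]] dinner[OF d2] dP) simp
    then show ?thesis
      unfolding inner_scaleR_right inner_commute[of "Bessel_exp \<nu> t"] alg[OF pos] .
  qed
  have anti: "V t \<le> V u" if "u \<le> t" for u t
    using dV pos by (intro DERIV_nonpos_imp_nonincreasing[OF that]) (auto intro!: exI divide_nonpos_nonneg mult_nonpos_nonneg)
  have nE: "norm (exp (\<nu> * of_real r)) = 1" for r by (simp add: \<nu>_def norm_exp_eq_Re)
  have V_eq: "V t = (norm (Bessel_entire \<nu> (of_real (exp (2 * t) / 4))))\<^sup>2 +
      (norm (\<nu> * Bessel_entire \<nu> (of_real (exp (2 * t) / 4))
     - of_real (exp (2 * t) / 2) * Bessel_entire (\<nu> + 1) (of_real (exp (2 * t) / 4))))\<^sup>2 / (exp (2 * t) + s\<^sup>2)" for t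
    unfolding V_def Bessel_exp_def Bessel_exp'_def power2_norm_eq_inner[symmetric] norm_mult nE by (simp add: norm_mult)
  have cont: "isCont (Bessel_entire \<mu>) 0" if "Re \<mu> \<ge> 0" for \<mu>
    using DERIV_Bessel_entire[OF that] by (rule DERIV_isCont)
  have lim0: "((\<lambda>t. of_real (exp (2 * t) / c) :: complex) \<longlongrightarrow> of_real 0) at_bot" if "c > 0" for c :: real
    using that by (intro tendsto_of_real) real_asymp
  have limF: "((\<lambda>t. Bessel_entire \<mu> (of_real (exp (2 * t) / 4))) \<longlongrightarrow> rGamma (\<mu> + 1)) at_bot" if "Re \<mu> \<ge> 0" for \<mu>
    using isCont_tendsto_compose[OF cont[OF that] lim0[of 4, simplified]] by (simp add: Bessel_entire_0)
  \<comment> \<open>The oscillating factor has modulus 1 and drops out of \<open>V\<close>, and the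
    entire factors tend to their values at 0. Both summands have the same limit since |\<nu>|^2 =
    s^2, whence the factor 2 in the bound.\<close>
  have "(V \<longlongrightarrow> (norm (rGamma (\<nu> + 1)))\<^sup>2 + (norm (\<nu> * rGamma (\<nu> + 1) - of_real 0 * rGamma (\<nu> + 1 + 1)))\<^sup>2 / (0 + s\<^sup>2)) at_bot"
    unfolding V_eq[abs_def] by (intro tendsto_intros limF lim0) (use s nu in \<open>simp_all\<close>, real_asymp)
  moreover have "eventually (\<lambda>u. V t \<le> V u) at_bot"
    using eventually_le_at_bot[of t] by eventually_elim (rule anti)
  ultimately have "V t \<le> (norm (rGamma (\<nu> + 1)))\<^sup>2 + (norm (\<nu> * rGamma (\<nu> + 1) - of_real 0 * rGamma (\<nu> + 1 + 1)))\<^sup>2 / (0 + s\<^sup>2)"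
    by (intro tendsto_lowerbound) auto
  also have "\<dots> = 2 * (norm (rGamma (1 + \<nu>)))\<^sup>2"
    using s by (simp add: norm_mult \<nu>_def power_mult_distrib add.commute)
  also have "\<dots> = 2 * sinh (pi * s) / (pi * s)"
    using norm_rGamma_imag_sq[OF s] by (simp add: \<nu>_def)
  finally show ?thesis by (simp add: V_def power2_norm_eq_inner)
qed

section \<open>The Laplace transform of Bessel functions of imaginary order\<close>

text \<open>The mean value inequality bounds every difference quotient by \<open>G\<close>, so
  dominated convergence applies along each sequence tending to 0.\<close>

lemma has_vector_derivative_lebesgue_integral:
  fixes f f' :: "real \<Rightarrow> real \<Rightarrow> 'a :: euclidean_space"
  assumes r: "r \<in> {a<..<b}"
    and int: "\<And>x. x \<in> {a<..<b} \<Longrightarrow> integrable lborel (f x)"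
    and der: "\<And>x t. x \<in> {a<..<b} \<Longrightarrow> ((\<lambda>x. f x t) has_vector_derivative f' x t) (at x)"
    and bound: "\<And>x t. x \<in> {a<..<b} \<Longrightarrow> norm (f' x t) \<le> G t"
    and G: "integrable lborel G"
    and meas [measurable]: "f' r \<in> borel_measurable borel"
  shows "((\<lambda>x. LINT t|lborel. f x t) has_vector_derivative (LINT t|lborel. f' r t)) (at r)"
proof -
  let ?F = "\<lambda>x. LINT t|lborel. f x t" and ?D = "LINT t|lborel. f' r t"
  have lip: "norm (f x t - f r t) \<le> G t * norm (x - r)" if "x \<in> {a<..<b}" for x t
  proof (rule differentiable_bound[where S="{a<..<b}" and f'="\<lambda>x h. h *\<^sub>R f' x t"])
    show "((\<lambda>x. f x t) has_derivative (\<lambda>h. h *\<^sub>R f' x t)) (at x within {a<..<b})" if "x \<in> {a<..<b}" for x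
      using der[OF that] unfolding has_vector_derivative_def by (rule has_derivative_at_withinI)
    show "onorm (\<lambda>h. h *\<^sub>R f' x t) \<le> G t" if "x \<in> {a<..<b}" for x
      using mult_right_mono[OF bound[OF that, of t] abs_ge_zero] by (intro onorm_le) (simp add: mult.commute)
  qed (use r that in auto)
  have "((\<lambda>h. norm (?F (r + h) - ?F r - h *\<^sub>R ?D) / norm h) \<longlongrightarrow> 0) (at 0)"
    unfolding tendsto_at_iff_sequentially
  proof (intro allI impI)
    fix X :: "nat \<Rightarrow> real" assume X: "\<forall>i. X i \<in> UNIV - {0}" "X \<longlonglongrightarrow> 0"
    \<comment> \<open>Where r + X i leaves the interval, \<open>q\<close> takes the value of the
      limit, so that the bound by \<open>G\<close> holds for every i and not only
      eventually.\<close>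
    define q where "q = (\<lambda>i t. if r + X i \<in> {a<..<b} then (f (r + X i) t - f r t) /\<^sub>R X i else f' r t)"
    have ev: "eventually (\<lambda>i. r + X i \<in> {a<..<b}) sequentially"
    proof -
      have "(\<lambda>i. r + X i) \<longlonglongrightarrow> r + 0" by (intro tendsto_intros X)
      then show ?thesis using r by (auto dest: topological_tendstoD[where S="{a<..<b}"])
    qed
    have "(\<lambda>i. LINT t|lborel. q i t) \<longlonglongrightarrow> ?D"
    proof (rule integral_dominated_convergence[where w=G])
      show "q i \<in> borel_measurable lborel" for i
        using int[OF r] int[of "r + X i"] unfolding q_def by (cases "r + X i \<in> {a<..<b}") auto
      show "AE t in lborel. norm (q i t) \<le> G t" for i
      proof (rule AE_I2)
        fix t
        have "norm (f (r + X i) t - f r t) / \<bar>X i\<bar> \<le> G t" if "r + X i \<in> {a<..<b}"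
          using lip[OF that, of t] X(1) by (simp add: field_simps)
        then show "norm (q i t) \<le> G t"
          using bound[OF r, of t] by (simp add: q_def divide_inverse mult.commute)
      qed
      show "AE t in lborel. (\<lambda>i. q i t) \<longlonglongrightarrow> f' r t"
      proof (rule AE_I2)
        fix t
        have "((\<lambda>h. norm (f (r + h) t - f r t - h *\<^sub>R f' r t) / norm h) \<longlongrightarrow> 0) (at 0)"
          using der[OF r, of t] by (simp add: has_vector_derivative_def has_derivative_at)
        then have "(\<lambda>i. norm (f (r + X i) t - f r t - X i *\<^sub>R f' r t) / norm (X i)) \<longlonglongrightarrow> 0"
          using X unfolding tendsto_at_iff_sequentially by (auto simp: o_def)
        moreover have "norm (f (r + X i) t - f r t - X i *\<^sub>R f' r t) / norm (X i) =
            norm ((f (r + X i) t - f r t) /\<^sub>R X i - f' r t)" for i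
        proof -
          have "(f (r + X i) t - f r t) /\<^sub>R X i - f' r t = (f (r + X i) t - f r t - X i *\<^sub>R f' r t) /\<^sub>R X i"
            using X(1) by (simp add: scaleR_diff_right)
          then show ?thesis by (simp add: divide_inverse mult.commute)
        qed
        ultimately have "(\<lambda>i. (f (r + X i) t - f r t) /\<^sub>R X i) \<longlonglongrightarrow> f' r t"
          by (simp add: LIM_zero_iff tendsto_norm_zero_iff)
        moreover have "eventually (\<lambda>i. (f (r + X i) t - f r t) /\<^sub>R X i = q i t) sequentially"
          using ev by eventually_elim (simp add: q_def)
        ultimately show "(\<lambda>i. q i t) \<longlonglongrightarrow> f' r t" by (rule Lim_transform_eventually)
      qed
    qed (use G in auto)
    then have "(\<lambda>i. norm ((LINT t|lborel. q i t) - ?D)) \<longlonglongrightarrow> 0"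
      by (simp add: LIM_zero_iff tendsto_norm_zero_iff)
    moreover have "eventually (\<lambda>i. norm ((LINT t|lborel. q i t) - ?D) =
       ((\<lambda>h. norm (?F (r + h) - ?F r - h *\<^sub>R ?D) / norm h) \<circ> X) i) sequentially"
      using ev
    proof eventually_elim
      case (elim i)
      have "(LINT t|lborel. q i t) = (?F (r + X i) - ?F r) /\<^sub>R X i"
        using elim int[OF elim] int[OF r] by (simp add: q_def)
      then have "(LINT t|lborel. q i t) - ?D = (?F (r + X i) - ?F r - X i *\<^sub>R ?D) /\<^sub>R X i"
        using X(1) by (simp add: scaleR_diff_right)
      then show ?case by (simp add: divide_inverse mult.commute)
    qed
    ultimately show "((\<lambda>h. norm (?F (r + h) - ?F r - h *\<^sub>R ?D) / norm h) \<circ> X) \<longlonglongrightarrow> 0"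
      by (rule Lim_transform_eventually)
  qed
  then show ?thesis
    by (simp add: has_vector_derivative_def has_derivative_at bounded_linear_scaleR_left)
qed

lemma integral_line_FTC:
  fixes F f :: "real \<Rightarrow> 'a :: euclidean_space"
  assumes "\<And>x. (F has_vector_derivative f x) (at x)" and "continuous_on UNIV f" "integrable lborel f"
    and "(F \<longlongrightarrow> A) at_bot" "(F \<longlongrightarrow> B) at_top"
  shows "(LINT x|lborel. f x) = B - A"
proof -
  have U: "einterval (-\<infinity>) \<infinity> = UNIV" by (auto simp: einterval_def)
  have "(LBINT x=-\<infinity>..\<infinity>. f x) = B - A"
    using assms by (intro interval_integral_FTC_integrable)
      (auto simp: U set_integrable_def ereal_tendsto_simps continuous_on_eq_continuous_at)
  then show ?thesis by (simp add: interval_lebesgue_integral_def U set_lebesgue_integral_def)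
qed

text \<open>A translation by ln c reduces this to the Gamma integral with real exponent k; it
  provides the majorants for the Laplace integrals written in t.\<close>

lemma integrable_exp_exp:
  fixes c k :: real
  assumes "c > 0" "k > 0"
  shows "integrable lborel (\<lambda>t. exp (k * t) * exp (- (c * exp t)))"
proof -
  have "integrable lborel (\<lambda>s. norm (exp (complex_of_real k * of_real s - of_real (exp s))))"
    using Gamma_line_integral[of "of_real k"] assms by (intro integrable_norm) (simp add: has_bochner_integral_iff)
  then have "integrable lborel (\<lambda>s. exp (k * s - exp s))" by (simp add: norm_exp_eq_Re)
  then have "integrable lborel (\<lambda>t. exp (k * (ln c + 1 * t) - exp (ln c + 1 * t)))"
    by (rule lborel_integrable_real_affine) simp
  moreover have "exp (k * (ln c + 1 * t) - exp (ln c + 1 * t)) = exp (k * ln c) * (exp (k * t) * exp (- (c * exp t)))" for t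
    using assms by (simp add: exp_add exp_diff exp_minus divide_inverse algebra_simps)
  ultimately show ?thesis by simp
qed

lemma norm_Bessel_exp_le:
  assumes "s \<noteq> 0"
  shows "norm (Bessel_exp (\<i> * of_real s) t) \<le> sqrt (2 * sinh (pi * s) / (pi * s))"
    and "norm (Bessel_exp' (\<i> * of_real s) t) \<le> sqrt (2 * sinh (pi * s) / (pi * s)) * (exp t + \<bar>s\<bar>)"
proof -
  let ?C = "2 * sinh (pi * s) / (pi * s)" and ?\<nu> = "\<i> * of_real s"
  have pos: "exp (2 * t) + s\<^sup>2 > 0" by (simp add: add_pos_nonneg)
  note E = Bessel_exp_energy[OF assms, of t]
  have "(norm (Bessel_exp ?\<nu> t))\<^sup>2 \<le> ?C"
    by (rule order_trans[OF _ E]) (use pos in auto)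
  then show "norm (Bessel_exp ?\<nu> t) \<le> sqrt ?C" by (rule real_le_rsqrt)
  have "(norm (Bessel_exp' ?\<nu> t))\<^sup>2 / (exp (2 * t) + s\<^sup>2) \<le> ?C"
    by (rule order_trans[OF _ E]) auto
  then have "(norm (Bessel_exp' ?\<nu> t))\<^sup>2 \<le> ?C * (exp (2 * t) + s\<^sup>2)"
    using pos by (simp add: pos_divide_le_eq)
  then have "norm (Bessel_exp' ?\<nu> t) \<le> sqrt (?C * (exp (2 * t) + s\<^sup>2))" by (rule real_le_rsqrt)
  also have "\<dots> = sqrt ?C * sqrt ((exp t)\<^sup>2 + \<bar>s\<bar>\<^sup>2)" by (simp only: real_sqrt_mult exp_double power2_abs)
  also have "\<dots> \<le> sqrt ?C * (exp t + \<bar>s\<bar>)"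
    using order_trans[OF zero_le_power2 \<open>(norm (Bessel_exp ?\<nu> t))\<^sup>2 \<le> ?C\<close>]
    by (intro mult_left_mono sqrt_sum_squares_le_sum real_sqrt_ge_zero) auto
  finally show "norm (Bessel_exp' ?\<nu> t) \<le> sqrt ?C * (exp t + \<bar>s\<bar>)" .
qed

text \<open>With x = e^t this is cosh r times the Laplace transform of J_is at sinh r. The factor
  cosh r normalises it so that it satisfies an equation with constant coefficients in r.\<close>

definition Laplace_Bessel :: "real \<Rightarrow> real \<Rightarrow> complex" where
  "Laplace_Bessel s r = (LINT t|lborel. (cosh r * exp t * exp (- (exp t * sinh r))) *\<^sub>R Bessel_exp (\<i> * of_real s) t)"

text \<open>The kernel K = cosh r e^t exp (-e^t sinh r) satisfies K_rr = K_tt + e^(2t) K, while y_tt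
  = -(e^(2t) + s^2) y. Hence (K_rr + s^2 K) y is the t-derivative of K_t y - K y_t, and integrating
  over the line gives N'' = -s^2 N. \<open>K0\<close>, \<open>K1\<close>, \<open>K2\<close> are K,
  K_r, K_rr.\<close>

lemma Laplace_Bessel_ODE:
  assumes s: "s \<noteq> 0"
  obtains N' where
    "\<And>r. r > 0 \<Longrightarrow> (Laplace_Bessel s has_vector_derivative N' r) (at r)"
    "\<And>r. r > 0 \<Longrightarrow> (N' has_vector_derivative - (s\<^sup>2) *\<^sub>R Laplace_Bessel s r) (at r)"
    "\<And>r. r > 0 \<Longrightarrow> integrable lborel (\<lambda>t. (cosh r * exp t * exp (- (exp t * sinh r))) *\<^sub>R Bessel_exp (\<i> * of_real s) t)"
proof -
  define \<nu> where "\<nu> = \<i> * complex_of_real s"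
  define B where "B = sqrt (2 * sinh (pi * s) / (pi * s))"
  let ?y = "Bessel_exp \<nu>" and ?y' = "Bessel_exp' \<nu>"
  define h where "h = (\<lambda>r t::real. exp (- (exp t * sinh r)))"
  define K0 where "K0 = (\<lambda>r t. cosh r * exp t * h r t)"
  define K1 where "K1 = (\<lambda>r t. (exp t * sinh r - exp (2 * t) * (cosh r)\<^sup>2) * h r t)"
  define K2 where "K2 = (\<lambda>r t. cosh r * (exp t - 3 * exp (2 * t) * sinh r + exp (3 * t) * (cosh r)\<^sup>2) * h r t)"
  have nu: "Re \<nu> \<ge> 0" "\<nu>\<^sup>2 = - of_real (s\<^sup>2)" by (simp_all add: \<nu>_def power_mult_distrib)
  have yB: "norm (?y t) \<le> B" and y'B: "norm (?y' t) \<le> B * (exp t + \<bar>s\<bar>)" for t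
    using norm_Bessel_exp_le[OF s] by (simp_all add: \<nu>_def B_def)
  have B0: "B \<ge> 0" using yB[of 0] norm_ge_zero order_trans by blast
  note dy = Bessel_exp_deriv(1)[OF nu(1)] and dy' = Bessel_exp_deriv(2)[OF nu(1)]
  have conty: "continuous_on UNIV ?y"
    by (intro continuous_at_imp_continuous_on ballI has_vector_derivative_continuous[OF dy])
  then have [measurable]: "?y \<in> borel_measurable borel" by (rule borel_measurable_continuous_onI)
  have e2: "exp (2 * t) = exp t * exp t" and e3: "exp (3 * t) = exp t * exp t * exp t" for t :: real
    by (simp_all flip: exp_add)
  have dh: "((\<lambda>r. h r t) has_real_derivative - (exp t * cosh r) * h r t) (at r)" for r t
    unfolding h_def by (auto intro!: derivative_eq_intros)
  have dK0: "((\<lambda>r. K0 r t) has_real_derivative K1 r t) (at r)" for r t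
    unfolding K0_def K1_def
    by (rule derivative_eq_intros dh refl)+ (unfold e2 e3, simp add: algebra_simps power2_eq_square)
  have dK1: "((\<lambda>r. K1 r t) has_real_derivative K2 r t) (at r)" for r t
    unfolding K1_def K2_def
    by (rule derivative_eq_intros dh refl)+ (unfold e2 e3, simp add: algebra_simps power2_eq_square)
  have [measurable]: "K0 r \<in> borel_measurable borel" "K1 r \<in> borel_measurable borel" "K2 r \<in> borel_measurable borel" for r
    unfolding K0_def K1_def K2_def h_def by measurable
  \<comment> \<open>One majorant serves the kernel and both of its r-derivatives: each is a
    combination of e^t, e^(2t), e^(3t) times \<open>h\<close>, with coefficients bounded by 3 (cosh
    b)^3 for r at most b.\<close>
  define E where "E = (\<lambda>c t::real. (exp t + exp (2 * t) + exp (3 * t)) * exp (- (c * exp t)))"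
  have intE: "integrable lborel (E c)" if "c > 0" for c
    unfolding E_def using integrable_exp_exp[OF that, of 1] integrable_exp_exp[OF that, of 2] integrable_exp_exp[OF that, of 3]
    by (simp add: distrib_right)
  have bounds: "\<bar>K0 r t\<bar> \<le> 3 * cosh b ^ 3 * E (sinh a) t" "\<bar>K1 r t\<bar> \<le> 3 * cosh b ^ 3 * E (sinh a) t" "\<bar>K2 r t\<bar> \<le> 3 * cosh b ^ 3 * E (sinh a) t"
    if ab: "0 < a" "a \<le> r" "r \<le> b" for a b r t
  proof -
    let ?M = "cosh b"
    have sh: "0 \<le> sinh r" "sinh r \<le> ?M" "sinh a \<le> sinh r"
      using ab cosh_real_nonneg_le_iff[of r b] sinh_less_cosh_real[of r] by (auto intro: less_imp_le order_trans)
    have ch: "1 \<le> cosh r" "cosh r \<le> ?M" "1 \<le> ?M"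
      using ab cosh_real_nonneg_le_iff[of r b] cosh_real_ge_1 by auto
    have hh: "0 < h r t" "h r t \<le> exp (- (sinh a * exp t))"
      using sh(3) by (simp_all add: h_def mult.commute)
    have M: "?M \<le> ?M ^ 3" "?M\<^sup>2 \<le> ?M ^ 3" "0 \<le> ?M"
      using ch(3) power_increasing[of 1 3 ?M] power_increasing[of 2 3 ?M] by simp_all
    have ch2: "(cosh r)\<^sup>2 \<le> ?M\<^sup>2" using ch by (intro power_mono) auto
    have chsh: "cosh r * sinh r \<le> ?M\<^sup>2" using ch sh by (simp add: power2_eq_square mult_mono)
    have ch3: "cosh r * (cosh r)\<^sup>2 \<le> ?M ^ 3" using ch power_mono[of "cosh r" ?M 3] by (simp add: power3_eq_cube power2_eq_square mult.assoc)
    have main: "\<bar>q * h r t\<bar> \<le> 3 * ?M ^ 3 * E (sinh a) t"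
      if "\<bar>q\<bar> \<le> 3 * ?M ^ 3 * (exp t + exp (2 * t) + exp (3 * t))" for q
      using mult_mono[OF that hh(2)] hh(1) M(3) by (simp add: E_def abs_mult mult.assoc)
    let ?e = "exp t" and ?f = "exp (2 * t)" and ?g = "exp (3 * t)"
    have p: "?e > 0" "?f > 0" "?g > 0" by simp_all
    have M3: "?M ^ 3 \<ge> 0" using M by simp
    show "\<bar>K0 r t\<bar> \<le> 3 * cosh b ^ 3 * E (sinh a) t"
      unfolding K0_def
    proof (rule main)
      have "cosh r * ?e \<le> ?M ^ 3 * ?e" using order_trans[OF ch(2) M(1)] p by (intro mult_right_mono) auto
      moreover have "0 \<le> cosh r * ?e" using ch by simp
      moreover have "0 \<le> ?M ^ 3 * ?e" "0 \<le> ?M ^ 3 * ?f" "0 \<le> ?M ^ 3 * ?g" using M3 by simp_all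
      ultimately show "\<bar>cosh r * ?e\<bar> \<le> 3 * ?M ^ 3 * (?e + ?f + ?g)"
        unfolding distrib_left mult.assoc by (intro abs_leI; linarith)
    qed
    show "\<bar>K1 r t\<bar> \<le> 3 * cosh b ^ 3 * E (sinh a) t"
      unfolding K1_def
    proof (rule main)
      have "?e * sinh r \<le> ?M ^ 3 * ?e" unfolding mult.commute[of "?M ^ 3"] using order_trans[OF sh(2) M(1)] p by (intro mult_left_mono) auto
      moreover have "?f * (cosh r)\<^sup>2 \<le> ?M ^ 3 * ?f" unfolding mult.commute[of "?M ^ 3"] using order_trans[OF ch2 M(2)] p by (intro mult_left_mono) auto
      moreover have "0 \<le> ?e * sinh r" "0 \<le> ?f * (cosh r)\<^sup>2" using sh by simp_all
      moreover have "0 \<le> ?M ^ 3 * ?e" "0 \<le> ?M ^ 3 * ?f" "0 \<le> ?M ^ 3 * ?g" using M3 by simp_all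
      ultimately show "\<bar>?e * sinh r - ?f * (cosh r)\<^sup>2\<bar> \<le> 3 * ?M ^ 3 * (?e + ?f + ?g)"
        unfolding distrib_left mult.assoc by (intro abs_leI; linarith)
    qed
    show "\<bar>K2 r t\<bar> \<le> 3 * cosh b ^ 3 * E (sinh a) t"
      unfolding K2_def
    proof (rule main)
      have "?e * cosh r \<le> ?M ^ 3 * ?e" unfolding mult.commute[of "?M ^ 3"] using order_trans[OF ch(2) M(1)] p by (intro mult_left_mono) auto
      moreover have "?f * (cosh r * sinh r) \<le> ?M ^ 3 * ?f" unfolding mult.commute[of "?M ^ 3"] using order_trans[OF chsh M(2)] p by (intro mult_left_mono) auto
      moreover have "?g * (cosh r * (cosh r)\<^sup>2) \<le> ?M ^ 3 * ?g" unfolding mult.commute[of "?M ^ 3"] using ch3 p by (intro mult_left_mono) auto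
      moreover have "0 \<le> ?e * cosh r" "0 \<le> ?f * (cosh r * sinh r)" "0 \<le> ?g * (cosh r * (cosh r)\<^sup>2)" using sh ch by simp_all
      moreover have "0 \<le> ?M ^ 3 * ?e" "0 \<le> ?M ^ 3 * ?f" "0 \<le> ?M ^ 3 * ?g" using M3 by simp_all
      moreover have "cosh r * (?e - 3 * ?f * sinh r + ?g * (cosh r)\<^sup>2)
          = ?e * cosh r - 3 * (?f * (cosh r * sinh r)) + ?g * (cosh r * (cosh r)\<^sup>2)" by (simp add: algebra_simps)
      ultimately show "\<bar>cosh r * (?e - 3 * ?f * sinh r + ?g * (cosh r)\<^sup>2)\<bar> \<le> 3 * ?M ^ 3 * (?e + ?f + ?g)"
        unfolding distrib_left mult.assoc by (intro abs_leI; linarith)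
    qed
  qed
  have intK: "integrable lborel (\<lambda>t. K t *\<^sub>R ?y t)"
    if "K \<in> borel_measurable borel" "\<And>t. \<bar>K t\<bar> \<le> C * E c t" "c > 0" for K C c
  proof (rule Bochner_Integration.integrable_bound)
    show "integrable lborel (\<lambda>t. (C * E c t) * B)" using intE[OF that(3)] by simp
    show "AE t in lborel. norm (K t *\<^sub>R ?y t) \<le> norm ((C * E c t) * B)"
    proof (rule AE_I2)
      fix t
      have "norm (K t *\<^sub>R ?y t) \<le> (C * E c t) * B"
        using that(2)[of t] yB[of t] by (simp, intro mult_mono) (auto intro: order_trans[OF abs_ge_zero])
      then show "norm (K t *\<^sub>R ?y t) \<le> norm ((C * E c t) * B)" by simp
    qed
  qed (use that(1) in measurable)
  have int0: "integrable lborel (\<lambda>t. K0 r t *\<^sub>R ?y t)" and int1: "integrable lborel (\<lambda>t. K1 r t *\<^sub>R ?y t)" 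
    and int2: "integrable lborel (\<lambda>t. K2 r t *\<^sub>R ?y t)" if "r > 0" for r
    using bounds[OF that order_refl order_refl] that by (auto intro!: intK[where C="3 * cosh r ^ 3" and c="sinh r"])
  define N1 where "N1 = (\<lambda>r. LINT t|lborel. K1 r t *\<^sub>R ?y t)"
  have N_eq: "Laplace_Bessel s = (\<lambda>r. LINT t|lborel. K0 r t *\<^sub>R ?y t)"
    by (simp add: Laplace_Bessel_def K0_def h_def \<nu>_def fun_eq_iff)
  have under: "((\<lambda>r. LINT t|lborel. k r t *\<^sub>R ?y t) has_vector_derivative (LINT t|lborel. k' r t *\<^sub>R ?y t)) (at r)"
    if "r > 0" "\<And>r. r > 0 \<Longrightarrow> integrable lborel (\<lambda>t. k r t *\<^sub>R ?y t)"
      "\<And>r t. ((\<lambda>r. k r t) has_real_derivative k' r t) (at r)"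
      "\<And>a b r t. 0 < a \<Longrightarrow> a \<le> r \<Longrightarrow> r \<le> b \<Longrightarrow> \<bar>k' r t\<bar> \<le> 3 * cosh b ^ 3 * E (sinh a) t"
      "k' r \<in> borel_measurable borel" for k k' r
  \<comment> \<open>The neighbourhood of r is kept away from 0, so the exponential decay rate is at
    least sinh (r/2), and bounded above, so the powers of cosh stay bounded.\<close>
  proof (rule has_vector_derivative_lebesgue_integral[where a="r/2" and b="r+1" and G="\<lambda>t. 3 * cosh (r+1) ^ 3 * E (sinh (r/2)) t * B"])
    show "r \<in> {r/2<..<r+1}" using that by auto
    show "integrable lborel (\<lambda>t. k x t *\<^sub>R ?y t)" if "x \<in> {r/2<..<r+1}" for x
      using that \<open>r > 0\<close> by (intro \<open>\<And>r. r > 0 \<Longrightarrow> integrable lborel (\<lambda>t. k r t *\<^sub>R ?y t)\<close>) auto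
    show "((\<lambda>x. k x t *\<^sub>R ?y t) has_vector_derivative k' x t *\<^sub>R ?y t) (at x)" for x t
      using that(3)[of t x] by (auto intro!: derivative_eq_intros)
    show "norm (k' x t *\<^sub>R ?y t) \<le> 3 * cosh (r+1) ^ 3 * E (sinh (r/2)) t * B" if "x \<in> {r/2<..<r+1}" for x t
    proof -
      have "\<bar>k' x t\<bar> \<le> 3 * cosh (r+1) ^ 3 * E (sinh (r/2)) t"
        using that \<open>r > 0\<close> by (intro \<open>\<And>a b r t. 0 < a \<Longrightarrow> a \<le> r \<Longrightarrow> r \<le> b \<Longrightarrow> \<bar>k' r t\<bar> \<le> 3 * cosh b ^ 3 * E (sinh a) t\<close>) auto
      from mult_mono[OF this yB[of t] order_trans[OF abs_ge_zero this] norm_ge_zero]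
      show ?thesis by (simp only: norm_scaleR)
    qed
    show "integrable lborel (\<lambda>t. 3 * cosh (r+1) ^ 3 * E (sinh (r/2)) t * B)"
      using intE[of "sinh (r/2)"] \<open>r > 0\<close> by simp
    show "(\<lambda>t. k' r t *\<^sub>R ?y t) \<in> borel_measurable borel" using that(5) by measurable
  qed
  have d0: "(Laplace_Bessel s has_vector_derivative N1 r) (at r)" if "r > 0" for r
    unfolding N_eq N1_def by (rule under[OF that int0 dK0 bounds(2)]) simp_all
  have d1: "(N1 has_vector_derivative (LINT t|lborel. K2 r t *\<^sub>R ?y t)) (at r)" if "r > 0" for r
    unfolding N1_def by (rule under[OF that int1 dK1 bounds(3)]) simp_all
  have zero: "(LINT t|lborel. (K2 r t + s\<^sup>2 * K0 r t) *\<^sub>R ?y t) = 0" if r: "r > 0" for r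
  proof -
    \<comment> \<open>The boundary term K_t y - K y_t.\<close>
    define W where "W = (\<lambda>t. (cosh r * (exp t - exp (2 * t) * sinh r) * h r t) *\<^sub>R ?y t - K0 r t *\<^sub>R ?y' t)"
    have dht: "(h r has_real_derivative - (exp t * sinh r) * h r t) (at t)" for t
      unfolding h_def by (auto intro!: derivative_eq_intros)
    have dk: "((\<lambda>t. cosh r * (exp t - exp (2 * t) * sinh r) * h r t) has_real_derivative
        K2 r t - exp (2 * t) * K0 r t) (at t)" for t
    proof -
      have c2: "(cosh r)\<^sup>2 = (sinh r)\<^sup>2 + 1" by (rule cosh_square_eq)
      show ?thesis
        unfolding K2_def K0_def c2
        by (rule derivative_eq_intros dht refl)+ (unfold e2 e3, simp add: algebra_simps power2_eq_square)
    qed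
    have dK: "(K0 r has_real_derivative cosh r * (exp t - exp (2 * t) * sinh r) * h r t) (at t)" for t
      unfolding K0_def by (rule derivative_eq_intros dht refl)+ (unfold e2 e3, simp add: algebra_simps)
    have dW: "(W has_vector_derivative (K2 r t + s\<^sup>2 * K0 r t) *\<^sub>R ?y t) (at t)" for t
    proof -
      have "(W has_vector_derivative
          ((cosh r * (exp t - exp (2 * t) * sinh r) * h r t) *\<^sub>R ?y' t + (K2 r t - exp (2 * t) * K0 r t) *\<^sub>R ?y t)
          - (K0 r t *\<^sub>R ((\<nu>\<^sup>2 - of_real (exp (2 * t))) * ?y t) + (cosh r * (exp t - exp (2 * t) * sinh r) * h r t) *\<^sub>R ?y' t)) (at t)"
        unfolding W_def
        by (rule has_vector_derivative_diff[OF has_vector_derivative_scaleR[OF dk dy] has_vector_derivative_scaleR[OF dK dy']])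
      then show ?thesis
        by (rule has_vector_derivative_eq_rhs) (simp add: nu(2) scaleR_conv_of_real algebra_simps)
    qed
    have contK: "continuous_on UNIV (\<lambda>t. (K2 r t + s\<^sup>2 * K0 r t) *\<^sub>R ?y t)"
      unfolding K2_def K0_def h_def by (intro continuous_intros conty)
    have intW: "integrable lborel (\<lambda>t. (K2 r t + s\<^sup>2 * K0 r t) *\<^sub>R ?y t)"
      using int2[OF r] integrable_scaleR_right[OF int0[OF r], of "s\<^sup>2"] by (simp add: scaleR_add_left)
    have c: "sinh r > 0" using r by simp
    have c': "cosh r > 0" by simp
    define S where "S = sinh r"
    define C where "C = cosh r"
    \<comment> \<open>A majorant of \<open>W\<close> that vanishes at both ends: through the factor
      e^t at minus infinity and through exp (-e^t sinh r) at plus infinity.\<close>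
    define L where "L = (\<lambda>t. B * C * ((exp t + exp (2 * t) * S + exp t * (exp t + \<bar>s\<bar>)) * exp (- (exp t * S))))"
    have bW: "norm (W t) \<le> L t" for t
    proof -
      have "norm (W t) \<le> \<bar>C * (exp t - exp (2 * t) * S) * h r t\<bar> * norm (?y t) + \<bar>K0 r t\<bar> * norm (?y' t)"
        unfolding W_def C_def S_def by (rule order_trans[OF norm_triangle_ineq4]) simp
      also have "\<dots> \<le> (C * (exp t + exp (2 * t) * S) * h r t) * B + (C * exp t * h r t) * (B * (exp t + \<bar>s\<bar>))"
      proof (intro add_mono mult_mono yB y'B)
        have "\<bar>exp t - exp (2 * t) * S\<bar> \<le> exp t + exp (2 * t) * S"
          using c by (simp add: S_def abs_le_iff)
        then show "\<bar>C * (exp t - exp (2 * t) * S) * h r t\<bar> \<le> C * (exp t + exp (2 * t) * S) * h r t"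
          using c' by (simp add: abs_mult C_def h_def)
      qed (use c c' B0 in \<open>auto simp: K0_def C_def S_def h_def abs_mult\<close>)
      also have "\<dots> = L t" by (simp add: L_def h_def S_def algebra_simps)
      finally show ?thesis .
    qed
    have "S > 0" using c by (simp add: S_def)
    then have "(L \<longlongrightarrow> 0) at_top" "(L \<longlongrightarrow> 0) at_bot"
      unfolding L_def by (intro tendsto_mult_right_zero, real_asymp)+
    then have "(W \<longlongrightarrow> 0) at_top" "(W \<longlongrightarrow> 0) at_bot"
      using bW by (auto intro!: Lim_null_comparison[where g=L])
    then show ?thesis using integral_line_FTC[OF dW contK intW] by simp
  qed
  have "(LINT t|lborel. K2 r t *\<^sub>R ?y t) = - (s\<^sup>2) *\<^sub>R Laplace_Bessel s r" if "r > 0" for r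
  proof -
    have "0 = (LINT t|lborel. K2 r t *\<^sub>R ?y t + s\<^sup>2 *\<^sub>R (K0 r t *\<^sub>R ?y t))"
      using zero[OF that] by (simp add: scaleR_add_left)
    also have "\<dots> = (LINT t|lborel. K2 r t *\<^sub>R ?y t) + s\<^sup>2 *\<^sub>R Laplace_Bessel s r"
      by (subst Bochner_Integration.integral_add[OF int2[OF that] integrable_scaleR_right[OF int0[OF that]]])
        (simp add: N_eq del: scaleR_scaleR)
    finally show ?thesis by (simp add: eq_neg_iff_add_eq_0)
  qed
  with d1 have "(N1 has_vector_derivative - (s\<^sup>2) *\<^sub>R Laplace_Bessel s r) (at r)" if "r > 0" for r
    using that by metis
  from that[OF d0 this] int0 show thesis
    by (simp add: K0_def h_def \<nu>_def)
qed

text \<open>Replacing t by t - ln (sinh r) moves the large parameter into the Bessel function, whose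
  argument then tends to 0, so only its leading term survives. Since sinh r behaves like e^r / 2,
  the phases cancel, and the remaining integral is \<open>Gamma (\<nu> + 1)\<close>, cancelling the
  leading coefficient.\<close>

lemma Laplace_Bessel_tendsto:
  assumes s: "s \<noteq> 0"
  shows "((\<lambda>r. exp (\<i> * of_real (s * r)) * Laplace_Bessel s r) \<longlongrightarrow> 1) at_top"
proof -
  define \<nu> where "\<nu> = \<i> * complex_of_real s"
  define B where "B = sqrt (2 * sinh (pi * s) / (pi * s))"
  have nu: "Re \<nu> = 0" by (simp add: \<nu>_def)
  have yB: "norm (Bessel_exp \<nu> t) \<le> B" for t
    using norm_Bessel_exp_le(1)[OF s] by (simp add: \<nu>_def B_def)
  have "continuous_on UNIV (Bessel_exp \<nu>)"
    by (intro continuous_at_imp_continuous_on ballI has_vector_derivative_continuous[OF Bessel_exp_deriv(1)]) (simp add: nu)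
  then have [measurable]: "Bessel_exp \<nu> \<in> borel_measurable borel" by (rule borel_measurable_continuous_onI)
  define u where "u = (\<lambda>r t. (cosh r / sinh r * (exp t * exp (- exp t))) *\<^sub>R (exp (\<nu> * of_real r) * Bessel_exp \<nu> (t - ln (sinh r))))"
  have eq: "exp (\<nu> * of_real r) * Laplace_Bessel s r = (LINT t|lborel. u r t)" if "r > 0" for r
  proof -
    have sh: "sinh r > 0" using that by simp
    have "Laplace_Bessel s r = (LINT t|lborel. (cosh r * exp (- ln (sinh r) + 1 * t) * exp (- (exp (- ln (sinh r) + 1 * t) * sinh r))) *\<^sub>R Bessel_exp \<nu> (- ln (sinh r) + 1 * t))"
      unfolding Laplace_Bessel_def \<nu>_def by (subst lborel_integral_real_affine[of 1 _ "- ln (sinh r)"]) simp_all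
    also have "\<dots> = (LINT t|lborel. (cosh r / sinh r * (exp t * exp (- exp t))) *\<^sub>R Bessel_exp \<nu> (t - ln (sinh r)))"
      using sh by (intro Bochner_Integration.integral_cong refl) (simp add: exp_diff field_simps)
    finally show ?thesis unfolding u_def by (simp flip: integral_mult_right_zero)
  qed
  have lim: "((\<lambda>r. LINT t|lborel. u r t) \<longlongrightarrow>
      (LINT t|lborel. (1 * (exp t * exp (- exp t))) *\<^sub>R (rGamma (\<nu> + 1) * exp (\<nu> * of_real (t + 0))))) at_top"
  proof (rule integral_dominated_convergence_at_top)
    show "integrable lborel (\<lambda>t. 2 * B * (exp (1 * t) * exp (- (1 * exp t))))"
      by (intro integrable_mult_right integrable_exp_exp) auto
    show "u r \<in> borel_measurable lborel" for r unfolding u_def by measurable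
    show "AE t in lborel. ((\<lambda>r. u r t) \<longlongrightarrow> (1 * (exp t * exp (- exp t))) *\<^sub>R (rGamma (\<nu> + 1) * exp (\<nu> * of_real (t + 0)))) at_top"
    proof (rule AE_I2)
      fix t
      have 1: "((\<lambda>r::real. cosh r / sinh r) \<longlongrightarrow> 1) at_top" by real_asymp
      have 2: "((\<lambda>r::real. r - ln (sinh r) - ln 2) \<longlongrightarrow> 0) at_top" by (real_asymp simp: ln_div)
      have 3: "((\<lambda>r::real. exp (2 * (t - ln (sinh r))) / 4) \<longlongrightarrow> 0) at_top" by real_asymp
      have "isCont (Bessel_entire \<nu>) 0" using DERIV_Bessel_entire[of \<nu>] nu by (intro DERIV_isCont) auto
      then have 4: "((\<lambda>r. Bessel_entire \<nu> (of_real (exp (2 * (t - ln (sinh r))) / 4))) \<longlongrightarrow> rGamma (\<nu> + 1)) at_top"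
        unfolding Bessel_entire_0[symmetric]
        by (rule isCont_tendsto_compose) (use tendsto_of_real[OF 3, where 'a=complex] in simp)
      have "((\<lambda>r. (cosh r / sinh r * (exp t * exp (- exp t))) *\<^sub>R (Bessel_entire \<nu> (of_real (exp (2 * (t - ln (sinh r))) / 4)) *
           exp (\<nu> * of_real (t + (r - ln (sinh r) - ln 2)))))
         \<longlongrightarrow> (1 * (exp t * exp (- exp t))) *\<^sub>R (rGamma (\<nu> + 1) * exp (\<nu> * of_real (t + 0)))) at_top"
        by (intro tendsto_intros 1 2 4)
      moreover have "exp (\<nu> * of_real r) * Bessel_exp \<nu> (t - ln (sinh r)) =
          Bessel_entire \<nu> (of_real (exp (2 * (t - ln (sinh r))) / 4)) * exp (\<nu> * of_real (t + (r - ln (sinh r) - ln 2)))" for r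
        unfolding Bessel_exp_def by (simp add: algebra_simps flip: exp_add)
      ultimately show "((\<lambda>r. u r t) \<longlongrightarrow> (1 * (exp t * exp (- exp t))) *\<^sub>R (rGamma (\<nu> + 1) * exp (\<nu> * of_real (t + 0)))) at_top"
        unfolding u_def by simp
    qed
    have "eventually (\<lambda>r::real. 0 < cosh r / sinh r \<and> cosh r / sinh r < 2) at_top" 
      by (intro eventually_conj) real_asymp+
    then show "eventually (\<lambda>r. AE t in lborel. norm (u r t) \<le> 2 * B * (exp (1 * t) * exp (- (1 * exp t)))) at_top"
    proof eventually_elim
      case (elim r)
      show ?case
      proof (rule AE_I2)
        fix t
        have "norm (u r t) = cosh r / sinh r * (exp t * exp (- exp t)) * norm (Bessel_exp \<nu> (t - ln (sinh r)))"
          using abs_of_pos[OF conjunct1[OF elim]]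
          by (simp add: u_def norm_mult norm_exp_eq_Re nu abs_mult del: abs_divide times_divide_eq_left)
        also have "\<dots> \<le> 2 * (exp t * exp (- exp t)) * B"
          using elim yB by (intro mult_mono mult_right_mono) auto
        finally show "norm (u r t) \<le> 2 * B * (exp (1 * t) * exp (- (1 * exp t)))" by (simp add: mult_ac)
      qed
    qed
  qed measurable
  have "has_bochner_integral lborel (\<lambda>t. rGamma (\<nu> + 1) * exp ((\<nu> + 1) * of_real t - of_real (exp t))) (rGamma (\<nu> + 1) * Gamma (\<nu> + 1))"
    by (intro has_bochner_integral_mult_right Gamma_line_integral) (simp add: nu)
  moreover have "rGamma (\<nu> + 1) * Gamma (\<nu> + 1) = 1"
    using Gamma_nonzero_if_Re_pos[of "\<nu> + 1"] nu by (simp add: rGamma_inverse_Gamma)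
  moreover have "rGamma (\<nu> + 1) * exp ((\<nu> + 1) * of_real t - of_real (exp t)) = (1 * (exp t * exp (- exp t))) *\<^sub>R (rGamma (\<nu> + 1) * exp (\<nu> * of_real (t + 0)))" for t
    by (simp add: scaleR_conv_of_real exp_diff exp_add exp_minus field_simps flip: exp_of_real)
  ultimately have "(LINT t|lborel. (1 * (exp t * exp (- exp t))) *\<^sub>R (rGamma (\<nu> + 1) * exp (\<nu> * of_real (t + 0)))) = 1"
    by (simp only: has_bochner_integral_iff)
  with lim have "((\<lambda>r. LINT t|lborel. u r t) \<longlongrightarrow> 1) at_top" by simp
  moreover have "eventually (\<lambda>r. (LINT t|lborel. u r t) = exp (\<i> * of_real (s * r)) * Laplace_Bessel s r) at_top"
    using eventually_gt_at_top[of 0] by eventually_elim (use eq in \<open>simp add: \<nu>_def mult.assoc\<close>)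
  ultimately show ?thesis by (rule Lim_transform_eventually)
qed

text \<open>Two successive first integrals, with w = is, write e^(wr) N as A + D e^(2wr).
  Convergence to 1 excludes the oscillating term, so D = 0 and A = 1.\<close>

lemma Laplace_Bessel_eq:
  assumes s: "s \<noteq> 0" and r: "r > 0"
  shows "Laplace_Bessel s r = exp (- (\<i> * of_real (s * r)))"
proof -
  obtain N' where d0: "\<And>r. r > 0 \<Longrightarrow> (Laplace_Bessel s has_vector_derivative N' r) (at r)"
    and d1: "\<And>r. r > 0 \<Longrightarrow> (N' has_vector_derivative - (s\<^sup>2) *\<^sub>R Laplace_Bessel s r) (at r)"
    using Laplace_Bessel_ODE[OF s] by metis
  let ?N = "Laplace_Bessel s" and ?w = "\<i> * complex_of_real s"
  have w2: "?w * ?w = - of_real (s\<^sup>2)" by (simp add: power2_eq_square algebra_simps)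
  have dexp: "((\<lambda>r. exp (c * of_real r)) has_vector_derivative c * exp (c * of_real r)) (at r)" for c :: complex and r
    using exp_scaleR_has_vector_derivative_right[of c r UNIV] by (simp add: scaleR_conv_of_real mult.commute)
  \<comment> \<open>N'' = w^2 N factors as (d/dr - w)(d/dr + w) N = 0, so N' + wN is a multiple of
    e^(wr).\<close>
  have "\<exists>c. \<forall>r\<in>{0<..}. exp (- ?w * of_real r) * (N' r + ?w * ?N r) = c"
  proof (rule has_vector_derivative_zero_constant)
    fix r :: real assume "r \<in> {0<..}"
    then have r: "r > 0" by simp
    have "((\<lambda>r. exp (- ?w * of_real r) * (N' r + ?w * ?N r)) has_vector_derivative
        exp (- ?w * of_real r) * (- (s\<^sup>2) *\<^sub>R ?N r + ?w * N' r) + - ?w * exp (- ?w * of_real r) * (N' r + ?w * ?N r)) (at r)"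
      by (intro has_vector_derivative_mult dexp has_vector_derivative_add has_vector_derivative_mult_right d0 d1 r)
    also have "exp (- ?w * of_real r) * (- (s\<^sup>2) *\<^sub>R ?N r + ?w * N' r) + - ?w * exp (- ?w * of_real r) * (N' r + ?w * ?N r)
        = exp (- ?w * of_real r) * ((- of_real (s\<^sup>2) - ?w * ?w) * ?N r)"
      by (simp add: scaleR_conv_of_real algebra_simps)
    finally show "((\<lambda>r. exp (- ?w * of_real r) * (N' r + ?w * ?N r)) has_vector_derivative 0) (at r within {0<..})"
      unfolding w2 by (simp add: has_vector_derivative_at_within)
  qed auto
  then obtain C where C: "exp (- ?w * of_real r) * (N' r + ?w * ?N r) = C" if "r > 0" for r by auto
  have C': "N' r + ?w * ?N r = C * exp (?w * of_real r)" if "r > 0" for r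
    using C[OF that] by (simp add: exp_minus field_simps)
  define D where "D = C / (2 * ?w)"
  have D: "2 * ?w * D = C" using s by (simp add: D_def)
  have "\<exists>c. \<forall>r\<in>{0<..}. exp (?w * of_real r) * ?N r - D * exp ((2 * ?w) * of_real r) = c"
  proof (rule has_vector_derivative_zero_constant)
    fix r :: real assume "r \<in> {0<..}"
    then have r: "r > 0" by simp
    have e: "exp ((2 * ?w) * of_real r) = exp (?w * of_real r) * exp (?w * of_real r)"
      by (simp add: algebra_simps flip: exp_add)
    have "((\<lambda>r. exp (?w * of_real r) * ?N r - D * exp ((2 * ?w) * of_real r)) has_vector_derivative
        (exp (?w * of_real r) * N' r + ?w * exp (?w * of_real r) * ?N r) - D * (2 * ?w * exp (2 * ?w * of_real r))) (at r)"
      by (intro has_vector_derivative_diff has_vector_derivative_mult dexp has_vector_derivative_mult_right d0 r)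
    also have "(exp (?w * of_real r) * N' r + ?w * exp (?w * of_real r) * ?N r) - D * (2 * ?w * exp (2 * ?w * of_real r))
       = exp (?w * of_real r) * (N' r + ?w * ?N r) - (2 * ?w * D) * exp (2 * ?w * of_real r)"
      by (simp add: algebra_simps)
    also have "\<dots> = 0" unfolding C'[OF r] D e by (simp add: algebra_simps)
    finally show "((\<lambda>r. exp (?w * of_real r) * ?N r - D * exp ((2 * ?w) * of_real r)) has_vector_derivative 0) (at r within {0<..})"
      by (rule has_vector_derivative_at_within)
  qed auto
  then obtain A where A: "exp (?w * of_real r) * ?N r - D * exp ((2 * ?w) * of_real r) = A" if "r > 0" for r by auto
  have A': "exp (\<i> * of_real (s * r)) * ?N r = A + D * exp ((2 * ?w) * of_real r)" if "r > 0" for r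
    using A[OF that] by (simp add: algebra_simps)
  note lim = Laplace_Bessel_tendsto[OF s]
  have ev: "eventually (\<lambda>r. exp (\<i> * of_real (s * r)) * ?N r = A + D * exp ((2 * ?w) * of_real r)) at_top"
    using eventually_gt_at_top[of 0] by eventually_elim (rule A')
  have lim1: "((\<lambda>r. A + D * exp ((2 * ?w) * of_real r)) \<longlongrightarrow> 1) at_top"
    using lim ev by (rule Lim_transform_eventually)
  \<comment> \<open>Half a period of e^(2isr): the shift by \<open>p\<close> reverses the sign of
    the oscillating term and fixes the constant one, so the difference isolates D.\<close>
  define p where "p = pi / (2 * s)"
  have "filterlim (\<lambda>r. p + r) at_top at_top" by (rule filterlim_tendsto_add_at_top[OF tendsto_const filterlim_ident])
  from filterlim_compose[OF lim1 this]
  have lim2: "((\<lambda>r. A + D * exp ((2 * ?w) * of_real (p + r))) \<longlongrightarrow> 1) at_top" .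
  have shift: "exp ((2 * ?w) * of_real (p + r)) = - exp ((2 * ?w) * of_real r)" for r
  proof -
    have "(2 * ?w) * of_real p = of_real pi * \<i>" using s by (simp add: p_def)
    then show ?thesis by (simp only: of_real_add distrib_left exp_add exp_pi_i) simp
  qed
  have "((\<lambda>r. (A + D * exp ((2 * ?w) * of_real r)) - (A + D * exp ((2 * ?w) * of_real (p + r)))) \<longlongrightarrow> 1 - 1) at_top"
    by (intro tendsto_diff lim1 lim2)
  then have "((\<lambda>r. norm (2 * D * exp ((2 * ?w) * of_real r))) \<longlongrightarrow> 0) at_top"
    unfolding shift by (intro tendsto_norm_zero) (simp add: algebra_simps)
  then have "((\<lambda>r::real. norm (2 * D)) \<longlongrightarrow> 0) at_top"
    by (simp add: norm_mult norm_exp_eq_Re)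
  then have D0: "D = 0" by (simp add: tendsto_const_iff)
  with lim1 have "A = 1" by (simp add: tendsto_const_iff)
  with D0 A'[OF r] have "exp (\<i> * of_real (s * r)) * ?N r = 1" by simp
  then show ?thesis by (simp add: exp_minus field_simps)
qed

text \<open>Extension by zero makes this a Borel function on the whole line, so integrals over x > 0
  can be taken over \<open>lborel\<close> without an indicator.\<close>

definition Bessel_imag :: "real \<Rightarrow> real \<Rightarrow> complex" where
  "Bessel_imag s x = (if x > 0 then Bessel_J (\<i> * of_real s) x else 0)"

lemma Bessel_imag_measurable [measurable]: "Bessel_imag s \<in> borel_measurable borel"
proof -
  have "continuous_on UNIV (Bessel_exp (\<i> * of_real s))"
    by (intro continuous_at_imp_continuous_on ballI has_vector_derivative_continuous[OF Bessel_exp_deriv(1)]) simp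
  then have [measurable]: "Bessel_exp (\<i> * of_real s) \<in> borel_measurable borel" by (rule borel_measurable_continuous_onI)
  have "Bessel_imag s = (\<lambda>x. if x > 0 then Bessel_exp (\<i> * of_real s) (ln x) else 0)"
    by (auto simp: Bessel_imag_def Bessel_exp_eq fun_eq_iff)
  also have "\<dots> \<in> borel_measurable borel" by measurable
  finally show ?thesis .
qed

lemma norm_Bessel_imag_sq_le:
  assumes "s \<noteq> 0"
  shows "(norm (Bessel_imag s x))\<^sup>2 \<le> 2 * sinh (pi * s) / (pi * s)"
proof (cases "x > 0")
  case True
  have "(norm (Bessel_exp (\<i> * of_real s) (ln x)))\<^sup>2 \<le> 2 * sinh (pi * s) / (pi * s)"
    by (rule order_trans[OF _ Bessel_exp_energy[OF assms, of "ln x"]]) (use zero_le_power2[of s] in \<open>simp add: add_nonneg_nonneg\<close>)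
  with True show ?thesis by (simp add: Bessel_imag_def Bessel_exp_eq)
next
  case False
  have "0 \<le> (norm (rGamma (1 + \<i> * of_real s)))\<^sup>2" by simp
  with False show ?thesis unfolding norm_rGamma_imag_sq[OF assms] by (simp add: Bessel_imag_def)
qed

lemma has_bochner_integral_Laplace_Bessel_imag:
  assumes s: "s \<noteq> 0" and r: "r > 0"
  shows "has_bochner_integral lborel (\<lambda>x. exp (- (x * sinh r)) *\<^sub>R Bessel_imag s x) (exp (- (\<i> * of_real (s * r))) / of_real (cosh r))"
proof -
  let ?f = "\<lambda>x. exp (- (x * sinh r)) *\<^sub>R Bessel_imag s x"
  have R: "range (exp :: real \<Rightarrow> real) = {0<..}"
    by (auto simp: image_iff intro: exp_ln[symmetric])
  have m: "?f \<in> borel_measurable borel" by measurable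
  note sub = integral_substitution_line[where f="?f" and g=exp and g'=exp and S="{0<..}", OF m continuous_on_exp[OF continuous_on_id] DERIV_exp exp_gt_zero R]
  have S: "indicator {0<..} x *\<^sub>R ?f x = ?f x" for x by (auto simp: Bessel_imag_def indicator_def)
  have c: "cosh r > 0" by simp
  have eq: "exp t *\<^sub>R ?f (exp t) = (1 / cosh r) *\<^sub>R ((cosh r * exp t * exp (- (exp t * sinh r))) *\<^sub>R Bessel_exp (\<i> * of_real s) t)" for t
    using c by (simp add: Bessel_imag_def Bessel_exp_eq)
  have I: "integrable lborel (\<lambda>t. exp t *\<^sub>R ?f (exp t))"
    unfolding eq by (rule integrable_scaleR_right, rule Laplace_Bessel_ODE[OF s]) (use r in simp)
  have "(LINT t|lborel. exp t *\<^sub>R ?f (exp t)) = (1 / cosh r) *\<^sub>R Laplace_Bessel s r"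
    unfolding eq Laplace_Bessel_def by (rule integral_scaleR_right)
  also have "\<dots> = exp (- (\<i> * of_real (s * r))) / of_real (cosh r)"
    unfolding Laplace_Bessel_eq[OF s r] by (simp add: scaleR_conv_of_real)
  finally show ?thesis
    using sub I unfolding set_integrable_def set_lebesgue_integral_def S has_bochner_integral_iff by simp
qed

section \<open>Neumann's formula for the square\<close>

text \<open>Translates between the expression ln (1 + e^(2y)) in the Beta integral and hyperbolic
  cosines.\<close>

lemma cosh_times_exp: "2 * cosh y * exp y = 1 + exp (2 * y)" for y :: real
proof -
  have "exp (2 * y) = exp y * exp y" by (simp flip: exp_add)
  then show ?thesis unfolding cosh_field_def exp_minus by (simp only:) (simp add: field_simps)
qed

lemma of_real_cosh_complex: "complex_of_real (cosh r) = cosh (of_real r)"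
  by (simp only: cosh_field_def exp_of_real of_real_minus[symmetric] of_real_add of_real_divide of_real_numeral)

text \<open>The Beta integral with a = (1 + is)/2 and b = 1 - a. Then a + b = 1, and the reflection
  formula gives pi / sin (pi a), where sin (pi a) = cosh (pi s / 2).\<close>

lemma has_bochner_integral_sech_Fourier:
  "has_bochner_integral lborel (\<lambda>y. exp (\<i> * of_real (s * y)) / of_real (cosh y)) (of_real (pi / cosh (pi * s / 2)))"
proof -
  define a where "a = 1 / 2 + \<i> * of_real s / 2"
  have Re: "Re a > 0" "Re (1 - a) > 0" by (simp_all add: a_def)
  have h: "2 * exp (2 * a * of_real y - (a + (1 - a)) * of_real (ln (1 + exp (2 * y)))) = exp (\<i> * of_real (s * y)) / of_real (cosh y)" for y
  proof -
    have p: "1 + exp (2 * y) > 0" by (simp add: add_pos_pos)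
    have r: "exp y / (1 + exp (2 * y)) = 1 / (2 * cosh y)" unfolding cosh_times_exp[symmetric] by simp
    have "2 * a * of_real y = of_real y + \<i> * of_real (s * y)"
      by (simp add: a_def algebra_simps)
    then have "exp (2 * a * of_real y - (a + (1 - a)) * of_real (ln (1 + exp (2 * y))))
        = exp (\<i> * of_real (s * y)) * (of_real (exp y) / of_real (exp (ln (1 + exp (2 * y)))))"
      by (simp only: add_diff_cancel_left' add.commute[of a] diff_add_cancel mult_1 exp_diff exp_add exp_of_real mult.commute times_divide_eq_right)
    also have "exp (ln (1 + exp (2 * y))) = 1 + exp (2 * y)" using p by simp
    also have "exp (\<i> * of_real (s * y)) * (of_real (exp y) / of_real (1 + exp (2 * y))) = exp (\<i> * of_real (s * y)) / of_real (2 * cosh y)"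
      by (simp only: of_real_divide[symmetric] r) simp
    finally show ?thesis by simp
  qed
  have "sin (of_real pi * a) = of_real (cosh (pi * s / 2))"
  proof -
    have "of_real pi * a = of_real (pi / 2) + \<i> * of_real (pi * s / 2)" by (simp add: a_def field_simps)
    then have "sin (of_real pi * a) = cos (\<i> * of_real (pi * s / 2))"
      by (simp only: sin_add sin_of_real cos_of_real) simp
    also have "\<dots> = cosh (of_real (pi * s / 2))" by (simp only: cosh_conv_cos)
    also have "\<dots> = of_real (cosh (pi * s / 2))" by (rule of_real_cosh_complex[symmetric])
    finally show ?thesis .
  qed
  then have "2 * (Gamma a * Gamma (1 - a) / (2 * Gamma (a + (1 - a)))) = of_real (pi / cosh (pi * s / 2))"
    by (simp add: Gamma_reflection_complex)
  with has_bochner_integral_mult_right[OF Beta_line_integral[OF Re], of 2] show ?thesis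
    unfolding h by simp
qed

lemma range_sinh_real: "range (sinh :: real \<Rightarrow> real) = UNIV"
  by (metis sinh_arsinh_real surjI)

text \<open>The substitution q = sinh y gives a Beta integral with both parameters equal to z + 1/2.
  Legendre's duplication formula rewrites the result with the quotient of Gamma values that appears
  in \<open>Bessel_coeff_square_sum\<close>.\<close>

lemma has_bochner_integral_one_plus_sq_powr:
  assumes z: "Re z > - 1 / 2"
  shows "has_bochner_integral lborel (\<lambda>q. exp (- (z + 1) * of_real (ln (1 + q\<^sup>2))))
     (of_real pi * exp (- 2 * z * of_real (ln 2)) * Gamma (2 * z + 1) / (Gamma (z + 1))\<^sup>2)"
proof -
  define a where "a = z + 1 / 2"
  have a: "Re a > 0" using z by (simp add: a_def)
  let ?f = "\<lambda>q. exp (- (z + 1) * of_real (ln (1 + q\<^sup>2)))"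
  have m: "?f \<in> borel_measurable borel" by measurable
  have ds: "(sinh has_real_derivative cosh x) (at x)" for x
    by (auto intro!: derivative_eq_intros)
  note sub = integral_substitution_line[where f="?f" and g=sinh and g'=cosh and S=UNIV, OF m continuous_on_cosh[OF continuous_on_id] ds cosh_real_pos range_sinh_real]
  have eq: "cosh y *\<^sub>R ?f (sinh y) = exp (2 * a * of_real (ln 2)) * exp (2 * a * of_real y - (a + a) * of_real (ln (1 + exp (2 * y))))" for y
  proof -
    have p: "1 + exp (2 * y) > 0" by (simp add: add_pos_pos)
    have l: "ln (cosh y) = ln (1 + exp (2 * y)) - y - ln 2"
      unfolding cosh_times_exp[symmetric] by (simp add: ln_mult)
    have "1 + (sinh y)\<^sup>2 = (cosh y)\<^sup>2" by (simp add: cosh_square_eq)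
    then have "ln (1 + (sinh y)\<^sup>2) = 2 * ln (cosh y)" by (simp add: ln_realpow)
    moreover have "complex_of_real (cosh y) = exp (of_real (ln (cosh y)))" by (simp add: exp_of_real)
    ultimately have "cosh y *\<^sub>R ?f (sinh y) = exp (of_real (ln (cosh y)) + - (z + 1) * of_real (2 * ln (cosh y)))"
      by (simp only: scaleR_conv_of_real exp_add)
    also have "of_real (ln (cosh y)) + - (z + 1) * of_real (2 * ln (cosh y)) = - 2 * a * of_real (ln (cosh y))"
      by (simp add: a_def algebra_simps)
    also have "\<dots> = 2 * a * of_real (ln 2) + (2 * a * of_real y - (a + a) * of_real (ln (1 + exp (2 * y))))"
      unfolding l by (simp add: algebra_simps)
    finally show ?thesis by (simp only: exp_add)
  qed
  have "has_bochner_integral lborel (\<lambda>y. cosh y *\<^sub>R ?f (sinh y)) (exp (2 * a * of_real (ln 2)) * (Gamma a * Gamma a / (2 * Gamma (a + a))))"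
    unfolding eq by (intro has_bochner_integral_mult_right Beta_line_integral a)
  then have B: "has_bochner_integral lborel ?f (exp (2 * a * of_real (ln 2)) * (Gamma a * Gamma a / (2 * Gamma (a + a))))"
    using sub by (simp add: has_bochner_integral_iff set_integrable_def set_lebesgue_integral_def)
  have "a \<notin> \<int>\<^sub>\<le>\<^sub>0" "a + 1 / 2 \<notin> \<int>\<^sub>\<le>\<^sub>0" using a by (auto intro!: not_nonpos_Ints_if_Re_pos)
  from Gamma_legendre_duplication[OF this]
  have dup: "Gamma a * Gamma (z + 1) = exp (- 2 * z * of_real (ln 2)) * of_real (sqrt pi) * Gamma (2 * z + 1)"
    by (simp add: a_def algebra_simps)
  have aa: "a + a = 2 * z + 1" by (simp add: a_def)
  have nz: "Gamma (2 * z + 1) \<noteq> 0" "Gamma (z + 1) \<noteq> 0" using z by (intro Gamma_nonzero_if_Re_pos; simp)+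
  have e2: "exp (2 * a * of_real (ln 2)) = 2 * exp (2 * z * of_real (ln 2))"
  proof -
    have "2 * a * of_real (ln 2) = of_real (ln 2) + 2 * z * of_real (ln 2)" by (simp add: a_def algebra_simps)
    then have "exp (2 * a * of_real (ln 2)) = of_real (exp (ln 2)) * exp (2 * z * of_real (ln 2))" by (simp only: exp_add exp_of_real)
    then show ?thesis by simp
  qed
  define P where "P = exp (2 * z * of_real (ln 2))"
  have P: "P \<noteq> 0" "exp (- 2 * z * of_real (ln 2)) = 1 / P" by (simp_all add: P_def exp_minus divide_inverse)
  have sp: "complex_of_real (sqrt pi) * of_real (sqrt pi) = of_real pi" by (simp flip: of_real_mult)
  have Ga: "Gamma a = of_real (sqrt pi) * Gamma (2 * z + 1) / (P * Gamma (z + 1))"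
    using dup nz P by (simp add: field_simps)
  have "exp (2 * a * of_real (ln 2)) * (Gamma a * Gamma a / (2 * Gamma (a + a))) =
     (of_real (sqrt pi) * of_real (sqrt pi)) * Gamma (2 * z + 1) / (P * (Gamma (z + 1))\<^sup>2)"
    unfolding e2 aa P_def[symmetric] Ga using nz P(1) by (simp add: field_simps power2_eq_square)
  also have "\<dots> = of_real pi * exp (- 2 * z * of_real (ln 2)) * Gamma (2 * z + 1) / (Gamma (z + 1))\<^sup>2"
    unfolding sp P(2) by simp
  finally show ?thesis using B by simp
qed

lemma integrable_inverse_one_plus_sq: "integrable lborel (\<lambda>q::real. 1 / (1 + q\<^sup>2))"
proof -
  have p: "1 + q\<^sup>2 > 0" for q :: real by (simp add: add_pos_nonneg)
  have "integrable lborel (\<lambda>q. norm (exp (- (0 + 1) * complex_of_real (ln (1 + q\<^sup>2)))))"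
    using has_bochner_integral_one_plus_sq_powr[of 0] by (intro integrable_norm) (simp add: has_bochner_integral_iff)
  moreover have "norm (exp (- (0 + 1) * complex_of_real (ln (1 + q\<^sup>2)))) = 1 / (1 + q\<^sup>2)" for q
    unfolding norm_exp_eq_Re using p[of q] by (simp add: exp_minus divide_inverse)
  ultimately show ?thesis by simp
qed

text \<open>For w = \<nu> + k the products of coefficients are, up to a common factor, products of
  the generalised binomials (w over i) and (w over k - i). Vandermonde's identity sums them to (2w
  over k).\<close>

lemma Bessel_coeff_square_sum:
  assumes "Re \<nu> \<ge> 0"
  shows "(\<Sum>i\<le>k. Bessel_coeff \<nu> i * Bessel_coeff \<nu> (k - i)) =
    Bessel_coeff (2 * \<nu>) k * Gamma (2 * (\<nu> + of_nat k) + 1) / (Gamma (\<nu> + of_nat k + 1))\<^sup>2"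
proof -
  define w where "w = \<nu> + of_nat k"
  have w: "w + 1 \<notin> \<int>\<^sub>\<le>\<^sub>0" "2 * w + 1 \<notin> \<int>\<^sub>\<le>\<^sub>0" using assms by (auto intro!: not_nonpos_Ints_if_Re_pos simp: w_def add_pos_nonneg)
  have G: "Gamma (w + 1) \<noteq> 0" using assms by (intro Gamma_nonzero_if_Re_pos) (simp add: w_def)
  have choose: "w gchoose i = Gamma (w + 1) * rGamma (of_nat (k - i) + \<nu> + 1) / fact i" if "i \<le> k" for i
  proof -
    have "w - of_nat i + 1 = of_nat (k - i) + \<nu> + 1" using that by (simp add: w_def of_nat_diff)
    then show ?thesis
      unfolding gbinomial_Gamma[OF w(1)] rGamma_inverse_Gamma by (simp only: divide_inverse inverse_mult_distrib mult_ac)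
  qed
  have "(2 * w gchoose k) = (\<Sum>i\<in>{0..k}. (w gchoose i) * (w gchoose (k - i)))"
    using gbinomial_Vandermonde[of w w k] by simp
  also have "\<dots> = (\<Sum>i\<le>k. (Gamma (w + 1))\<^sup>2 * (-1) ^ k * (Bessel_coeff \<nu> i * Bessel_coeff \<nu> (k - i)))"
    unfolding atLeast0AtMost
  proof (intro sum.cong refl)
    fix i assume "i \<in> {..k}"
    then have i: "i \<le> k" "k - i \<le> k" "k - (k - i) = i" by auto
    have sg: "(-1) ^ k * ((-1) ^ i * (-1) ^ (k - i)) = (1 :: complex)"
      using i(1) by (simp flip: power_add power_mult_distrib)
    have "(Gamma (w + 1))\<^sup>2 * (-1) ^ k * (Bessel_coeff \<nu> i * Bessel_coeff \<nu> (k - i)) =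
       ((-1) ^ k * ((-1) ^ i * (-1) ^ (k - i))) * ((Gamma (w + 1) * rGamma (of_nat (k - i) + \<nu> + 1) / fact i) * (Gamma (w + 1) * rGamma (of_nat i + \<nu> + 1) / fact (k - i)))"
      unfolding Bessel_coeff_def by (simp add: power2_eq_square mult_ac)
    then show "(w gchoose i) * (w gchoose (k - i)) = (Gamma (w + 1))\<^sup>2 * (-1) ^ k * (Bessel_coeff \<nu> i * Bessel_coeff \<nu> (k - i))"
      unfolding choose[OF i(1)] choose[OF i(2)] i(3) sg by simp
  qed
  also have "\<dots> = (Gamma (w + 1))\<^sup>2 * (-1) ^ k * (\<Sum>i\<le>k. Bessel_coeff \<nu> i * Bessel_coeff \<nu> (k - i))"
    by (rule sum_distrib_left[symmetric])
  finally have 1: "(2 * w gchoose k) = (Gamma (w + 1))\<^sup>2 * (-1) ^ k * (\<Sum>i\<le>k. Bessel_coeff \<nu> i * Bessel_coeff \<nu> (k - i))" .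
  have "2 * w - of_nat k + 1 = of_nat k + 2 * \<nu> + 1" by (simp add: w_def)
  then have 2: "(-1) ^ k * (2 * w gchoose k) = Gamma (2 * w + 1) * Bessel_coeff (2 * \<nu>) k"
    unfolding gbinomial_Gamma[OF w(2)] Bessel_coeff_def rGamma_inverse_Gamma by (simp add: divide_inverse mult_ac)
  have sq: "(-1) ^ k * ((-1) ^ k * x) = x" for x :: complex by (simp flip: mult.assoc power_mult_distrib)
  have "(Gamma (w + 1))\<^sup>2 * (\<Sum>i\<le>k. Bessel_coeff \<nu> i * Bessel_coeff \<nu> (k - i)) = Gamma (2 * w + 1) * Bessel_coeff (2 * \<nu>) k"
    unfolding 2[symmetric] 1 mult.commute[of _ "(-1) ^ k"] mult.assoc sq ..
  then show ?thesis using G by (simp add: w_def field_simps)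
qed

text \<open>Neumann's average of J_2\<nu>(2x cos \<theta>) over \<theta> between -pi/2 and pi/2,
  written with q = tan \<theta>, so that d\<theta> = dq / (1 + q^2) and cos \<theta> = 1 / sqrt (1 +
  q^2). Both sides are compared as power series in x.\<close>

lemma Bessel_imag_square:
  assumes x: "x > 0"
  shows "(Bessel_imag s x)\<^sup>2 = (LINT q|lborel. (1 / (1 + q\<^sup>2)) *\<^sub>R Bessel_imag (2 * s) (2 * x / sqrt (1 + q\<^sup>2))) / of_real pi"
proof -
  define \<nu> where "\<nu> = \<i> * complex_of_real s"
  have nu: "Re \<nu> = 0" "\<i> * complex_of_real (2 * s) = 2 * \<nu>" by (simp_all add: \<nu>_def)
  have p: "1 + q\<^sup>2 > 0" for q :: real by (simp add: add_pos_nonneg)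
  define c where "c = (\<lambda>k. Bessel_coeff (2 * \<nu>) k * of_real (x\<^sup>2) ^ k * exp (2 * \<nu> * of_real (ln x)))"
  \<comment> \<open>The k-th term of the series of the weighted integrand; \<open>c k\<close>
    collects what does not depend on q.\<close>
  define T where "T = (\<lambda>k q. c k * exp (- (\<nu> + of_nat k + 1) * of_real (ln (1 + q\<^sup>2))))"
  have T: "has_bochner_integral lborel (T k) (c k * (of_real pi * exp (- 2 * (\<nu> + of_nat k) * of_real (ln 2)) * Gamma (2 * (\<nu> + of_nat k) + 1) / (Gamma (\<nu> + of_nat k + 1))\<^sup>2))" for k
    unfolding T_def by (intro has_bochner_integral_mult_right has_bochner_integral_one_plus_sq_powr) (simp add: nu)
  have "Re (2 * \<nu>) \<ge> 0" by (simp add: nu)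
  note entire = Bessel_entire_sums[OF this] and sum_norm = summable_norm_Bessel_coeff[OF this]
  have T_sums: "(\<lambda>k. T k q) sums ((1 / (1 + q\<^sup>2)) *\<^sub>R Bessel_imag (2 * s) (2 * x / sqrt (1 + q\<^sup>2)))" for q
  proof -
    let ?y = "2 * x / sqrt (1 + q\<^sup>2)"
    have y: "?y > 0" using x p[of q] by simp
    have l: "ln (?y / 2) = ln x - ln (1 + q\<^sup>2) / 2" using x p[of q] by (simp add: ln_div ln_sqrt)
    then have e: "2 * \<nu> * of_real (ln (?y / 2)) = 2 * \<nu> * of_real (ln x) + - \<nu> * of_real (ln (1 + q\<^sup>2))"
      unfolding l by (simp add: algebra_simps)
    have y2: "(?y / 2)\<^sup>2 = x\<^sup>2 / (1 + q\<^sup>2)" using p[of q] by (simp add: power_divide)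
    have "(1 / (1 + q\<^sup>2)) *\<^sub>R Bessel_imag (2 * s) ?y =
        (exp (2 * \<nu> * of_real (ln x)) * exp (- \<nu> * of_real (ln (1 + q\<^sup>2))) / of_real (1 + q\<^sup>2)) * Bessel_entire (2 * \<nu>) (of_real (x\<^sup>2 / (1 + q\<^sup>2)))"
      using y unfolding Bessel_imag_def nu Bessel_J_eq[OF y] e y2 exp_add by (simp add: scaleR_conv_of_real)
    moreover have "T k q = (exp (2 * \<nu> * of_real (ln x)) * exp (- \<nu> * of_real (ln (1 + q\<^sup>2))) / of_real (1 + q\<^sup>2)) * (Bessel_coeff (2 * \<nu>) k * of_real (x\<^sup>2 / (1 + q\<^sup>2)) ^ k)" for k
    proof -
      have "exp (- (\<nu> + of_nat k + 1) * of_real (ln (1 + q\<^sup>2))) =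
          exp (- \<nu> * of_real (ln (1 + q\<^sup>2))) * exp (of_nat k * - of_real (ln (1 + q\<^sup>2))) * exp (- of_real (ln (1 + q\<^sup>2)))"
        by (simp add: algebra_simps flip: exp_add)
      also have "exp (of_nat k * - complex_of_real (ln (1 + q\<^sup>2))) = (1 / of_real (1 + q\<^sup>2)) ^ k"
        unfolding exp_of_nat_mult by (simp only: exp_minus exp_of_real exp_ln[OF p] divide_inverse mult_1)
      also have "exp (- complex_of_real (ln (1 + q\<^sup>2))) = 1 / of_real (1 + q\<^sup>2)"
        by (simp only: exp_minus exp_of_real exp_ln[OF p] divide_inverse mult_1)
      finally show ?thesis
        unfolding T_def c_def by (simp add: power_divide mult_ac)
    qed
    ultimately show ?thesis by (simp only: sums_mult[OF entire])
  qed
  \<comment> \<open>As \<nu> is imaginary, the power of 1 + q^2 has modulus (1 + q^2)^(-k-1), at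
    most 1 / (1 + q^2) for every k. What remains is the absolutely convergent series at x^2.\<close>
  have nT: "norm (T k q) \<le> norm (Bessel_coeff (2 * \<nu>) k * of_real (x\<^sup>2) ^ k) * (1 / (1 + q\<^sup>2))" for k q
  proof -
    have "norm (exp (- (\<nu> + of_nat k + 1) * of_real (ln (1 + q\<^sup>2)))) = exp (- (real k + 1) * ln (1 + q\<^sup>2))"
      by (simp add: norm_exp_eq_Re nu)
    also have "\<dots> \<le> exp (- 1 * ln (1 + q\<^sup>2))"
      by (subst exp_le_cancel_iff, rule mult_right_mono) (auto intro: ln_ge_zero)
    also have "\<dots> = 1 / (1 + q\<^sup>2)" using p[of q] by (simp add: exp_minus divide_inverse)
    finally have "norm (exp (- (\<nu> + of_nat k + 1) * of_real (ln (1 + q\<^sup>2)))) \<le> 1 / (1 + q\<^sup>2)" .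
    moreover have "norm (c k) = norm (Bessel_coeff (2 * \<nu>) k * of_real (x\<^sup>2) ^ k)"
      by (simp add: c_def norm_mult norm_exp_eq_Re nu)
    ultimately show ?thesis unfolding T_def norm_mult[of "c k"] by (intro mult_mono) auto
  qed
  have "(\<lambda>k. LINT q|lborel. T k q) sums (LINT q|lborel. (\<Sum>k. T k q))"
  proof (rule sums_integral)
    show iT: "integrable lborel (T k)" for k using T by (auto simp: has_bochner_integral_iff)
    show "AE q in lborel. summable (\<lambda>k. norm (T k q))"
    proof (rule AE_I2)
      fix q
      show "summable (\<lambda>k. norm (T k q))"
        by (rule summable_comparison_test'[OF summable_mult2[OF sum_norm[of "of_real (x\<^sup>2)"], of "1 / (1 + q\<^sup>2)"]]) (use nT in auto)
    qed
    show "summable (\<lambda>k. LINT q|lborel. norm (T k q))"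
    proof (rule summable_comparison_test'[OF summable_mult2[OF sum_norm[of "of_real (x\<^sup>2)"], of "LINT q|lborel. 1 / (1 + q\<^sup>2)"]])
      fix k :: nat
      have "(LINT q|lborel. norm (T k q)) \<le> (LINT q|lborel. norm (Bessel_coeff (2 * \<nu>) k * of_real (x\<^sup>2) ^ k) * (1 / (1 + q\<^sup>2)))"
        by (rule integral_mono[OF integrable_norm[OF iT] integrable_mult_right[OF integrable_inverse_one_plus_sq] nT])
      then show "norm (LINT q|lborel. norm (T k q)) \<le> norm (Bessel_coeff (2 * \<nu>) k * of_real (x\<^sup>2) ^ k) * (LINT q|lborel. 1 / (1 + q\<^sup>2))"
        by (simp only: integral_mult_right_zero real_norm_def abs_of_nonneg[OF integral_nonneg_AE[OF AE_I2[OF norm_ge_zero]]])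
    qed
  qed
  then have S1: "(\<lambda>k. LINT q|lborel. T k q) sums (LINT q|lborel. (1 / (1 + q\<^sup>2)) *\<^sub>R Bessel_imag (2 * s) (2 * x / sqrt (1 + q\<^sup>2)))"
    using sums_unique[OF T_sums] by simp
  let ?z = "complex_of_real ((x / 2)\<^sup>2)"
  have nu0: "Re \<nu> \<ge> 0" by (simp add: nu)
  have "(\<lambda>k. \<Sum>i\<le>k. (Bessel_coeff \<nu> i * ?z ^ i) * (Bessel_coeff \<nu> (k - i) * ?z ^ (k - i))) sums (Bessel_entire \<nu> ?z * Bessel_entire \<nu> ?z)"
    unfolding Bessel_entire_def by (intro Cauchy_product_sums summable_norm_Bessel_coeff nu0)
  then have "(\<lambda>k. ?z ^ k * (\<Sum>i\<le>k. Bessel_coeff \<nu> i * Bessel_coeff \<nu> (k - i))) sums (Bessel_entire \<nu> ?z)\<^sup>2"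
  proof -
    have "(\<Sum>i\<le>k. (Bessel_coeff \<nu> i * ?z ^ i) * (Bessel_coeff \<nu> (k - i) * ?z ^ (k - i))) = ?z ^ k * (\<Sum>i\<le>k. Bessel_coeff \<nu> i * Bessel_coeff \<nu> (k - i))" for k
      unfolding sum_distrib_left
    proof (intro sum.cong refl)
      fix i assume "i \<in> {..k}"
      then have "?z ^ k = ?z ^ i * ?z ^ (k - i)" by (simp only: power_add[symmetric]) simp
      then show "(Bessel_coeff \<nu> i * ?z ^ i) * (Bessel_coeff \<nu> (k - i) * ?z ^ (k - i)) = ?z ^ k * (Bessel_coeff \<nu> i * Bessel_coeff \<nu> (k - i))"
        by (simp only: mult_ac)
    qed
    then show ?thesis
      using \<open>(\<lambda>k. \<Sum>i\<le>k. (Bessel_coeff \<nu> i * ?z ^ i) * (Bessel_coeff \<nu> (k - i) * ?z ^ (k - i))) sums (Bessel_entire \<nu> ?z * Bessel_entire \<nu> ?z)\<close>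
      by (simp only: power2_eq_square)
  qed
  then have "(\<lambda>k. exp (2 * \<nu> * of_real (ln (x / 2))) * (?z ^ k * (\<Sum>i\<le>k. Bessel_coeff \<nu> i * Bessel_coeff \<nu> (k - i)))) sums
      (exp (2 * \<nu> * of_real (ln (x / 2))) * (Bessel_entire \<nu> ?z)\<^sup>2)"
    by (rule sums_mult)
  moreover have "exp (2 * \<nu> * of_real (ln (x / 2))) * (Bessel_entire \<nu> ?z)\<^sup>2 = (Bessel_imag s x)\<^sup>2"
  proof -
    have "exp (2 * \<nu> * of_real (ln (x / 2))) = (exp (\<nu> * of_real (ln (x / 2))))\<^sup>2"
      unfolding exp_double[symmetric] by (simp add: mult.assoc)
    then show ?thesis using x by (simp only: Bessel_imag_def Bessel_J_eq[OF x] if_True \<nu>_def[symmetric] power_mult_distrib mult.commute)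
  qed
  \<comment> \<open>The powers of 1/4 match: on the left they come from (x/2)^2, on the right from
    the duplication formula.\<close>
  moreover have "exp (2 * \<nu> * of_real (ln (x / 2))) * (?z ^ k * (\<Sum>i\<le>k. Bessel_coeff \<nu> i * Bessel_coeff \<nu> (k - i))) = (LINT q|lborel. T k q) / of_real pi" for k
  proof -
    have "2 * \<nu> * of_real (ln (x / 2)) = 2 * \<nu> * of_real (ln x) + - 2 * \<nu> * of_real (ln 2)"
      using x by (simp add: ln_div algebra_simps)
    then have e1: "exp (2 * \<nu> * of_real (ln (x / 2))) = exp (2 * \<nu> * of_real (ln x)) * exp (- 2 * \<nu> * of_real (ln 2))"
      by (simp only: exp_add)
    have "- 2 * (\<nu> + of_nat k) * complex_of_real (ln 2) = - 2 * \<nu> * of_real (ln 2) + of_nat k * of_real (- (2 * ln 2))"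
      by (simp add: algebra_simps)
    then have "exp (- 2 * (\<nu> + of_nat k) * of_real (ln 2)) = exp (- 2 * \<nu> * of_real (ln 2)) * exp (of_real (- (2 * ln 2))) ^ k"
      by (simp only: exp_add exp_of_nat_mult)
    also have "exp (complex_of_real (- (2 * ln 2))) = 1 / 4"
      unfolding exp_of_real by (simp add: exp_minus exp_double)
    finally have e2: "exp (- 2 * (\<nu> + of_nat k) * of_real (ln 2)) = exp (- 2 * \<nu> * of_real (ln 2)) * (1 / 4) ^ k" .
    have z: "?z ^ k = of_real (x\<^sup>2) ^ k * (1 / 4) ^ k" by (simp add: power_divide)
    show ?thesis
      unfolding has_bochner_integral_integral_eq[OF T] Bessel_coeff_square_sum[OF nu0] e1 e2 z c_def
      by simp
  qed
  ultimately have "(\<lambda>k. (LINT q|lborel. T k q) / of_real pi) sums (Bessel_imag s x)\<^sup>2" by simp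
  then show ?thesis by (rule sums_unique2[OF _ sums_divide[OF S1]])
qed

section \<open>The kernel\<close>

lemma borel_measurable_sinh_cosh [measurable]:
  "(sinh :: real \<Rightarrow> real) \<in> borel_measurable borel" "(cosh :: real \<Rightarrow> real) \<in> borel_measurable borel"
  by (intro borel_measurable_continuous_onI continuous_intros)+

text \<open>For a nonnegative integrand, a finite limit of the antiderivative yields integrability
  as well as the value.\<close>

lemma halfline_FTC_nonneg:
  fixes F f :: "real \<Rightarrow> real"
  assumes F: "\<And>x. (F has_real_derivative f x) (at x)" and f: "continuous_on UNIV f"
    and nonneg: "\<And>x. x > 0 \<Longrightarrow> f x \<ge> 0" and lim: "(F \<longlongrightarrow> B) at_top"
  shows "has_bochner_integral lborel (\<lambda>x. indicator {0<..} x * f x) (B - F 0)"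
proof -
  have U: "einterval 0 \<infinity> = {0<..}" by (auto simp: einterval_def zero_ereal_def)
  have "isCont F 0" using F by (rule DERIV_isCont)
  then have "(F \<longlongrightarrow> F 0) (at_right 0)" by (simp add: isCont_def filterlim_at_split)
  then have A: "((F \<circ> real_of_ereal) \<longlongrightarrow> F 0) (at_right 0)"
    by (simp add: zero_ereal_def ereal_tendsto_simps)
  have B: "((F \<circ> real_of_ereal) \<longlongrightarrow> B) (at_left \<infinity>)"
    using lim by (simp add: ereal_tendsto_simps)
  have c: "isCont f x" for x using f by (simp add: continuous_on_eq_continuous_at)
  have n: "AE x in lborel. 0 < ereal x \<longrightarrow> ereal x < \<infinity> \<longrightarrow> 0 \<le> f x"
    using nonneg by (auto simp: zero_ereal_def)
  note FTC = interval_integral_FTC_nonneg[of 0 \<infinity> F f, OF _ F c n A B]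
  show ?thesis
    using FTC by (simp add: U set_integrable_def set_lebesgue_integral_def has_bochner_integral_iff interval_lebesgue_integral_def)
qed

lemma line_FTC_nonneg:
  fixes F f :: "real \<Rightarrow> real"
  assumes F: "\<And>x. (F has_real_derivative f x) (at x)" and f: "continuous_on UNIV f"
    and nonneg: "\<And>x. f x \<ge> 0" and lim: "(F \<longlongrightarrow> A) at_bot" "(F \<longlongrightarrow> B) at_top"
  shows "has_bochner_integral lborel f (B - A)"
proof -
  have U: "einterval (-\<infinity>) \<infinity> = UNIV" by (auto simp: einterval_def)
  have c: "isCont f x" for x using f by (simp add: continuous_on_eq_continuous_at)
  have A: "((F \<circ> real_of_ereal) \<longlongrightarrow> A) (at_right (-\<infinity>))" and B: "((F \<circ> real_of_ereal) \<longlongrightarrow> B) (at_left \<infinity>)"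
    using lim by (simp_all add: ereal_tendsto_simps)
  have n: "AE x in lborel. -\<infinity> < ereal x \<longrightarrow> ereal x < \<infinity> \<longrightarrow> 0 \<le> f x"
    using nonneg by auto
  note FTC = interval_integral_FTC_nonneg[of "-\<infinity>" \<infinity> F f, OF _ F c n A B]
  show ?thesis
    using FTC by (simp add: U set_integrable_def set_lebesgue_integral_def has_bochner_integral_iff interval_lebesgue_integral_def)
qed

text \<open>On v > 0 the derivative of -1 / sqrt (1 + v^2), hence a probability density; the
  indicator allows integration over the whole line.\<close>

definition kernel_weight :: "real \<Rightarrow> real" where
  "kernel_weight v = indicator {0<..} v * (v / ((1 + v\<^sup>2) * sqrt (1 + v\<^sup>2)))"

text \<open>For z > 0 this equals 1 - (pi/2) z K_0(z), by \<open>Struve_K0_eq\<close>: the relative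
  error of the leading asymptotics of the Struve-type function.\<close>

definition kernel_Laplace :: "real \<Rightarrow> real" where
  "kernel_Laplace z = (LINT v|lborel. kernel_weight v * exp (- (z * v)))"

lemma kernel_weight_measurable [measurable]: "kernel_weight \<in> borel_measurable borel"
  unfolding kernel_weight_def by measurable

lemma kernel_Laplace_measurable [measurable]: "kernel_Laplace \<in> borel_measurable borel"
  unfolding kernel_Laplace_def by measurable

lemma kernel_weight_nonneg: "kernel_weight v \<ge> 0"
  by (simp add: kernel_weight_def indicator_def)

lemma DERIV_inverse_sqrt_one_plus_sq:
  "((\<lambda>v. - (1 / sqrt (1 + v\<^sup>2))) has_real_derivative v / ((1 + v\<^sup>2) * sqrt (1 + v\<^sup>2))) (at v)"
proof -
  have p: "1 + v\<^sup>2 > 0" by (simp add: add_pos_nonneg)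
  show ?thesis
    using p by (auto intro!: derivative_eq_intros simp: field_simps)
qed

lemma has_bochner_integral_kernel_weight: "has_bochner_integral lborel kernel_weight 1"
proof -
  have p: "1 + v\<^sup>2 > 0" for v :: real by (simp add: add_pos_nonneg)
  have nz: "(1 + v\<^sup>2) * sqrt (1 + v\<^sup>2) \<noteq> 0" for v :: real using p[of v] by simp
  have "has_bochner_integral lborel (\<lambda>v. indicator {0<..} v * (v / ((1 + v\<^sup>2) * sqrt (1 + v\<^sup>2)))) (0 - (- (1 / sqrt (1 + 0\<^sup>2))))"
  proof (rule halfline_FTC_nonneg[OF DERIV_inverse_sqrt_one_plus_sq])
    show "continuous_on UNIV (\<lambda>v::real. v / ((1 + v\<^sup>2) * sqrt (1 + v\<^sup>2)))"
      using nz by (intro continuous_intros) auto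
    show "((\<lambda>v::real. - (1 / sqrt (1 + v\<^sup>2))) \<longlongrightarrow> 0) at_top" by real_asymp
  qed simp
  then show ?thesis by (simp add: kernel_weight_def[abs_def])
qed

lemma kernel_weight_exp_le:
  assumes "z \<ge> 0"
  shows "kernel_weight v * exp (- (z * v)) \<le> kernel_weight v"
proof (cases "v > 0")
  case True
  then show ?thesis using assms by (intro mult_left_le kernel_weight_nonneg) auto
qed (simp add: kernel_weight_def)

lemma integrable_kernel_weight_exp:
  assumes "z \<ge> 0"
  shows "integrable lborel (\<lambda>v. kernel_weight v * exp (- (z * v)))"
proof (rule Bochner_Integration.integrable_bound)
  show "integrable lborel kernel_weight"
    using has_bochner_integral_kernel_weight by (simp add: has_bochner_integral_iff)
  show "AE v in lborel. norm (kernel_weight v * exp (- (z * v))) \<le> norm (kernel_weight v)"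
    using kernel_weight_exp_le[OF assms] by (intro AE_I2) (simp add: kernel_weight_nonneg)
qed simp

text \<open>The bound 1 is the total mass of the weight. The bound 1 / z^2 results from replacing
  the weight by v, whose Laplace transform is exactly that.\<close>

lemma kernel_Laplace_bounds:
  assumes "z > 0"
  shows "0 \<le> kernel_Laplace z" "kernel_Laplace z \<le> 1" "kernel_Laplace z \<le> 1 / z\<^sup>2"
proof -
  show "0 \<le> kernel_Laplace z"
    unfolding kernel_Laplace_def by (intro integral_nonneg_AE AE_I2) (simp add: kernel_weight_nonneg)
  note I = integrable_kernel_weight_exp[of z]
  have "kernel_Laplace z \<le> (LINT v|lborel. kernel_weight v)"
    unfolding kernel_Laplace_def
  proof (rule integral_mono[OF I])
    show "integrable lborel kernel_weight"
      using has_bochner_integral_kernel_weight by (simp add: has_bochner_integral_iff)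
    show "kernel_weight v * exp (- (z * v)) \<le> kernel_weight v" for v
      using assms by (intro kernel_weight_exp_le) simp
  qed (use assms in simp)
  then show "kernel_Laplace z \<le> 1"
    using has_bochner_integral_kernel_weight by (simp add: has_bochner_integral_iff)
  have "has_bochner_integral lborel (\<lambda>v. indicator {0<..} v * (v * exp (- (z * v)))) (0 - (- (0 / z + 1 / z\<^sup>2) * exp (- (z * 0))))"
  proof (rule halfline_FTC_nonneg)
    show "((\<lambda>v. - (v / z + 1 / z\<^sup>2) * exp (- (z * v))) has_real_derivative v * exp (- (z * v))) (at v)" for v
      using assms by (auto intro!: derivative_eq_intros simp: field_simps power2_eq_square)
    show "((\<lambda>v. - (v / z + 1 / z\<^sup>2) * exp (- (z * v))) \<longlongrightarrow> 0) at_top"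
      using assms by real_asymp
  qed (auto intro!: continuous_intros)
  then have J: "has_bochner_integral lborel (\<lambda>v. indicator {0<..} v * (v * exp (- (z * v)))) (1 / z\<^sup>2)" by simp
  have "kernel_Laplace z \<le> (LINT v|lborel. indicator {0<..} v * (v * exp (- (z * v))))"
    unfolding kernel_Laplace_def
  proof (rule integral_mono[OF I])
    show "integrable lborel (\<lambda>v. indicator {0<..} v * (v * exp (- (z * v))))"
      using J by (simp add: has_bochner_integral_iff)
    fix v :: real
    have "v / ((1 + v\<^sup>2) * sqrt (1 + v\<^sup>2)) \<le> v / 1" if "v > 0"
      using that mult_mono[of 1 "1 + v\<^sup>2" 1 "sqrt (1 + v\<^sup>2)"] by (intro divide_left_mono) auto
    then have "kernel_weight v \<le> indicator {0<..} v * v"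
      by (auto simp: kernel_weight_def indicator_def)
    from mult_right_mono[OF this exp_ge_zero]
    show "kernel_weight v * exp (- (z * v)) \<le> indicator {0<..} v * (v * exp (- (z * v)))"
      by (simp only: mult.assoc)
  qed (use assms in simp)
  then show "kernel_Laplace z \<le> 1 / z\<^sup>2" using J by (simp add: has_bochner_integral_iff)
qed

text \<open>For x at most 1 the trivial bound is used, otherwise the quadratic one with 2x cosh u at
  least x. Uniformity in u is what lets the majorants split in Fubini's theorem.\<close>

lemma kernel_Laplace_le:
  assumes x: "x > 0"
  shows "kernel_Laplace (2 * x * cosh u) \<le> 2 * (1 / (1 + x\<^sup>2))"
proof -
  have c: "cosh u \<ge> 1" by (rule cosh_real_ge_1)
  have z: "2 * x * cosh u > 0" using x by simp
  have xz: "x \<le> 2 * x * cosh u" using x c mult_mono[of 1 "2 * cosh u" x x] by (simp add: mult_ac)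
  have p: "1 + x\<^sup>2 > 0" by (simp add: add_pos_nonneg)
  show ?thesis
  proof (cases "x \<le> 1")
    case True
    then have "x\<^sup>2 \<le> 1" using x by (simp add: power_le_one)
    then have "1 \<le> 2 * (1 / (1 + x\<^sup>2))" using p by (simp add: field_simps)
    then show ?thesis using kernel_Laplace_bounds(2)[OF z] by linarith
  next
    case False
    then have "1 \<le> x\<^sup>2" by simp
    have "kernel_Laplace (2 * x * cosh u) \<le> 1 / (2 * x * cosh u)\<^sup>2" by (rule kernel_Laplace_bounds(3)[OF z])
    also have "\<dots> \<le> 1 / x\<^sup>2" using x z power_mono[OF xz, of 2] by (intro divide_left_mono) auto
    also have "\<dots> \<le> 2 * (1 / (1 + x\<^sup>2))" using p \<open>1 \<le> x\<^sup>2\<close> x by (simp add: field_simps)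
    finally show ?thesis .
  qed
qed

text \<open>After v = sinh t the integrand is e^(-zv) / sqrt (1 + v^2). Integration by parts: the
  derivative of -e^(-zv) / sqrt (1 + v^2) is z times this integrand plus the weighted exponential,
  and its integral over the half-line is 1.\<close>

lemma Struve_K0_eq:
  assumes z: "z > 0"
  shows "z * Struve_K0 z = 2 / pi * (1 - kernel_Laplace z)"
proof -
  have p: "1 + v\<^sup>2 > 0" for v :: real by (simp add: add_pos_nonneg)
  have nz: "(1 + v\<^sup>2) * sqrt (1 + v\<^sup>2) \<noteq> 0" "sqrt (1 + v\<^sup>2) \<noteq> 0" for v :: real using p[of v] by simp_all
  let ?g = "\<lambda>v. indicator {0<..} v * (exp (- (z * v)) / sqrt (1 + v\<^sup>2))"
  have "has_bochner_integral lborel (\<lambda>v. indicator {0<..} v * (z * (exp (- (z * v)) / sqrt (1 + v\<^sup>2)) + v / ((1 + v\<^sup>2) * sqrt (1 + v\<^sup>2)) * exp (- (z * v))))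
      (0 - (- (1 / sqrt (1 + 0\<^sup>2)) * exp (- (z * 0))))"
  proof (rule halfline_FTC_nonneg)
    show "((\<lambda>v. - (1 / sqrt (1 + v\<^sup>2)) * exp (- (z * v))) has_real_derivative
        z * (exp (- (z * v)) / sqrt (1 + v\<^sup>2)) + v / ((1 + v\<^sup>2) * sqrt (1 + v\<^sup>2)) * exp (- (z * v))) (at v)" for v
      by (rule DERIV_cong[OF DERIV_mult[OF DERIV_inverse_sqrt_one_plus_sq]])
         (auto intro!: derivative_eq_intros)
    show "continuous_on UNIV (\<lambda>v::real. z * (exp (- (z * v)) / sqrt (1 + v\<^sup>2)) + v / ((1 + v\<^sup>2) * sqrt (1 + v\<^sup>2)) * exp (- (z * v)))"
      using nz by (intro continuous_intros) auto
    show "((\<lambda>v. - (1 / sqrt (1 + v\<^sup>2)) * exp (- (z * v))) \<longlongrightarrow> 0) at_top"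
      using z by real_asymp
  qed (use z in auto)
  moreover have "indicator {0<..} v * (z * (exp (- (z * v)) / sqrt (1 + v\<^sup>2)) + v / ((1 + v\<^sup>2) * sqrt (1 + v\<^sup>2)) * exp (- (z * v)))
      = z * ?g v + kernel_weight v * exp (- (z * v))" for v
    by (simp add: kernel_weight_def indicator_def)
  ultimately have S: "has_bochner_integral lborel (\<lambda>v. z * ?g v + kernel_weight v * exp (- (z * v))) 1" by simp
  have I: "integrable lborel (\<lambda>v. kernel_weight v * exp (- (z * v)))" using z by (intro integrable_kernel_weight_exp) simp
  have "integrable lborel (\<lambda>v. (z * ?g v + kernel_weight v * exp (- (z * v))) - kernel_weight v * exp (- (z * v)))"
    by (rule Bochner_Integration.integrable_diff[OF _ I]) (use S in \<open>simp add: has_bochner_integral_iff\<close>)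
  then have zg: "integrable lborel (\<lambda>v. z * ?g v)" by simp
  have "(LINT v|lborel. z * ?g v + kernel_weight v * exp (- (z * v))) = z * (LINT v|lborel. ?g v) + kernel_Laplace z"
    unfolding kernel_Laplace_def by (subst Bochner_Integration.integral_add[OF zg I]) (simp only: integral_mult_right_zero)
  then have zg1: "z * (LINT v|lborel. ?g v) = 1 - kernel_Laplace z"
    using S by (simp add: has_bochner_integral_iff)
  have ds: "(sinh has_real_derivative cosh x) (at x)" for x
    by (auto intro!: derivative_eq_intros)
  have m: "?g \<in> borel_measurable borel" by measurable
  note sub = integral_substitution_line(2)[where f="?g" and g=sinh and g'=cosh and S=UNIV, OF m continuous_on_cosh[OF continuous_on_id] ds cosh_real_pos range_sinh_real]
  have e: "cosh t *\<^sub>R ?g (sinh t) = indicator {0<..} t *\<^sub>R exp (- z * sinh t)" for t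
  proof -
    have "1 + (sinh t)\<^sup>2 = (cosh t)\<^sup>2" by (simp add: cosh_square_eq)
    then have "sqrt (1 + (sinh t)\<^sup>2) = cosh t" by simp
    then show ?thesis by (simp add: indicator_def)
  qed
  have "(LINT t:{0..}|lborel. exp (- z * sinh t)) = (LINT t:{0<..}|lborel. exp (- z * sinh t))"
    unfolding set_lebesgue_integral_def
    by (intro integral_cong_AE) (auto intro!: AE_I[where N="{0}"] simp: indicator_def)
  also have "\<dots> = (LINT v|lborel. ?g v)"
    using sub unfolding e by (simp add: set_lebesgue_integral_def)
  finally have "Struve_K0 z = 2 / pi * (LINT v|lborel. ?g v)" by (simp add: Struve_K0_def)
  then show ?thesis using zg1 by (simp add: mult.left_commute)
qed

definition Omega_weight :: "nat \<Rightarrow> real \<Rightarrow> real" where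
  "Omega_weight n u = indicator {0..pi} u * (sinh u * sin (real n * u))"

lemma Omega_weight_measurable [measurable]: "Omega_weight n \<in> borel_measurable borel"
  unfolding Omega_weight_def by measurable

lemma integrable_Omega_weight: "integrable lborel (Omega_weight n)"
proof -
  have "continuous_on {0..pi} (\<lambda>u. sinh u * sin (real n * u))" by (intro continuous_intros)
  from borel_integrable_atLeastAtMost'[OF this] show ?thesis
    by (simp add: set_integrable_def Omega_weight_def[abs_def])
qed

text \<open>By \<open>Struve_K0_eq\<close> the subtracted term removes exactly the constant 1,
  leaving -1 / (pi cosh u) times \<open>kernel_Laplace\<close>. The cosh u then cancels against sinh
  2u = 2 sinh u cosh u.\<close>

lemma Omega_eq:
  assumes x: "x > 0"
  shows "Omega n x = - (2 / pi) * (LINT u|lborel. Omega_weight n u * kernel_Laplace (2 * x * cosh u))"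
proof -
  have eq: "(x * Struve_K0 (2 * x * cosh u) - 1 / (pi * cosh u)) * sinh (2 * u) * sin (real n * u)
      = - (2 / pi) * ((sinh u * sin (real n * u)) * kernel_Laplace (2 * x * cosh u))" for u
  proof -
    have c: "cosh u > 0" by simp
    have z: "2 * x * cosh u > 0" using x by simp
    have K: "x * Struve_K0 (2 * x * cosh u) = (1 - kernel_Laplace (2 * x * cosh u)) / (pi * cosh u)"
      using Struve_K0_eq[OF z] c by (simp add: field_simps)
    show ?thesis unfolding K sinh_double using c by (simp add: field_simps)
  qed
  have bd: "\<bar>Omega_weight n u * kernel_Laplace (2 * x * cosh u)\<bar> \<le> \<bar>Omega_weight n u\<bar>" for u
    using kernel_Laplace_bounds[of "2 * x * cosh u"] x by (simp add: abs_mult mult_left_le)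
  have "integrable lborel (\<lambda>u. Omega_weight n u * kernel_Laplace (2 * x * cosh u))"
    by (rule Bochner_Integration.integrable_bound[OF integrable_Omega_weight]) (use bd in auto)
  then have "set_integrable lborel {0..pi} (\<lambda>u. (sinh u * sin (real n * u)) * kernel_Laplace (2 * x * cosh u))"
    by (simp add: set_integrable_def Omega_weight_def mult.assoc)
  note I = set_borel_integral_eq_integral(2)[OF this]
  have "Omega n x = - (2 / pi) * integral {0..pi} (\<lambda>u. (sinh u * sin (real n * u)) * kernel_Laplace (2 * x * cosh u))"
    unfolding Omega_def eq by (rule integral_mult_right)
  then show ?thesis
    unfolding I[symmetric] by (simp add: set_lebesgue_integral_def Omega_weight_def mult.assoc)
qed

section \<open>Integrating the kernel against the square\<close>

text \<open>The Laplace transform of J_is at p, classically written (sqrt (1 + p^2) - p)^(is) / sqrt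
  (1 + p^2).\<close>

definition Laplace_kernel :: "real \<Rightarrow> real \<Rightarrow> complex" where
  "Laplace_kernel s p = exp (- (\<i> * of_real (s * arsinh p))) / of_real (sqrt (1 + p\<^sup>2))"

lemma Laplace_kernel_measurable [measurable]: "Laplace_kernel s \<in> borel_measurable borel"
proof -
  have [measurable]: "(arsinh :: real \<Rightarrow> real) \<in> borel_measurable borel"
    by (intro borel_measurable_continuous_onI continuous_intros)
  show ?thesis unfolding Laplace_kernel_def by measurable
qed

lemma norm_Laplace_kernel: "norm (Laplace_kernel s p) = 1 / sqrt (1 + p\<^sup>2)"
proof -
  have "1 + p\<^sup>2 > 0" by (simp add: add_pos_nonneg)
  then show ?thesis by (simp add: Laplace_kernel_def norm_divide norm_exp_eq_Re)
qed

lemma norm_Laplace_kernel_le: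
  assumes "p > 0"
  shows "p * norm (Laplace_kernel s p) \<le> 1"
proof -
  have "1 + p\<^sup>2 > 0" by (simp add: add_pos_nonneg)
  moreover have "sqrt (p\<^sup>2) \<le> sqrt (1 + p\<^sup>2)" by (intro real_sqrt_le_mono) simp
  ultimately show ?thesis using assms by (simp add: norm_Laplace_kernel)
qed

lemma has_bochner_integral_Laplace_kernel:
  assumes "s \<noteq> 0" "p > 0"
  shows "has_bochner_integral lborel (\<lambda>x. exp (- (x * p)) *\<^sub>R Bessel_imag s x) (Laplace_kernel s p)"
  using has_bochner_integral_Laplace_Bessel_imag[OF assms(1), of "arsinh p"] assms(2)
  by (simp add: Laplace_kernel_def cosh_arsinh_real add.commute)

lemma norm_Bessel_imag_bounded:
  assumes "s \<noteq> 0"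
  obtains B where "B \<ge> 0" "\<And>x. norm (Bessel_imag s x) \<le> B"
proof
  show "sqrt (2 * sinh (pi * s) / (pi * s)) \<ge> 0"
    using order_trans[OF zero_le_power2 norm_Bessel_imag_sq_le[OF assms, of 0]] by simp
  show "norm (Bessel_imag s x) \<le> sqrt (2 * sinh (pi * s) / (pi * s))" for x
    by (rule real_le_rsqrt[OF norm_Bessel_imag_sq_le[OF assms]])
qed

lemma Bessel_imag_nonpos: "x \<le> 0 \<Longrightarrow> Bessel_imag s x = 0"
  by (simp add: Bessel_imag_def)

text \<open>Neumann's average is inserted and the order of integration exchanged, with e^(-px)
  supplying decay in x and 1 / (1 + q^2) decay in q. The q-integral stays as it is until the
  integration over v.\<close>

lemma Laplace_Bessel_imag_square:
  assumes s: "s \<noteq> 0" and p: "p > 0"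
  shows "(LINT x|lborel. exp (- (x * p)) *\<^sub>R (Bessel_imag s x)\<^sup>2) =
    (LINT q|lborel. (1 / sqrt (1 + q\<^sup>2)) *\<^sub>R Laplace_kernel (2 * s) (p * (sqrt (1 + q\<^sup>2) / 2))) / of_real (2 * pi)"
proof -
  have s2: "2 * s \<noteq> 0" using s by simp
  obtain B where B: "B \<ge> 0" "\<And>x. norm (Bessel_imag (2 * s) x) \<le> B" using norm_Bessel_imag_bounded[OF s2] by metis
  have pos: "1 + q\<^sup>2 > 0" for q :: real by (simp add: add_pos_nonneg)
  define h where "h = (\<lambda>x q. exp (- (x * p)) *\<^sub>R ((1 / (1 + q\<^sup>2)) *\<^sub>R Bessel_imag (2 * s) (2 * x / sqrt (1 + q\<^sup>2))))"
  have [measurable]: "case_prod h \<in> borel_measurable (lborel \<Otimes>\<^sub>M lborel)" unfolding h_def by measurable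
  have bound: "norm (h x q) \<le> (B * (indicator {0<..} x * exp (- (p * x)))) * (1 / (1 + q\<^sup>2))" for x q
  proof (cases "x > 0")
    case True
    have "norm (h x q) = (norm (Bessel_imag (2 * s) (2 * x / sqrt (1 + q\<^sup>2))) * exp (- (p * x))) * (1 / (1 + q\<^sup>2))"
      using pos[of q] by (simp add: h_def mult_ac)
    also have "\<dots> \<le> (B * exp (- (p * x))) * (1 / (1 + q\<^sup>2))"
      using pos[of q] B by (intro mult_right_mono) auto
    finally show ?thesis using True by simp
  next
    case False
    then have "2 * x / sqrt (1 + q\<^sup>2) \<le> 0" using pos[of q] by (simp add: divide_nonpos_pos)
    then show ?thesis using False by (simp add: h_def Bessel_imag_def)
  qed
  have intx: "integrable lborel (\<lambda>x. B * (indicator {0<..} x * exp (- (p * x))))"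
  proof -
    have "has_bochner_integral lborel (\<lambda>x. indicator {0<..} x * exp (- (p * x))) (0 - (- (1 / p) * exp (- (p * 0))))"
    proof (rule halfline_FTC_nonneg)
      show "((\<lambda>x. - (1 / p) * exp (- (p * x))) has_real_derivative exp (- (p * x))) (at x)" for x
        using p by (auto intro!: derivative_eq_intros)
      show "((\<lambda>x. - (1 / p) * exp (- (p * x))) \<longlongrightarrow> 0) at_top" using p by real_asymp
    qed (auto intro!: continuous_intros)
    then show ?thesis by (simp add: has_bochner_integral_iff)
  qed
  have W: "exp (- (x * p)) *\<^sub>R (Bessel_imag s x)\<^sup>2 = (LINT q|lborel. h x q) / of_real pi" for x
  proof (cases "x > 0")
    case True
    show ?thesis unfolding Bessel_imag_square[OF True] h_def integral_scaleR_right by (simp add: scaleR_conv_of_real)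
  next
    case False
    then have "2 * x / sqrt (1 + q\<^sup>2) \<le> 0" for q using pos[of q] by (simp add: divide_nonpos_pos)
    then have "h x q = 0" for q unfolding h_def by (simp add: Bessel_imag_nonpos)
    then show ?thesis using False by (simp add: Bessel_imag_def)
  qed
  \<comment> \<open>Scaling x by sqrt (1 + q^2) / 2 normalises the Bessel argument; its Jacobian
    turns 1 / (1 + q^2) into half of 1 / sqrt (1 + q^2).\<close>
  have inner: "(LINT x|lborel. h x q) = (1 / sqrt (1 + q\<^sup>2)) *\<^sub>R Laplace_kernel (2 * s) (p * (sqrt (1 + q\<^sup>2) / 2)) / 2" for q
  proof -
    let ?c = "sqrt (1 + q\<^sup>2) / 2"
    have c: "?c > 0" using pos[of q] by simp
    have sq: "sqrt (1 + q\<^sup>2) * sqrt (1 + q\<^sup>2) = 1 + q\<^sup>2" using pos[of q] by simp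
    have "(LINT x|lborel. h x q) = (1 / (1 + q\<^sup>2)) *\<^sub>R (LINT x|lborel. exp (- (x * p)) *\<^sub>R Bessel_imag (2 * s) (2 * x / sqrt (1 + q\<^sup>2)))"
      unfolding h_def by (subst integral_scaleR_right[symmetric]) (simp add: mult.commute)
    also have "(LINT x|lborel. exp (- (x * p)) *\<^sub>R Bessel_imag (2 * s) (2 * x / sqrt (1 + q\<^sup>2))) =
        ?c *\<^sub>R (LINT x|lborel. exp (- (x * (p * ?c))) *\<^sub>R Bessel_imag (2 * s) x)"
      using c lborel_integral_real_affine[of ?c "\<lambda>x. exp (- (x * p)) *\<^sub>R Bessel_imag (2 * s) (2 * x / sqrt (1 + q\<^sup>2))" 0]
      by (simp add: mult_ac)
    also have "(LINT x|lborel. exp (- (x * (p * ?c))) *\<^sub>R Bessel_imag (2 * s) x) = Laplace_kernel (2 * s) (p * ?c)"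
      using has_bochner_integral_Laplace_kernel[OF s2, of "p * ?c"] p c by (simp add: has_bochner_integral_iff)
    also have "(1 / (1 + q\<^sup>2)) *\<^sub>R ?c *\<^sub>R Laplace_kernel (2 * s) (p * ?c) = (1 / sqrt (1 + q\<^sup>2)) *\<^sub>R Laplace_kernel (2 * s) (p * ?c) / 2"
    proof -
      have "1 / a * (r / 2) = 1 / r / 2" if "r * r = a" "r / 2 > 0" for r a :: real
        unfolding that(1)[symmetric] using that(2) by simp
      from this[OF sq c] have "(1 / (1 + q\<^sup>2)) *\<^sub>R ?c *\<^sub>R Laplace_kernel (2 * s) (p * ?c) = (1 / sqrt (1 + q\<^sup>2) / 2) *\<^sub>R Laplace_kernel (2 * s) (p * ?c)"
        by (simp only: scaleR_scaleR)
      then show ?thesis by (simp add: scaleR_conv_of_real)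
    qed
    finally show ?thesis .
  qed
  have "(LINT x|lborel. exp (- (x * p)) *\<^sub>R (Bessel_imag s x)\<^sup>2) = (LINT x|lborel. LINT q|lborel. h x q) / of_real pi"
    unfolding W by (rule integral_divide_zero)
  also have "(LINT x|lborel. LINT q|lborel. h x q) = (LINT q|lborel. LINT x|lborel. h x q)"
    by (rule Fubini_dominated[OF _ intx integrable_inverse_one_plus_sq bound]) measurable
  also have "\<dots> = (LINT q|lborel. (1 / sqrt (1 + q\<^sup>2)) *\<^sub>R Laplace_kernel (2 * s) (p * (sqrt (1 + q\<^sup>2) / 2))) / 2"
    unfolding inner by (rule integral_divide_zero)
  finally show ?thesis by simp
qed

text \<open>This is the q-integral remaining after the rescaling of v, with A = b^2 + p^2. An
  antiderivative is b q / (A sqrt (A + b^2 q^2)), with limits 1/A and -1/A at the two ends.\<close>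

lemma has_bochner_integral_line_kernel:
  fixes A b :: real
  assumes A: "A > 0" and b: "b > 0"
  shows "has_bochner_integral lborel (\<lambda>q. b / ((A + b\<^sup>2 * q\<^sup>2) * sqrt (A + b\<^sup>2 * q\<^sup>2))) (2 / A)"
proof -
  have pos: "A + b\<^sup>2 * q\<^sup>2 > 0" for q :: real using A by (simp add: add_pos_nonneg)
  have "has_bochner_integral lborel (\<lambda>q. b / ((A + b\<^sup>2 * q\<^sup>2) * sqrt (A + b\<^sup>2 * q\<^sup>2))) (1 / A - (- (1 / A)))"
  proof (rule line_FTC_nonneg)
    fix q :: real
    have s: "sqrt (A + b\<^sup>2 * q\<^sup>2) > 0" "sqrt (A + b\<^sup>2 * q\<^sup>2) * sqrt (A + b\<^sup>2 * q\<^sup>2) = A + b\<^sup>2 * q\<^sup>2"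
      using pos[of q] by simp_all
    have d: "((\<lambda>q. sqrt (A + b\<^sup>2 * q\<^sup>2)) has_real_derivative b\<^sup>2 * q / sqrt (A + b\<^sup>2 * q\<^sup>2)) (at q)"
      using pos[of q] by (auto intro!: derivative_eq_intros simp: field_simps)
    have "((\<lambda>q. b * q / (A * sqrt (A + b\<^sup>2 * q\<^sup>2))) has_real_derivative
        (b * (A * sqrt (A + b\<^sup>2 * q\<^sup>2)) - b * q * (A * (b\<^sup>2 * q / sqrt (A + b\<^sup>2 * q\<^sup>2)))) / ((A * sqrt (A + b\<^sup>2 * q\<^sup>2)) * (A * sqrt (A + b\<^sup>2 * q\<^sup>2)))) (at q)"
      using A s(1) by (intro DERIV_divide DERIV_cmult d) (auto intro!: derivative_eq_intros)
    moreover have "(b * (A * r) - b * q * (A * (b\<^sup>2 * q / r))) / ((A * r) * (A * r)) = b / (r * r * r)"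
      if "r > 0" "r * r = A + b\<^sup>2 * q\<^sup>2" for r
    proof -
      have "b * (A * r) - b * q * (A * (b\<^sup>2 * q / r)) = A * b * (r * r - b\<^sup>2 * q\<^sup>2) / r"
        using that(1) by (simp add: field_simps power2_eq_square)
      also have "r * r - b\<^sup>2 * q\<^sup>2 = A" using that(2) by simp
      finally show ?thesis using A that(1) by (simp add: field_simps)
    qed
    ultimately show "((\<lambda>q. b * q / (A * sqrt (A + b\<^sup>2 * q\<^sup>2))) has_real_derivative b / ((A + b\<^sup>2 * q\<^sup>2) * sqrt (A + b\<^sup>2 * q\<^sup>2))) (at q)"
      using s by simp
  next
    have "(A + b\<^sup>2 * q\<^sup>2) * sqrt (A + b\<^sup>2 * q\<^sup>2) \<noteq> 0" for q using pos[of q] by simp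
    then show "continuous_on UNIV (\<lambda>q. b / ((A + b\<^sup>2 * q\<^sup>2) * sqrt (A + b\<^sup>2 * q\<^sup>2)))"
      by (intro continuous_intros) auto
    show "b / ((A + b\<^sup>2 * q\<^sup>2) * sqrt (A + b\<^sup>2 * q\<^sup>2)) \<ge> 0" for q using pos[of q] b by simp
    show "((\<lambda>q. b * q / (A * sqrt (A + b\<^sup>2 * q\<^sup>2))) \<longlongrightarrow> - (1 / A)) at_bot" using A b by (real_asymp simp: field_simps)
    show "((\<lambda>q. b * q / (A * sqrt (A + b\<^sup>2 * q\<^sup>2))) \<longlongrightarrow> 1 / A) at_top" using A b by (real_asymp simp: field_simps)
  qed
  then show ?thesis by simp
qed

text \<open>The parameter b stands for cosh u. Writing \<open>kernel_Laplace\<close> as an integral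
  over v brings in the Laplace transform of the square at 2bv. For fixed q the new variable p = v b
  sqrt (1 + q^2) makes the transform independent of q, so q can be integrated out by
  \<open>has_bochner_integral_line_kernel\<close>.\<close>

lemma kernel_Laplace_transform_Bessel_square:
  assumes s: "s \<noteq> 0" and b: "b \<ge> 1"
  shows "(LINT x|lborel. kernel_Laplace (2 * x * b) *\<^sub>R (Bessel_imag s x)\<^sup>2) =
    (LINT p|lborel. (indicator {0<..} p * (p / (b\<^sup>2 + p\<^sup>2))) *\<^sub>R Laplace_kernel (2 * s) p) / of_real pi"
proof -
  define L where "L = Laplace_kernel (2 * s)"
  have [measurable]: "L \<in> borel_measurable borel" unfolding L_def by measurable
  have b0: "b > 0" using b by simp
  have pos: "1 + q\<^sup>2 > 0" for q :: real by (simp add: add_pos_nonneg)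
  obtain B where B: "B \<ge> 0" "\<And>x. norm (Bessel_imag s x) \<le> B" using norm_Bessel_imag_bounded[OF s] by metis
  let ?W = "\<lambda>x. (Bessel_imag s x)\<^sup>2"
  have W0: "?W x = 0" if "x \<le> 0" for x using that by (simp add: Bessel_imag_def)
  have WB: "norm (?W x) \<le> B\<^sup>2" for x using B by (simp add: norm_power power_mono)
  have swap1: "(LINT x|lborel. LINT v|lborel. (kernel_weight v * exp (- (2 * x * b * v))) *\<^sub>R ?W x)
      = (LINT v|lborel. LINT x|lborel. (kernel_weight v * exp (- (2 * x * b * v))) *\<^sub>R ?W x)"
  proof (rule lborel_pair.Fubini_integral[symmetric], rule lborel_pair.Fubini_integrable)
    have I: "integrable lborel (\<lambda>v. kernel_weight v * exp (- (2 * x * b * v)))" if "x > 0" for x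
      using integrable_kernel_weight_exp[of "2 * x * b"] that b0 by simp
    have eq: "(LINT v|lborel. norm ((kernel_weight v * exp (- (2 * x * b * v))) *\<^sub>R ?W x)) = kernel_Laplace (2 * x * b) * norm (?W x)" for x
      unfolding kernel_Laplace_def norm_scaleR integral_mult_left_zero[symmetric]
      by (intro Bochner_Integration.integral_cong refl) (simp add: abs_mult kernel_weight_nonneg)
    show "integrable lborel (\<lambda>x. LINT v|lborel. norm (case (x, v) of (x, v) \<Rightarrow> (kernel_weight v * exp (- (2 * x * b * v))) *\<^sub>R ?W x))"
      unfolding prod.case eq
    proof (rule Bochner_Integration.integrable_bound)
      show "integrable lborel (\<lambda>x. (2 * (1 / (1 + x\<^sup>2))) * B\<^sup>2)"
        by (intro integrable_mult_left integrable_mult_right integrable_inverse_one_plus_sq)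
      show "AE x in lborel. norm (kernel_Laplace (2 * x * b) * norm (?W x)) \<le> norm ((2 * (1 / (1 + x\<^sup>2))) * B\<^sup>2)"
      proof (rule AE_I2)
        fix x :: real
        show "norm (kernel_Laplace (2 * x * b) * norm (?W x)) \<le> norm ((2 * (1 / (1 + x\<^sup>2))) * B\<^sup>2)"
        proof (cases "x > 0")
          case True
          \<comment> \<open>Writing b as a hyperbolic cosine brings the integrand into the form of
            \<open>kernel_Laplace_le\<close>.\<close>
          have c: "cosh (arcosh b) = b" using b by simp
          have "0 \<le> kernel_Laplace (2 * x * b)" "kernel_Laplace (2 * x * b) \<le> 2 * (1 / (1 + x\<^sup>2))"
            using kernel_Laplace_bounds(1)[of "2 * x * b"] kernel_Laplace_le[OF True, of "arcosh b"] True b0 unfolding c by auto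
          then show ?thesis using WB[of x] pos[of x]
            by (simp only: real_norm_def abs_mult abs_of_nonneg norm_ge_zero abs_norm_cancel) (intro mult_mono, auto)
        qed (simp add: W0 not_less)
      qed
    qed measurable
    show "AE x in lborel. integrable lborel (\<lambda>v. case (x, v) of (x, v) \<Rightarrow> (kernel_weight v * exp (- (2 * x * b * v))) *\<^sub>R ?W x)"
    proof (rule AE_I2)
      fix x :: real
      show "integrable lborel (\<lambda>v. case (x, v) of (x, v) \<Rightarrow> (kernel_weight v * exp (- (2 * x * b * v))) *\<^sub>R ?W x)"
        using I[of x] by (cases "x > 0") (simp_all add: W0 not_less)
    qed
  qed measurable
  define g where "g = (\<lambda>v q. (kernel_weight v / sqrt (1 + q\<^sup>2)) *\<^sub>R L (v * (b * sqrt (1 + q\<^sup>2))))"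
  have [measurable]: "case_prod g \<in> borel_measurable (lborel \<Otimes>\<^sub>M lborel)" unfolding g_def by measurable
  have Lap: "(LINT x|lborel. (kernel_weight v * exp (- (2 * x * b * v))) *\<^sub>R ?W x) = (LINT q|lborel. g v q) / of_real (2 * pi)" for v
  proof (cases "v > 0")
    case True
    have "(LINT x|lborel. (kernel_weight v * exp (- (2 * x * b * v))) *\<^sub>R ?W x) = kernel_weight v *\<^sub>R (LINT x|lborel. exp (- (x * (2 * b * v))) *\<^sub>R ?W x)"
      by (subst integral_scaleR_right[symmetric]) (simp add: mult_ac)
    also have "(LINT x|lborel. exp (- (x * (2 * b * v))) *\<^sub>R ?W x) =
        (LINT q|lborel. (1 / sqrt (1 + q\<^sup>2)) *\<^sub>R L ((2 * b * v) * (sqrt (1 + q\<^sup>2) / 2))) / of_real (2 * pi)"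
      unfolding L_def using True b0 by (intro Laplace_Bessel_imag_square[OF s]) simp
    also have "kernel_weight v *\<^sub>R \<dots> = (kernel_weight v *\<^sub>R (LINT q|lborel. (1 / sqrt (1 + q\<^sup>2)) *\<^sub>R L ((2 * b * v) * (sqrt (1 + q\<^sup>2) / 2)))) / of_real (2 * pi)"
      by (simp add: scaleR_conv_of_real)
    also have "kernel_weight v *\<^sub>R (LINT q|lborel. (1 / sqrt (1 + q\<^sup>2)) *\<^sub>R L ((2 * b * v) * (sqrt (1 + q\<^sup>2) / 2))) = (LINT q|lborel. g v q)"
      unfolding g_def by (subst integral_scaleR_right[symmetric]) (simp add: mult_ac)
    finally show ?thesis .
  qed (simp add: kernel_weight_def g_def)
  \<comment> \<open>Since \<open>p * norm (Laplace_kernel s p)\<close> is at most 1, the transform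
    contributes 1 / (v sqrt (1 + q^2)): this cancels the v in the weight and supplies the second
    square root in q.\<close>
  have boundg: "norm (g v q) \<le> (1 / (1 + v\<^sup>2)) * (1 / (1 + q\<^sup>2))" for v q
  proof (cases "v > 0")
    case True
    let ?r = "sqrt (1 + q\<^sup>2)" and ?t = "sqrt (1 + v\<^sup>2)"
    have r: "?r > 0" "?r * ?r = 1 + q\<^sup>2" and t: "?t \<ge> 1" using pos[of q] by simp_all
    have vb: "v * (b * ?r) > 0" using True b0 r by simp
    have "norm (L (v * (b * ?r))) \<le> 1 / (v * (b * ?r))"
      using norm_Laplace_kernel_le[OF vb, of "2 * s"] vb unfolding L_def by (simp add: pos_le_divide_eq mult.commute)
    also have "\<dots> \<le> 1 / (v * ?r)" using True b r by (intro divide_left_mono) auto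
    finally have n: "norm (L (v * (b * ?r))) \<le> 1 / (v * ?r)" .
    have "norm (g v q) = v / ((1 + v\<^sup>2) * ?t) / ?r * norm (L (v * (b * ?r)))"
      using True pos[of v] by (simp add: g_def kernel_weight_def abs_mult)
    also have "\<dots> \<le> v / ((1 + v\<^sup>2) * 1) / ?r * (1 / (v * ?r))"
      using n True pos[of v] t r by (intro mult_mono divide_right_mono divide_left_mono mult_left_mono) auto
    also have "\<dots> = (1 / (1 + v\<^sup>2)) * (1 / (?r * ?r))" using True by (simp add: divide_simps)
    finally show ?thesis unfolding r(2) .
  qed (use pos[of v] pos[of q] in \<open>simp add: g_def kernel_weight_def\<close>)
  have swap2: "(LINT v|lborel. LINT q|lborel. g v q) = (LINT q|lborel. LINT v|lborel. g v q)"
    by (rule Fubini_dominated[OF _ integrable_inverse_one_plus_sq integrable_inverse_one_plus_sq boundg]) measurable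
  define k where "k = (\<lambda>p q. b / (((b\<^sup>2 + p\<^sup>2) + b\<^sup>2 * q\<^sup>2) * sqrt ((b\<^sup>2 + p\<^sup>2) + b\<^sup>2 * q\<^sup>2)))"
  define h where "h = (\<lambda>p q. (indicator {0<..} p * p * k p q) *\<^sub>R L p)"
  have [measurable]: "case_prod h \<in> borel_measurable (lborel \<Otimes>\<^sub>M lborel)" unfolding h_def k_def by measurable
  \<comment> \<open>With K = b sqrt (1 + q^2) and v = p / K one has 1 + v^2 = (K^2 + p^2) / K^2, and
    K^2 + p^2 = b^2 + p^2 + b^2 q^2 is the expression in \<open>k\<close>.\<close>
  have scale: "(LINT v|lborel. g v q) = (LINT p|lborel. h p q)" for q
  proof -
    let ?r = "sqrt (1 + q\<^sup>2)"
    let ?K = "b * ?r"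
    have r: "?r > 0" "?r\<^sup>2 = 1 + q\<^sup>2" using pos[of q] by simp_all
    have K: "?K > 0" using b0 r by simp
    have "(LINT v|lborel. g v q) = (1 / ?K) *\<^sub>R (LINT p|lborel. g (1 / ?K * p) q)"
    proof -
      have i: "1 / ?K > 0" using K by (rule divide_pos_pos[OF zero_less_one])
      then have "1 / ?K \<noteq> 0" by (rule less_imp_neq[symmetric])
      from lborel_integral_real_affine[OF this, of "\<lambda>v. g v q" 0]
      show ?thesis unfolding abs_of_pos[OF i] add_0 .
    qed
    also have "\<dots> = (LINT p|lborel. (1 / ?K) *\<^sub>R g (1 / ?K * p) q)" by (rule integral_scaleR_right[symmetric])
    also have "\<dots> = (LINT p|lborel. h p q)"
    proof (intro Bochner_Integration.integral_cong refl)
      fix p :: real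
      show "(1 / ?K) *\<^sub>R g (1 / ?K * p) q = h p q"
      proof (cases "p > 0")
        case True
        then have i: "1 / ?K * p > 0" using K by simp
        define S where "S = ?K\<^sup>2 + p\<^sup>2"
        have S: "S > 0" unfolding S_def by (intro add_pos_nonneg zero_less_power K) simp
        have "1 + (1 / c * p)\<^sup>2 = (c\<^sup>2 + p\<^sup>2) / c\<^sup>2" if "c > 0" for c
          using that by (simp add: power_divide add_divide_distrib)
        then have e1: "1 + (1 / ?K * p)\<^sup>2 = S / ?K\<^sup>2" unfolding S_def using K .
        have e2: "sqrt (S / ?K\<^sup>2) = sqrt S / ?K" unfolding real_sqrt_divide using K by simp
        have e3: "(b\<^sup>2 + p\<^sup>2) + b\<^sup>2 * q\<^sup>2 = S" by (simp add: S_def power_mult_distrib r(2) algebra_simps)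
        have "1 / c * p * c = p" if "c > 0" for c using that by simp
        then have e4: "1 / ?K * p * ?K = p" using K .
        have "(1 / ?K) * (kernel_weight (1 / ?K * p) / ?r) = p * (b / (S * sqrt S))"
        proof -
          have "kernel_weight (1 / ?K * p) = (1 / ?K * p) / (S / ?K\<^sup>2 * (sqrt S / ?K))"
            unfolding kernel_weight_def e1 e2 using i by simp
          also have "(1 / ?K) * (\<dots> / ?r) = p * (?K / ?r) / (S * sqrt S)"
            using K S r(1) by (simp add: divide_simps power2_eq_square)
          also have "?K / ?r = b" using r(1) by simp
          finally show ?thesis by simp
        qed
        then show ?thesis using True unfolding g_def h_def k_def e3 e4 by simp
      next
        case False
        then have "1 / ?K * p \<le> 0" using K by (simp add: divide_nonpos_pos)
        then show ?thesis using False by (simp add: g_def h_def kernel_weight_def)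
      qed
    qed
    finally show ?thesis .
  qed
  have A: "b\<^sup>2 + p\<^sup>2 > 0" for p :: real using b0 by (simp add: add_pos_nonneg)
  have kint: "has_bochner_integral lborel (k p) (2 / (b\<^sup>2 + p\<^sup>2))" for p
    unfolding k_def by (rule has_bochner_integral_line_kernel[OF A b0])
  have k0: "k p q \<ge> 0" for p q
    unfolding k_def using b0 A[of p] by (intro divide_nonneg_nonneg mult_nonneg_nonneg) auto
  \<comment> \<open>The integral of the norm over q is known exactly; the hypothesis that b is at
    least 1 then bounds it by 2 / (1 + p^2).\<close>
  have swap3: "(LINT q|lborel. LINT p|lborel. h p q) = (LINT p|lborel. LINT q|lborel. h p q)"
  proof (rule lborel_pair.Fubini_integral, rule lborel_pair.Fubini_integrable)
    have eq: "(LINT q|lborel. norm (h p q)) = (indicator {0<..} p * p * norm (L p)) * (2 / (b\<^sup>2 + p\<^sup>2))" for p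
    proof -
      have "(LINT q|lborel. norm (h p q)) = (LINT q|lborel. (indicator {0<..} p * p * norm (L p)) * k p q)"
        by (intro Bochner_Integration.integral_cong refl) (auto simp: h_def abs_mult k0 indicator_def)
      then show ?thesis using kint[of p] by (simp add: has_bochner_integral_iff)
    qed
    show "integrable lborel (\<lambda>p. LINT q|lborel. norm (case_prod h (p, q)))"
      unfolding prod.case eq
    proof (rule Bochner_Integration.integrable_bound)
      show "integrable lborel (\<lambda>p. 2 * (1 / (1 + p\<^sup>2)) :: real)"
        by (intro integrable_mult_right integrable_inverse_one_plus_sq)
      show "AE p in lborel. norm ((indicator {0<..} p * p * norm (L p)) * (2 / (b\<^sup>2 + p\<^sup>2))) \<le> norm (2 * (1 / (1 + p\<^sup>2)) :: real)"
      proof (rule AE_I2)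
        fix p :: real
        have 1: "\<bar>indicator {0<..} p * p * norm (L p)\<bar> \<le> 1"
          using norm_Laplace_kernel_le[of p "2 * s"] by (auto simp: L_def indicator_def abs_mult)
        have "1 \<le> b\<^sup>2" using b by simp
        then have 2: "2 / (b\<^sup>2 + p\<^sup>2) \<le> 2 * (1 / (1 + p\<^sup>2))" using pos[of p] A[of p] by (simp add: frac_le)
        have "norm ((indicator {0<..} p * p * norm (L p)) * (2 / (b\<^sup>2 + p\<^sup>2))) = \<bar>indicator {0<..} p * p * norm (L p)\<bar> * (2 / (b\<^sup>2 + p\<^sup>2))"
          using A[of p] by (simp add: abs_mult)
        also have "\<dots> \<le> 1 * (2 * (1 / (1 + p\<^sup>2)))" using 1 2 A[of p] by (intro mult_mono) auto
        also have "\<dots> \<le> norm (2 * (1 / (1 + p\<^sup>2)))" by simp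
        finally show "norm ((indicator {0<..} p * p * norm (L p)) * (2 / (b\<^sup>2 + p\<^sup>2))) \<le> norm (2 * (1 / (1 + p\<^sup>2)) :: real)" .
      qed
    qed measurable
    show "AE p in lborel. integrable lborel (\<lambda>q. case_prod h (p, q))"
      using kint by (auto simp: h_def has_bochner_integral_iff)
  qed measurable
  have inner: "(LINT q|lborel. h p q) = 2 *\<^sub>R ((indicator {0<..} p * (p / (b\<^sup>2 + p\<^sup>2))) *\<^sub>R L p)" for p
  proof -
    have "(LINT q|lborel. h p q) = (LINT q|lborel. k p q *\<^sub>R ((indicator {0<..} p * p) *\<^sub>R L p))"
      unfolding h_def by (simp add: mult_ac)
    also have "\<dots> = (LINT q|lborel. k p q) *\<^sub>R ((indicator {0<..} p * p) *\<^sub>R L p)"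
      using kint[of p] by (intro integral_scaleR_left) (simp add: has_bochner_integral_iff)
    finally show ?thesis using kint[of p] by (simp add: has_bochner_integral_iff mult_ac)
  qed
  have "(LINT x|lborel. kernel_Laplace (2 * x * b) *\<^sub>R ?W x) = (LINT x|lborel. LINT v|lborel. (kernel_weight v * exp (- (2 * x * b * v))) *\<^sub>R ?W x)"
  proof (intro Bochner_Integration.integral_cong refl)
    fix x :: real
    show "kernel_Laplace (2 * x * b) *\<^sub>R ?W x = (LINT v|lborel. (kernel_weight v * exp (- (2 * x * b * v))) *\<^sub>R ?W x)"
    proof (cases "x > 0")
      case True
      then have "integrable lborel (\<lambda>v. kernel_weight v * exp (- (2 * x * b * v)))"
        using b0 by (intro integrable_kernel_weight_exp) simp
      then show ?thesis unfolding kernel_Laplace_def by (intro integral_scaleR_left[symmetric])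
    qed (simp add: W0 not_less)
  qed
  also have "\<dots> = (LINT v|lborel. (LINT q|lborel. g v q) / of_real (2 * pi))" unfolding swap1 Lap ..
  also have "\<dots> = (LINT v|lborel. LINT q|lborel. g v q) / of_real (2 * pi)" by (rule integral_divide_zero)
  also have "(LINT v|lborel. LINT q|lborel. g v q) = (LINT p|lborel. LINT q|lborel. h p q)" unfolding swap2 scale swap3 ..
  also have "\<dots> = 2 *\<^sub>R (LINT p|lborel. (indicator {0<..} p * (p / (b\<^sup>2 + p\<^sup>2))) *\<^sub>R L p)"
    unfolding inner by (rule integral_scaleR_right)
  finally show ?thesis by (simp add: L_def scaleR_conv_of_real)
qed

section \<open>Inversion\<close>

lemma integral_even_half:
  fixes k :: "real \<Rightarrow> real"
  assumes int: "integrable lborel k" and even: "\<And>x. k (- x) = k x"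
  shows "(LINT x|lborel. indicator {0<..} x * k x) = (LINT x|lborel. k x) / 2"
proof -
  have I: "integrable lborel (\<lambda>x. indicator A x * k x)" if "A \<in> sets borel" for A
    using integrable_real_mult_indicator[of A lborel k] int that by (simp add: mult.commute)
  have "(LINT x|lborel. indicator {..<0} x * k x) = (LINT x|lborel. indicator {..<0} (- x) * k (- x))"
    using lborel_integral_real_affine[of "-1" "\<lambda>x. indicator {..<0} x * k x" 0] by simp
  also have "\<dots> = (LINT x|lborel. indicator {0<..} x * k x)"
    unfolding even by (intro Bochner_Integration.integral_cong refl) (simp add: indicator_def)
  finally have 1: "(LINT x|lborel. indicator {..<0} x * k x) = (LINT x|lborel. indicator {0<..} x * k x)" .
  have [measurable]: "k \<in> borel_measurable borel" using int by auto
  have "(LINT x|lborel. k x) = (LINT x|lborel. indicator {..<0} x * k x + indicator {0<..} x * k x)"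
    by (intro integral_cong_AE) (auto intro!: AE_I[where N="{0}"] simp: indicator_def)
  also have "\<dots> = (LINT x|lborel. indicator {..<0} x * k x) + (LINT x|lborel. indicator {0<..} x * k x)"
    by (intro Bochner_Integration.integral_add I) auto
  finally show ?thesis unfolding 1 by simp
qed

text \<open>With p = sinh r the rational factor becomes a difference of two translates of sech,
  which is odd in r. The imaginary part multiplies it by the odd function -sin (sr), so the
  half-line integral is half of a full-line one, evaluated by the Fourier integral of sech.\<close>

lemma Im_integral_Laplace_kernel:
  assumes u: "u > 0"
  shows "Im (LINT p|lborel. (indicator {0<..} p * (p / ((cosh u)\<^sup>2 + p\<^sup>2))) *\<^sub>R Laplace_kernel s p) =
    - pi * sin (s * u) / (2 * sinh u * cosh (pi * s / 2))"
proof -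
  let ?f = "\<lambda>p. (indicator {0<..} p * (p / ((cosh u)\<^sup>2 + p\<^sup>2))) *\<^sub>R Laplace_kernel s p"
  let ?c = "pi / cosh (pi * s / 2)"
  have sh: "sinh u > 0" using u by simp
  have ds: "(sinh has_real_derivative cosh x) (at x)" for x
    by (auto intro!: derivative_eq_intros)
  have m: "?f \<in> borel_measurable borel" by measurable
  note sub = integral_substitution_line(2)[where f="?f" and g=sinh and g'=cosh and S=UNIV, OF m continuous_on_cosh[OF continuous_on_id] ds cosh_real_pos range_sinh_real]
  \<comment> \<open>A partial fraction decomposition resting on cosh (r - u) cosh (r + u) = cosh^2 u
    + sinh^2 r.\<close>
  have frac: "sinh r / ((cosh u)\<^sup>2 + (sinh r)\<^sup>2) = (1 / cosh (r - u) - 1 / cosh (r + u)) / (2 * sinh u)" for r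
  proof -
    have prod: "cosh (r - u) * cosh (r + u) = (cosh u)\<^sup>2 + (sinh r)\<^sup>2"
    proof -
      have "cosh (r - u) * cosh (r + u) = (cosh r)\<^sup>2 * (cosh u)\<^sup>2 - (sinh r)\<^sup>2 * (sinh u)\<^sup>2"
        by (simp add: cosh_add cosh_diff algebra_simps power2_eq_square)
      also have "\<dots> = ((sinh r)\<^sup>2 + 1) * (cosh u)\<^sup>2 - (sinh r)\<^sup>2 * ((cosh u)\<^sup>2 - 1)"
        by (simp only: cosh_square_eq[of r] sinh_square_eq[of u])
      finally show ?thesis by (simp add: algebra_simps)
    qed
    have diff: "cosh (r + u) - cosh (r - u) = 2 * sinh u * sinh r"
      by (simp add: cosh_add cosh_diff)
    have p: "cosh (r - u) > 0" "cosh (r + u) > 0" by simp_all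
    have "1 / cosh (r - u) - 1 / cosh (r + u) = (cosh (r + u) - cosh (r - u)) / (cosh (r - u) * cosh (r + u))"
      using p by (simp add: field_simps)
    then show ?thesis unfolding prod diff using sh by simp
  qed
  define G where "G = (\<lambda>r. (indicator {0<..} r * ((1 / cosh (r - u) - 1 / cosh (r + u)) / (2 * sinh u))) *\<^sub>R exp (- (\<i> * of_real (s * r))))"
  have G: "cosh r *\<^sub>R ?f (sinh r) = G r" for r
  proof -
    have "Laplace_kernel s (sinh r) = exp (- (\<i> * of_real (s * r))) / of_real (cosh r)"
    proof -
      have "1 + (sinh r)\<^sup>2 = (cosh r)\<^sup>2" by (simp add: cosh_square_eq)
      then have "sqrt (1 + (sinh r)\<^sup>2) = cosh r" by simp
      then show ?thesis by (simp only: Laplace_kernel_def arsinh_sinh_real)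
    qed
    then show ?thesis
      unfolding G_def frac[symmetric] by (simp add: scaleR_conv_of_real indicator_def)
  qed
  have FT: "has_bochner_integral lborel (\<lambda>r. exp (\<i> * of_real (s * r)) / of_real (cosh (r - w))) (exp (\<i> * of_real (s * w)) * of_real ?c)" for w :: real
  proof -
    let ?F = "\<lambda>y. exp (\<i> * of_real (s * y)) / complex_of_real (cosh y)"
    note F = has_bochner_integral_sech_Fourier[of s]
    have "integrable lborel (\<lambda>r. ?F (- w + 1 * r))"
      using F by (intro lborel_integrable_real_affine) (auto simp: has_bochner_integral_iff)
    moreover have "(LINT r|lborel. ?F (- w + 1 * r)) = of_real ?c"
      using F lborel_integral_real_affine[of 1 ?F "- w"] by (simp add: has_bochner_integral_iff)
    ultimately have "has_bochner_integral lborel (\<lambda>r. ?F (- w + 1 * r)) (of_real ?c)" by (simp add: has_bochner_integral_iff)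
    then have "has_bochner_integral lborel (\<lambda>r. exp (\<i> * of_real (s * w)) * ?F (- w + 1 * r)) (exp (\<i> * of_real (s * w)) * of_real ?c)"
      by (rule has_bochner_integral_mult_right)
    moreover have "exp (\<i> * of_real (s * w)) * ?F (- w + 1 * r) = exp (\<i> * of_real (s * r)) / of_real (cosh (r - w))" for r
      by (simp add: algebra_simps flip: exp_add)
    ultimately show ?thesis by simp
  qed
  have sechint: "integrable lborel (\<lambda>r. 1 / cosh (r - w))" for w :: real
  proof -
    have "integrable lborel (\<lambda>r. norm (exp (\<i> * of_real (s * r)) / complex_of_real (cosh (r - w))))"
      using FT[of w] by (intro integrable_norm) (simp add: has_bochner_integral_iff)
    then show ?thesis by (simp add: norm_divide norm_exp_eq_Re)
  qed
  have sinint: "has_bochner_integral lborel (\<lambda>r. sin (s * r) / cosh (r - w)) (sin (s * w) * ?c)" for w :: real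
    using has_bochner_integral_Im[OF FT[of w]] by (simp add: Im_exp Im_divide_of_real)
  define k where "k = (\<lambda>r. sin (s * r) / cosh (r - u) - sin (s * r) / cosh (r - (- u)))"
  have k: "has_bochner_integral lborel k (2 * sin (s * u) * ?c)"
    using has_bochner_integral_diff[OF sinint[of u] sinint[of "- u"]] unfolding k_def by (simp add: mult_ac)
  have keven: "k (- r) = k r" for r
  proof -
    have "- r - u = - (r + u)" "- r - (- u) = - (r - u)" by simp_all
    then have c: "cosh (- r - u) = cosh (r + u)" "cosh (- r - (- u)) = cosh (r - u)" by (simp_all only: cosh_minus)
    show ?thesis unfolding k_def c by simp
  qed
  have half: "(LINT r|lborel. indicator {0<..} r * k r) = sin (s * u) * ?c"
    using integral_even_half[of k] keven k by (simp add: has_bochner_integral_iff)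
  have intG: "integrable lborel G"
  proof (rule Bochner_Integration.integrable_bound)
    show "integrable lborel (\<lambda>r. (1 / cosh (r - u) + 1 / cosh (r - (- u))) / (2 * sinh u))"
      by (intro integrable_divide Bochner_Integration.integrable_add sechint)
    show "G \<in> borel_measurable lborel" unfolding G_def by measurable
    show "AE r in lborel. norm (G r) \<le> norm ((1 / cosh (r - u) + 1 / cosh (r - (- u))) / (2 * sinh u))"
    proof (rule AE_I2)
      fix r
      have "norm (G r) \<le> \<bar>1 / cosh (r - u) - 1 / cosh (r + u)\<bar> / (2 * sinh u)"
        using sh by (simp add: G_def norm_exp_eq_Re indicator_def)
      also have "\<dots> \<le> (1 / cosh (r - u) + 1 / cosh (r + u)) / (2 * sinh u)"
        using sh by (intro divide_right_mono abs_leI) auto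
      also have "\<dots> \<le> norm ((1 / cosh (r - u) + 1 / cosh (r - (- u))) / (2 * sinh u))" using sh by simp
      finally show "norm (G r) \<le> norm ((1 / cosh (r - u) + 1 / cosh (r - (- u))) / (2 * sinh u))" .
    qed
  qed
  have "(LINT p|lborel. ?f p) = (LINT r|lborel. G r)"
    using sub unfolding G by (simp add: set_lebesgue_integral_def)
  then have "Im (LINT p|lborel. ?f p) = (LINT r|lborel. Im (G r))"
    using integral_Im[OF intG] by simp
  also have "\<dots> = (LINT r|lborel. (- 1 / (2 * sinh u)) * (indicator {0<..} r * k r))"
    by (intro Bochner_Integration.integral_cong refl) (use sh in \<open>simp add: G_def k_def Im_exp field_simps\<close>)
  also have "\<dots> = (- 1 / (2 * sinh u)) * (sin (s * u) * ?c)"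
    unfolding half[symmetric] by (rule integral_mult_right_zero)
  finally show ?thesis using sh by simp
qed

section \<open>Orthogonality of the sines and recovery of the coefficients\<close>

lemma sin_orthogonal:
  assumes "n \<ge> 1" "m \<ge> 1"
  shows "(LINT u|lborel. indicator {0..pi} u * (sin (real n * u) * sin (real m * u))) = (if n = m then pi / 2 else 0)"
proof -
  have c: "continuous_on {0..pi} (\<lambda>u. sin (real n * u) * sin (real m * u))" by (intro continuous_intros)
  note I = set_borel_integral_eq_integral(2)[OF borel_integrable_atLeastAtMost'[OF c]]
  have s0: "sin (real k * pi) = 0" for k by simp
  have "((\<lambda>u. sin (real n * u) * sin (real m * u)) has_integral (if n = m then pi / 2 else 0)) {0..pi}"
  proof (cases "n = m")
    case True
    have n: "real n > 0" using assms by simp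
    have "((\<lambda>u. sin (real n * u) * sin (real n * u)) has_integral
      ((\<lambda>u. u / 2 - sin (2 * real n * u) / (4 * real n)) pi - (\<lambda>u. u / 2 - sin (2 * real n * u) / (4 * real n)) 0)) {0..pi}"
    proof (rule fundamental_theorem_of_calculus)
      fix u :: real
      have "cos (2 * real n * u) = 1 - 2 * (sin (real n * u))\<^sup>2"
        using cos_double_sin[of "real n * u"] by (simp add: mult.assoc)
      then have e: "1 / 2 - (cos (2 * real n * u) * (2 * real n)) / (4 * real n) = sin (real n * u) * sin (real n * u)"
        using n by (simp add: power2_eq_square field_simps)
      have "((\<lambda>u. u / 2 - sin (2 * real n * u) / (4 * real n)) has_real_derivative 1 / 2 - (cos (2 * real n * u) * (2 * real n)) / (4 * real n)) (at u within {0..pi})"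
        by (auto intro!: derivative_eq_intros)
      then show "((\<lambda>u. u / 2 - sin (2 * real n * u) / (4 * real n)) has_vector_derivative sin (real n * u) * sin (real n * u)) (at u within {0..pi})"
        unfolding e by (simp only: has_real_derivative_iff_has_vector_derivative)
    qed simp
    moreover have "sin (2 * real n * pi) = 0" using s0[of "2 * n"] by simp
    ultimately show ?thesis using True by simp
  next
    case False
    let ?d = "real n - real m" and ?s = "real n + real m"
    have d: "?d \<noteq> 0" "?s \<noteq> 0" using False assms by auto
    have "((\<lambda>u. sin (real n * u) * sin (real m * u)) has_integral
      ((\<lambda>u. sin (?d * u) / (2 * ?d) - sin (?s * u) / (2 * ?s)) pi - (\<lambda>u. sin (?d * u) / (2 * ?d) - sin (?s * u) / (2 * ?s)) 0)) {0..pi}"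
    proof (rule fundamental_theorem_of_calculus)
      fix u :: real
      have e: "(cos (?d * u) * ?d) / (2 * ?d) - (cos (?s * u) * ?s) / (2 * ?s) = sin (real n * u) * sin (real m * u)"
      proof -
        have half: "y * z / (2 * z) = y / 2" if "z \<noteq> 0" for y z :: real using that by simp
        show ?thesis
          unfolding half[OF d(1)] half[OF d(2)] sin_times_sin left_diff_distrib[of _ _ u] distrib_right[of _ _ u]
          by (rule diff_divide_distrib[symmetric])
      qed
      have "((\<lambda>u. sin (?d * u) / (2 * ?d) - sin (?s * u) / (2 * ?s)) has_real_derivative (cos (?d * u) * ?d) / (2 * ?d) - (cos (?s * u) * ?s) / (2 * ?s)) (at u within {0..pi})"
        by (intro DERIV_diff DERIV_cdivide) (auto intro!: derivative_eq_intros)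
      then show "((\<lambda>u. sin (?d * u) / (2 * ?d) - sin (?s * u) / (2 * ?s)) has_vector_derivative sin (real n * u) * sin (real m * u)) (at u within {0..pi})"
        unfolding e by (simp only: has_real_derivative_iff_has_vector_derivative)
    qed simp
    moreover have "sin (?d * pi) = 0" "sin (?s * pi) = 0" by (simp_all add: left_diff_distrib distrib_right sin_diff sin_add)
    ultimately show ?thesis using False by simp
  qed
  then show ?thesis using I by (simp add: set_lebesgue_integral_def integral_unique)
qed

lemma Omega_bound:
  assumes x: "x > 0"
  shows "\<bar>Omega n x\<bar> \<le> 4 / pi * (LINT u|lborel. \<bar>Omega_weight n u\<bar>) * (1 / (1 + x\<^sup>2))"
proof -
  let ?h = "\<lambda>u. Omega_weight n u * kernel_Laplace (2 * x * cosh u)"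
  have pos: "1 + x\<^sup>2 > 0" by (simp add: add_pos_nonneg)
  have b: "\<bar>?h u\<bar> \<le> \<bar>Omega_weight n u\<bar> * (2 * (1 / (1 + x\<^sup>2)))" for u
  proof -
    have "kernel_Laplace (2 * x * cosh u) \<ge> 0" using x by (intro kernel_Laplace_bounds(1)) simp
    then show ?thesis
      unfolding abs_mult by (simp only: abs_of_nonneg mult_left_mono[OF kernel_Laplace_le[OF x] abs_ge_zero])
  qed
  have W: "integrable lborel (\<lambda>u. \<bar>Omega_weight n u\<bar> * (2 * (1 / (1 + x\<^sup>2))))"
    by (intro integrable_mult_left integrable_abs integrable_Omega_weight)
  have I: "integrable lborel ?h"
    by (rule Bochner_Integration.integrable_bound[OF W]) (use b pos in \<open>auto simp: abs_mult\<close>)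
  have "\<bar>LINT u|lborel. ?h u\<bar> \<le> (LINT u|lborel. \<bar>?h u\<bar>)" by (rule integral_abs_bound)
  also have "\<dots> \<le> (LINT u|lborel. \<bar>Omega_weight n u\<bar> * (2 * (1 / (1 + x\<^sup>2))))"
    by (rule integral_mono[OF integrable_abs[OF I] W b])
  also have "\<dots> = (LINT u|lborel. \<bar>Omega_weight n u\<bar>) * (2 * (1 / (1 + x\<^sup>2)))" by (rule integral_mult_left_zero)
  finally have "2 / pi * \<bar>LINT u|lborel. ?h u\<bar> \<le> 2 / pi * ((LINT u|lborel. \<bar>Omega_weight n u\<bar>) * (2 * (1 / (1 + x\<^sup>2))))"
    by (intro mult_left_mono) auto
  then show ?thesis unfolding Omega_eq[OF x] by (simp add: abs_mult)
qed

text \<open>For u > 0 the x-integral has imaginary part -sin (mu) / (2 sinh u cosh (pi m / 2)),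
  whose sinh u cancels the one in \<open>Omega_weight\<close>. The constant is the product of -2/pi
  from \<open>Omega_eq\<close>, -1 / (2 cosh (pi m / 2)) and pi/2 from orthogonality.\<close>

lemma has_bochner_integral_Omega_Bessel:
  assumes n: "n \<ge> 1" and m: "m \<ge> 1"
  shows "has_bochner_integral lborel (\<lambda>x. indicator {0<..} x * (Omega n x * Im ((Bessel_imag (real m / 2) x)\<^sup>2)))
    (if n = m then 1 / (2 * cosh (pi * real m / 2)) else 0)"
proof -
  define s where "s = real m / 2"
  have s: "s \<noteq> 0" using m by (simp add: s_def)
  have pos: "1 + x\<^sup>2 > 0" for x :: real by (simp add: add_pos_nonneg)
  obtain B where B: "B \<ge> 0" "\<And>x. norm (Bessel_imag s x) \<le> B" using norm_Bessel_imag_bounded[OF s] by metis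
  let ?W = "\<lambda>x. (Bessel_imag s x)\<^sup>2"
  have WB: "norm (?W x) \<le> B\<^sup>2" for x using B by (simp add: norm_power power_mono)
  have W0: "?W x = 0" if "x \<le> 0" for x using that by (simp add: Bessel_imag_nonpos)
  define h where "h = (\<lambda>x u. (Omega_weight n u * kernel_Laplace (2 * x * cosh u)) *\<^sub>R ?W x)"
  have [measurable]: "case_prod h \<in> borel_measurable (lborel \<Otimes>\<^sub>M lborel)" unfolding h_def by measurable
  have bound: "norm (h x u) \<le> (B\<^sup>2 * (2 * (1 / (1 + x\<^sup>2)))) * \<bar>Omega_weight n u\<bar>" for x u
  proof (cases "x > 0")
    case True
    have "\<bar>kernel_Laplace (2 * x * cosh u)\<bar> \<le> 2 * (1 / (1 + x\<^sup>2))"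
      using kernel_Laplace_bounds(1)[of "2 * x * cosh u"] kernel_Laplace_le[OF True, of u] True by simp
    from mult_mono[OF mult_mono[OF WB[of x] this] order_refl[of "\<bar>Omega_weight n u\<bar>"]]
    have "norm (?W x) * \<bar>kernel_Laplace (2 * x * cosh u)\<bar> * \<bar>Omega_weight n u\<bar> \<le> (B\<^sup>2 * (2 * (1 / (1 + x\<^sup>2)))) * \<bar>Omega_weight n u\<bar>"
      using pos[of x] by simp
    then show ?thesis unfolding h_def norm_scaleR abs_mult by (simp only: mult_ac)
  qed (use pos[of x] in \<open>simp add: h_def W0 not_less\<close>)
  have ix: "integrable lborel (\<lambda>x. B\<^sup>2 * (2 * (1 / (1 + x\<^sup>2))))"
    by (intro integrable_mult_right integrable_inverse_one_plus_sq)
  have iu: "integrable lborel (\<lambda>u. \<bar>Omega_weight n u\<bar>)" by (intro integrable_abs integrable_Omega_weight)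
  have inth: "integrable (lborel \<Otimes>\<^sub>M lborel) (case_prod h)"
    by (rule integrable_prod_dominated[OF _ ix iu bound]) measurable
  define J where "J = (\<lambda>x. (indicator {0<..} x * Omega n x) *\<^sub>R ?W x)"
  have J_eq: "J x = (- (2 / pi)) *\<^sub>R (LINT u|lborel. h x u)" for x
  proof (cases "x > 0")
    case True
    have "integrable lborel (\<lambda>u. Omega_weight n u * kernel_Laplace (2 * x * cosh u))"
    proof (rule Bochner_Integration.integrable_bound[OF iu])
      show "AE u in lborel. norm (Omega_weight n u * kernel_Laplace (2 * x * cosh u)) \<le> norm \<bar>Omega_weight n u\<bar>"
        using kernel_Laplace_bounds[of "2 * x * cosh u" for u] True by (intro AE_I2) (simp add: abs_mult mult_left_le)
    qed measurable
    then have "(LINT u|lborel. h x u) = (LINT u|lborel. Omega_weight n u * kernel_Laplace (2 * x * cosh u)) *\<^sub>R ?W x"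
      unfolding h_def by (intro integral_scaleR_left)
    then show ?thesis using True by (simp add: J_def Omega_eq)
  qed (simp add: J_def h_def W0 not_less)
  have intJ: "integrable lborel J"
    unfolding J_eq[abs_def] by (intro integrable_scaleR_right lborel_pair.integrable_fst[OF inth])
  define R where "R = (\<lambda>u. LINT x|lborel. kernel_Laplace (2 * x * cosh u) *\<^sub>R ?W x)"
  have hu: "(LINT x|lborel. h x u) = Omega_weight n u *\<^sub>R R u" for u
    unfolding R_def h_def by (subst integral_scaleR_right[symmetric]) simp
  have intR: "integrable lborel (\<lambda>u. Omega_weight n u *\<^sub>R R u)"
    using lborel_pair.integrable_snd[OF inth] unfolding hu .
  have "(LINT x|lborel. J x) = (- (2 / pi)) *\<^sub>R (LINT x|lborel. LINT u|lborel. h x u)"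
    unfolding J_eq by (rule integral_scaleR_right)
  also have "(LINT x|lborel. LINT u|lborel. h x u) = (LINT u|lborel. LINT x|lborel. h x u)"
    using lborel_pair.Fubini_integral[OF inth] by simp
  also have "\<dots> = (LINT u|lborel. Omega_weight n u *\<^sub>R R u)" unfolding hu ..
  finally have "Im (LINT x|lborel. J x) = (- (2 / pi)) * (LINT u|lborel. Im (Omega_weight n u *\<^sub>R R u))"
    using integral_Im[OF intR] by simp
  also have "(LINT u|lborel. Im (Omega_weight n u *\<^sub>R R u)) =
      (LINT u|lborel. - (1 / (2 * cosh (pi * real m / 2))) * (indicator {0..pi} u * (sin (real n * u) * sin (real m * u))))"
  proof (intro integral_cong_AE)
    show "(\<lambda>u. Im (Omega_weight n u *\<^sub>R R u)) \<in> borel_measurable lborel"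
      using intR by (intro borel_measurable_integrable integrable_Im)
    show "AE u in lborel. Im (Omega_weight n u *\<^sub>R R u) = - (1 / (2 * cosh (pi * real m / 2))) * (indicator {0..pi} u * (sin (real n * u) * sin (real m * u)))"
    \<comment> \<open>The closed form needs sinh u to be nonzero; u = 0 is a null set, and for
      negative u the weight vanishes.\<close>
    proof (rule AE_I[where N="{0}"])
      have "Im (Omega_weight n u *\<^sub>R R u) = - (1 / (2 * cosh (pi * real m / 2))) * (indicator {0..pi} u * (sin (real n * u) * sin (real m * u)))" if "u \<noteq> 0" for u
      proof (cases "u > 0")
        case True
        have "Im (R u) = - pi * sin (2 * s * u) / (2 * sinh u * cosh (pi * (2 * s) / 2)) / pi"
          unfolding R_def kernel_Laplace_transform_Bessel_square[OF s cosh_real_ge_1] Im_divide_of_real Im_integral_Laplace_kernel[OF True] ..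
        then have "Im (R u) = - sin (real m * u) / (2 * sinh u * cosh (pi * real m / 2))"
          by (simp add: s_def)
        then show ?thesis using True by (simp add: Omega_weight_def)
      qed (use that in \<open>simp add: Omega_weight_def\<close>)
      then show "{u \<in> space lborel. Im (Omega_weight n u *\<^sub>R R u) \<noteq> - (1 / (2 * cosh (pi * real m / 2))) * (indicator {0..pi} u * (sin (real n * u) * sin (real m * u)))} \<subseteq> {0}"
        by blast
    qed auto
  qed measurable
  also have "\<dots> = - (1 / (2 * cosh (pi * real m / 2))) * (if n = m then pi / 2 else 0)"
    unfolding sin_orthogonal[OF n m, symmetric] by (rule integral_mult_right_zero)
  finally have "(LINT x|lborel. Im (J x)) = (if n = m then 1 / (2 * cosh (pi * real m / 2)) else 0)"
    using integral_Im[OF intJ] by simp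
  then have "has_bochner_integral lborel (\<lambda>x. Im (J x)) (if n = m then 1 / (2 * cosh (pi * real m / 2)) else 0)"
    using integrable_Im[OF intJ] by (simp add: has_bochner_integral_iff)
  then show ?thesis by (simp add: J_def s_def mult.assoc)
qed

theorem theorem5:
  fixes a :: "nat \<Rightarrow> complex" and f :: "real \<Rightarrow> complex"
  assumes summ: "summable (\<lambda>n. norm (a (Suc n)))"
    and f_def: "\<And>x. x > 0 \<Longrightarrow> f x =
        (\<Sum>n. a (Suc n) / complex_of_real (sinh (pi * real (Suc n) / 2))
               * complex_of_real (Im ((Bessel_J (\<i> * of_nat (Suc n) / 2) x) ^ 2)))"
  shows "\<forall>n\<ge>1. set_integrable lborel {0<..} (\<lambda>x. complex_of_real (Omega n x) * f x)
            \<and> a n = complex_of_real (sinh (pi * real n))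
                    * (LBINT x:{0<..}. complex_of_real (Omega n x) * f x)"
proof (intro allI impI)
  fix n :: nat assume n: "n \<ge> 1"
  define c where "c = (\<lambda>k. a (Suc k) / complex_of_real (sinh (pi * real (Suc k) / 2)))"
  define w where "w = (\<lambda>k x. Im ((Bessel_imag (real (Suc k) / 2) x)\<^sup>2))"
  define C where "C = 4 / pi * (LINT u|lborel. \<bar>Omega_weight n u\<bar>)"
  have C0: "C \<ge> 0" by (simp add: C_def)
  have pos: "1 + x\<^sup>2 > 0" for x :: real by (simp add: add_pos_nonneg)
  \<comment> \<open>For order parameter s = (k + 1)/2 the bound 2 sinh (pi s) / (pi s) carries the
    same sinh as the denominator of \<open>c k\<close>. They cancel and leave 4 / (pi (k + 1)), at
    most 4 / pi.\<close>
  have w: "norm (c k * complex_of_real (w k x)) \<le> norm (a (Suc k)) * (4 / pi)" for k x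
  proof -
    let ?s = "real (Suc k) / 2" and ?S = "sinh (pi * real (Suc k) / 2)"
    have S: "?S > 0" by simp
    have "\<bar>w k x\<bar> \<le> (norm (Bessel_imag ?s x))\<^sup>2"
      unfolding w_def norm_power[symmetric] by (rule abs_Im_le_cmod)
    also have "\<dots> \<le> 2 * sinh (pi * ?s) / (pi * ?s)" by (rule norm_Bessel_imag_sq_le) simp
    also have "\<dots> = ?S * (4 / pi / real (Suc k))" by (simp add: field_simps)
    also have "\<dots> \<le> ?S * (4 / pi / 1)"
      using S by (intro mult_left_mono divide_left_mono) auto
    finally have "\<bar>w k x\<bar> / ?S \<le> 4 / pi" using S by (simp add: pos_divide_le_eq mult.commute)
    then have "norm (a (Suc k)) * (\<bar>w k x\<bar> / ?S) \<le> norm (a (Suc k)) * (4 / pi)" by (intro mult_left_mono) auto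
    moreover have "norm (c k * complex_of_real (w k x)) = norm (a (Suc k)) * (\<bar>w k x\<bar> / ?S)"
      using S by (simp add: c_def norm_mult norm_divide)
    ultimately show ?thesis by simp
  qed
  define T where "T = (\<lambda>k x. c k * complex_of_real (indicator {0<..} x * (Omega n x * w k x)))"
  have T: "has_bochner_integral lborel (T k) (c k * of_real (if n = Suc k then 1 / (2 * cosh (pi * real (Suc k) / 2)) else 0))" for k
    unfolding T_def w_def
    by (intro has_bochner_integral_mult_right has_bochner_integral_of_real has_bochner_integral_Omega_Bessel n) simp
  have iT: "integrable lborel (T k)" for k using T by (auto simp: has_bochner_integral_iff)
  have nT: "norm (T k x) \<le> norm (a (Suc k)) * (4 / pi * C * (1 / (1 + x\<^sup>2)))" for k x
  proof (cases "x > 0")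
    case True
    have "norm (T k x) = norm (c k * complex_of_real (w k x)) * \<bar>Omega n x\<bar>"
      using True by (simp add: T_def norm_mult abs_mult mult_ac)
    also have "\<dots> \<le> (norm (a (Suc k)) * (4 / pi)) * (C * (1 / (1 + x\<^sup>2)))"
      using Omega_bound[OF True, of n] by (intro mult_mono w) (auto simp: C_def)
    finally show ?thesis by (simp only: mult.assoc)
  qed (use C0 pos[of x] in \<open>simp add: T_def\<close>)
  have sT: "summable (\<lambda>k. norm (T k x))" for x
    by (rule summable_comparison_test'[OF summable_mult2[OF summ, of "4 / pi * C * (1 / (1 + x\<^sup>2))"]]) (use nT in auto)
  have siT: "summable (\<lambda>k. LINT x|lborel. norm (T k x))"
  proof (rule summable_comparison_test'[OF summable_mult2[OF summ, of "LINT x|lborel. 4 / pi * C * (1 / (1 + x\<^sup>2))"]])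
    fix k :: nat
    have "(LINT x|lborel. norm (T k x)) \<le> (LINT x|lborel. norm (a (Suc k)) * (4 / pi * C * (1 / (1 + x\<^sup>2))))"
      by (rule integral_mono[OF integrable_norm[OF iT] _ nT]) (intro integrable_mult_right integrable_inverse_one_plus_sq)
    then show "norm (LINT x|lborel. norm (T k x)) \<le> norm (a (Suc k)) * (LINT x|lborel. 4 / pi * C * (1 / (1 + x\<^sup>2)))"
      by (simp only: integral_mult_right_zero real_norm_def abs_of_nonneg[OF integral_nonneg_AE[OF AE_I2[OF norm_ge_zero]]])
  qed
  have sum_T: "(\<Sum>k. T k x) = indicator {0<..} x *\<^sub>R (complex_of_real (Omega n x) * f x)" for x
  proof (cases "x > 0")
    case True
    have "f x = (\<Sum>k. c k * complex_of_real (w k x))"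
      unfolding f_def[OF True] c_def w_def Bessel_imag_def using True by simp
    moreover have "summable (\<lambda>k. c k * complex_of_real (w k x))"
      by (rule summable_comparison_test'[OF summable_mult2[OF summ]]) (rule w)
    ultimately have "complex_of_real (Omega n x) * f x = (\<Sum>k. complex_of_real (Omega n x) * (c k * complex_of_real (w k x)))"
      by (simp add: suminf_mult)
    then show ?thesis using True by (simp add: T_def mult_ac)
  qed (simp add: T_def)
  have int: "set_integrable lborel {0<..} (\<lambda>x. complex_of_real (Omega n x) * f x)"
    unfolding set_integrable_def sum_T[symmetric] by (rule integrable_suminf[OF iT _ siT]) (use sT in auto)
  have "(\<lambda>k. LINT x|lborel. T k x) sums (LINT x|lborel. (\<Sum>k. T k x))"
    by (rule sums_integral[OF iT _ siT]) (use sT in auto)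
  then have S1: "(\<lambda>k. LINT x|lborel. T k x) sums (LBINT x:{0<..}. complex_of_real (Omega n x) * f x)"
    unfolding sum_T set_lebesgue_integral_def .
  let ?v = "a n / complex_of_real (sinh (pi * real n))"
  have "(LINT x|lborel. T k x) = (if k = n - 1 then ?v else 0)" for k
  proof (cases "n = Suc k")
    case True
    \<comment> \<open>The factor 1 / sinh (pi n / 2) in f and the factor 1 / (2 cosh (pi n / 2))
      from the integral combine to 1 / sinh (pi n).\<close>
    have d: "sinh (pi * real n) = 2 * sinh (pi * real n / 2) * cosh (pi * real n / 2)"
      using sinh_double[of "pi * real n / 2"] by simp
    have "(LINT x|lborel. T k x) = c k * of_real (1 / (2 * cosh (pi * real (Suc k) / 2)))"
      using T[of k] True by (simp add: has_bochner_integral_iff)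
    also have "\<dots> = ?v" unfolding c_def d True[symmetric] by simp
    finally show ?thesis using True by simp
  next
    case False
    then show ?thesis using T[of k] n by (auto simp: has_bochner_integral_iff)
  qed
  \<comment> \<open>Only one term of the series is nonzero; it has index \<open>n - 1\<close>
    because the sum starts at 0 and uses \<open>a (Suc k)\<close>.\<close>
  then have "(\<lambda>k. LINT x|lborel. T k x) sums ?v"
    using sums_single[of "n - 1" "\<lambda>_. ?v"] by simp
  then have "(LBINT x:{0<..}. complex_of_real (Omega n x) * f x) = ?v" using S1 by (rule sums_unique2[symmetric])
  moreover have "sinh (pi * real n) \<noteq> 0" using n by simp
  ultimately show "set_integrable lborel {0<..} (\<lambda>x. complex_of_real (Omega n x) * f x)
            \<and> a n = complex_of_real (sinh (pi * real n))
                    * (LBINT x:{0<..}. complex_of_real (Omega n x) * f x)"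
    using int by simp
qed

end
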